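(* Let $p$ be a prime and let $G$ be a finite $p$-solvable group. If all elements of $G$ of order $p$, and also all elements of order $4$ in case $p=2$, lie in $N^{\infty}_{\mathscr{U}_p}(G)$, then $h_p(G)\leq 3$.
   Context: All groups are finite. A group is $p$-solvable if each of its chief factors is a $p$-group or a $p'$-group, and $p$-supersolvable if each of its chief factors is either of order $p$ or a $p'$-group. $\mathscr{U}_p$ is the class of $p$-supersolvable groups. For a group $T$, $T^{\mathscr{U}_p}$ is the intersection of all normal subgroups $N$ of $T$ with $T/N\in\mathscr{U}_p$. Put $N_{\mathscr{U}_p}(G)=\bigcap_{T\le G}N_G(T^{\mathscr{U}_p})$, over all subgroups $T$ of $G$; set $N^0_{\mathscr{U}_p}(G)=1$ and $N^{i+1}_{\mathscr{U}_p}(G)/N^{i}_{\mathscr{U}_p}(G)=N_{\mathscr{U}_p}(G/N^{i}_{\mathscr{U}_p}(G))$; $N^{\infty}_{\mathscr{U}_p}(G)$ is the terminal term of this ascending series. $F_p(G)=O_{p'p}(G)$ is the $p$-Fitting subgroup (the largest normal $p$-nilpotent subgroup). For $p$-solvable $G$, the $p$-Fitting length $h_p(G)$ is the smallest positive integer $n$ with $F_p^n(G)=G$, where $F_p^0(G)=1$, $F_p^1(G)=F_p(G)$ and $F_p^{i+1}(G)/F_p^i(G)=F_p(G/F_p^i(G))$. *)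

theory Defs
  imports "HOL-Algebra.Algebra"
begin

text \<open>
  A subgroup \<open>T\<close> of \<open>G\<close>, seen as a group, is \<open>G\<lparr>carrier := T\<rparr>\<close>. All notions below are meant for
  finite groups; finiteness of \<open>G\<close> passes to its subgroups and quotients.
\<close>

definition p_group :: "nat \<Rightarrow> ('a, 'b) monoid_scheme \<Rightarrow> bool" where
  "p_group p G \<longleftrightarrow> (\<exists>n. order G = p ^ n)"

definition p'_group :: "nat \<Rightarrow> ('a, 'b) monoid_scheme \<Rightarrow> bool" where
  "p'_group p G \<longleftrightarrow> \<not> p dvd order G"

definition minimal_normal :: "'a set \<Rightarrow> ('a, 'b) monoid_scheme \<Rightarrow> bool" where
  "minimal_normal M G \<longleftrightarrow>
     M \<lhd> G \<and> M \<noteq> {\<one>\<^bsub>G\<^esub>} \<and> (\<forall>L. L \<lhd> G \<and> L \<subseteq> M \<longrightarrow> L = {\<one>\<^bsub>G\<^esub>} \<or> L = M)"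

text \<open>\<open>chief_factor G H K\<close>: the section \<open>H/K\<close> is a chief factor of \<open>G\<close>.\<close>

definition chief_factor :: "('a, 'b) monoid_scheme \<Rightarrow> 'a set \<Rightarrow> 'a set \<Rightarrow> bool" where
  "chief_factor G H K \<longleftrightarrow>
     K \<lhd> G \<and> H \<lhd> G \<and> K \<subseteq> H \<and> minimal_normal (carrier (G\<lparr>carrier := H\<rparr> Mod K)) (G Mod K)"

definition p_solvable :: "nat \<Rightarrow> ('a, 'b) monoid_scheme \<Rightarrow> bool" where
  "p_solvable p G \<longleftrightarrow>
     (\<forall>H K. chief_factor G H K \<longrightarrow>
        p_group p (G\<lparr>carrier := H\<rparr> Mod K) \<or> p'_group p (G\<lparr>carrier := H\<rparr> Mod K))"

definition p_supersolvable :: "nat \<Rightarrow> ('a, 'b) monoid_scheme \<Rightarrow> bool" where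
  "p_supersolvable p G \<longleftrightarrow>
     (\<forall>H K. chief_factor G H K \<longrightarrow>
        order (G\<lparr>carrier := H\<rparr> Mod K) = p \<or> p'_group p (G\<lparr>carrier := H\<rparr> Mod K))"

text \<open>The residual \<open>T\<^sup>U\<close> for the class \<open>U\<close> of \<open>p\<close>-supersolvable groups.\<close>

definition U_residual :: "nat \<Rightarrow> ('a, 'b) monoid_scheme \<Rightarrow> 'a set" where
  "U_residual p T = \<Inter>{N. N \<lhd> T \<and> p_supersolvable p (T Mod N)}"

definition N_U :: "nat \<Rightarrow> ('a, 'b) monoid_scheme \<Rightarrow> 'a set" where
  "N_U p G = \<Inter>{normalizer G (U_residual p (G\<lparr>carrier := T\<rparr>)) |T. subgroup T G}"

text \<open>For a set \<open>Q\<close> of cosets of \<open>N\<close>, its preimage under the projection \<open>G \<rightarrow> G/N\<close>; if \<open>Q\<close> is a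
  subgroup of \<open>G/N\<close>, this is the subgroup \<open>M \<supseteq> N\<close> with \<open>M/N = Q\<close>.\<close>

definition quotient_preimage :: "('a, 'b) monoid_scheme \<Rightarrow> 'a set \<Rightarrow> 'a set set \<Rightarrow> 'a set" where
  "quotient_preimage G N Q = {x \<in> carrier G. N #>\<^bsub>G\<^esub> x \<in> Q}"

primrec N_U_series :: "nat \<Rightarrow> ('a, 'b) monoid_scheme \<Rightarrow> nat \<Rightarrow> 'a set" where
  "N_U_series p G 0 = {\<one>\<^bsub>G\<^esub>}"
| "N_U_series p G (Suc i) =
     quotient_preimage G (N_U_series p G i) (N_U p (G Mod N_U_series p G i))"

text \<open>The terminal term: in a finite group the ascending series becomes stationary, and it is
  constant from the first repetition on.\<close>

definition N_U_infinity :: "nat \<Rightarrow> ('a, 'b) monoid_scheme \<Rightarrow> 'a set" where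
  "N_U_infinity p G = N_U_series p G (LEAST i. N_U_series p G (Suc i) = N_U_series p G i)"

text \<open>The largest normal \<open>p\<close>-subgroup and the largest normal \<open>p'\<close>-subgroup, each as the product of
  all normal subgroups of that kind.\<close>

definition O_p :: "nat \<Rightarrow> ('a, 'b) monoid_scheme \<Rightarrow> 'a set" where
  "O_p p G = generate G (\<Union>{N. N \<lhd> G \<and> p_group p (G\<lparr>carrier := N\<rparr>)})"

definition O_p' :: "nat \<Rightarrow> ('a, 'b) monoid_scheme \<Rightarrow> 'a set" where
  "O_p' p G = generate G (\<Union>{N. N \<lhd> G \<and> p'_group p (G\<lparr>carrier := N\<rparr>)})"

text \<open>The \<open>p\<close>-Fitting subgroup \<open>O\<^sub>p\<^sub>'\<^sub>p(G)\<close>, given by \<open>O\<^sub>p\<^sub>'\<^sub>p(G)/O\<^sub>p\<^sub>'(G) = O\<^sub>p(G/O\<^sub>p\<^sub>'(G))\<close>.\<close>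

definition F_p :: "nat \<Rightarrow> ('a, 'b) monoid_scheme \<Rightarrow> 'a set" where
  "F_p p G = quotient_preimage G (O_p' p G) (O_p p (G Mod O_p' p G))"

fun F_p_series :: "nat \<Rightarrow> ('a, 'b) monoid_scheme \<Rightarrow> nat \<Rightarrow> 'a set" where
  "F_p_series p G 0 = {\<one>\<^bsub>G\<^esub>}"
| "F_p_series p G (Suc 0) = F_p p G"
| "F_p_series p G (Suc (Suc i)) =
     quotient_preimage G (F_p_series p G (Suc i)) (F_p p (G Mod F_p_series p G (Suc i)))"

text \<open>Only meaningful for finite \<open>p\<close>-solvable \<open>G\<close>, where such an \<open>n\<close> exists.\<close>

definition p_Fitting_length :: "nat \<Rightarrow> ('a, 'b) monoid_scheme \<Rightarrow> nat" where
  "p_Fitting_length p G = (LEAST n. 0 < n \<and> F_p_series p G n = carrier G)"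

end

theory Submission
  imports Defs
begin

text \<open>
  Let \<open>U\<close> be the class of \<open>p\<close>-supersolvable groups, \<open>R\<close> the residual of \<open>G\<close> for \<open>U\<close>, and \<open>K\<close> the terminal term
  of the ascending series of the subgroups \<open>N_U\<close>. The bound follows from a normal series
  \<open>1 \<le> R \<le> D \<le> G\<close> in which \<open>R\<close> and \<open>D/R\<close> are \<open>p\<close>-nilpotent and \<open>G/D\<close> is a \<open>p'\<close>-group, because the
  \<open>F_p\<close>-series grows at least as fast as any normal series with \<open>p\<close>-nilpotent factors (\<open>F_p_step\<close>).

  The two upper factors exist for every \<open>G\<close>. Let \<open>D\<close> be the intersection of the centralizers of
  all chief factors of order \<open>p\<close> above \<open>R\<close>. A \<open>p\<close>-element has a nontrivial fixed point on a group of order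
  \<open>p\<close> and hence centralizes it, so \<open>D\<close> contains all \<open>p\<close>-elements (\<open>p_chief_centralizers_p'_index\<close>). The
  chief factors of \<open>G\<close> between \<open>R\<close> and \<open>D\<close> are \<open>p'\<close>-groups or central in \<open>D\<close>, and splitting off the central
  ones by Schur-Zassenhaus makes \<open>D/R\<close> a \<open>p\<close>-nilpotent group (\<open>p_nilpotent_section\<close>).

  That \<open>R\<close> is \<open>p\<close>-nilpotent is where \<open>K\<close> enters, and the heart of the matter is that \<open>R\<close> centralizes every
  chief factor \<open>H/L\<close> of \<open>G\<close> that is a \<open>p\<close>-group below \<open>K\<close>. After passing along the series one may assume
  that \<open>H\<close> normalizes the residual modulo \<open>L\<close> of each subgroup \<open>T\<close> containing \<open>L\<close>. Put
  \<open>C = C\<^sub>G(H/L)\<close> and choose \<open>T\<close> minimal with \<open>TC = G\<close>. Then \<open>H \<inter> T\<close> is normal in \<open>G\<close>. If \<open>H \<inter> T = L\<close>,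
  the residual of \<open>T\<close> and \<open>H\<close> normalize each other and meet in \<open>L\<close>, so the residual lies in \<open>C\<close> and
  \<open>G/C \<cong> T/(T \<inter> C)\<close> is in \<open>U\<close>, which is the claim. The other case, \<open>H \<le> T\<close>, is impossible unless
  \<open>C = G\<close>: let \<open>B/(T \<inter> C)\<close> be a minimal normal subgroup of \<open>T/(T \<inter> C)\<close>. It is not a \<open>p\<close>-group, because it acts
  faithfully on the irreducible \<open>p\<close>-group \<open>H/L\<close>. So it is a \<open>p'\<close>-group. As \<open>T\<close> is minimal, \<open>T \<inter> C\<close> behaves like
  a Frattini subgroup, and by the Schur-Zassenhaus theorem with the Frattini argument \<open>B\<close> is covered by
  some \<open>A\<close> normal in \<open>T\<close> with \<open>A/L\<close> a \<open>p'\<close>-group. Now \<open>A\<close> and \<open>H\<close> normalize each other and meet in \<open>L\<close>, so \<open>A\<close>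
  lies in \<open>C\<close>, a contradiction (\<open>residual_centralizes_normalizing_chief_factor\<close>).

  Finally let \<open>L\<close> be the largest \<open>p'\<close>-subgroup of \<open>R\<close> that is normal in \<open>G\<close>, and \<open>P/L\<close> the largest \<open>p\<close>-subgroup of
  \<open>R/L\<close> that is normal in \<open>G/L\<close>. Then \<open>P/L\<close> contains its centralizer in \<open>R/L\<close> (Hall and Higman). A
  \<open>p'\<close>-element of \<open>R\<close> centralizes all \<open>p\<close>-chief factors below \<open>K \<inter> P\<close>, so by coprime action it centralizes
  \<open>K \<inter> P\<close> modulo \<open>L\<close>, and there lie representatives of all elements of \<open>P/L\<close> of order \<open>p\<close>, and of order \<open>4\<close> if
  \<open>p = 2\<close>. A \<open>p'\<close>-automorphism of a \<open>p\<close>-group that fixes all those elements is trivial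
  (\<open>p'_automorphism_trivial\<close>), so the \<open>p'\<close>-element lies in \<open>P\<close> and hence in \<open>L\<close>, and \<open>R/L\<close> is a \<open>p\<close>-group.

  A section \<open>H/K\<close> is represented below by the pair of subgroups \<open>K \<subseteq> H\<close> of the one group \<open>G\<close>, and the
  residual of \<open>T/N\<close> by its preimage \<open>residual_above p T N\<close>. So \<open>L\<close> and \<open>H\<close> stay fixed while \<open>T\<close> varies, and
  all residuals are compared inside \<open>G\<close>.
\<close>

section \<open>Indices that are powers of a prime or prime to it\<close>

text \<open>
  The index is written multiplicatively, without division, so that the two predicates compose
  along a chain and can be transported between groups of different types.
\<close>

definition p_index :: "nat \<Rightarrow> 'a set \<Rightarrow> 'b set \<Rightarrow> bool" where
  "p_index p K H \<longleftrightarrow> (\<exists>k. card H = p ^ k * card K)"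

definition p'_index :: "nat \<Rightarrow> 'a set \<Rightarrow> 'b set \<Rightarrow> bool" where
  "p'_index p K H \<longleftrightarrow> (\<exists>k. \<not> p dvd k \<and> card H = k * card K)"

lemma p_index_refl [simp]: "p_index p K K"
  unfolding p_index_def by (rule exI[of _ 0]) simp

lemma p_index_trans: "p_index p A B \<Longrightarrow> p_index p B C \<Longrightarrow> p_index p A C"
proof -
  assume "p_index p A B" "p_index p B C"
  then obtain j k where "card B = p ^ j * card A" "card C = p ^ k * card B"
    unfolding p_index_def by blast
  then have "card C = p ^ (k + j) * card A" by (simp add: power_add)
  then show ?thesis unfolding p_index_def by blast
qed

lemma p'_index_refl: "Factorial_Ring.prime p \<Longrightarrow> p'_index p K K"
  unfolding p'_index_def by (rule exI[of _ 1]) (auto simp: prime_nat_iff)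

lemma p'_index_trans:
  "Factorial_Ring.prime p \<Longrightarrow> p'_index p A B \<Longrightarrow> p'_index p B C \<Longrightarrow> p'_index p A C"
proof -
  assume p: "Factorial_Ring.prime p" and "p'_index p A B" "p'_index p B C"
  then obtain j k where "\<not> p dvd j" "\<not> p dvd k" "card B = j * card A" "card C = k * card B"
    unfolding p'_index_def by blast
  then have "\<not> p dvd k * j" "card C = (k * j) * card A"
    using p by (simp_all add: prime_dvd_mult_iff)
  then show ?thesis unfolding p'_index_def by blast
qed

text \<open>
  The index of \<open>K\<close> in \<open>H\<close> is \<open>u * v\<close>, so a section of index \<open>u\<close> inherits its shape. This one
  computation serves for intermediate subgroups, images and kernels alike.
\<close>

lemma index_factor:
  assumes "Factorial_Ring.prime p" "card H = u * v * card K"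
    and "card A > 0" "card B = u * card A"
  shows "p_index p K H \<Longrightarrow> card K > 0 \<Longrightarrow> p_index p A B"
    and "p'_index p K H \<Longrightarrow> card K > 0 \<Longrightarrow> p'_index p A B"
proof -
  assume "p_index p K H" "card K > 0"
  then obtain k where "u * v = p ^ k" using assms(2) by (auto simp: p_index_def)
  then have "u dvd p ^ k" by (metis dvd_triv_left)
  then obtain j where "u = p ^ j"
    using divides_primepow_nat[OF assms(1)] by blast
  then show "p_index p A B" using assms(4) by (auto simp: p_index_def)
next
  assume "p'_index p K H" "card K > 0"
  then obtain k where "u * v = k" "\<not> p dvd k" using assms(2) by (auto simp: p'_index_def)
  then have "\<not> p dvd u" by auto
  then show "p'_index p A B" using assms(4) by (auto simp: p'_index_def)
qed

lemma p_and_p'_index: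
  assumes "Factorial_Ring.prime p" "p_index p K H" "p'_index p K H" "card K > 0"
  shows "card H = card K"
proof -
  obtain j k where jk: "card H = p ^ j * card K" "\<not> p dvd k" "card H = k * card K"
    using assms by (auto simp: p_index_def p'_index_def)
  then have "p ^ j = k" using assms(4) by auto
  with jk have "j = 0" by (cases j) auto
  with jk show ?thesis by simp
qed

section \<open>Finite groups and the correspondence under homomorphisms\<close>

locale finite_group = group G for G (structure) +
  assumes fin [simp, intro]: "finite (carrier G)"
begin

lemma finite_subset_carrier: "A \<subseteq> carrier G \<Longrightarrow> finite A"
  by (rule finite_subset[OF _ fin])

lemma card_subgroup_pos: "subgroup A G \<Longrightarrow> card A > 0"
  using finite_subset_carrier[of A] subgroup.subset[of A G] subgroup.one_closed[of A G]
  by (auto simp: card_gt_0_iff)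

lemma card_subgroup_dvd:
  assumes "subgroup A G" "subgroup B G" "A \<subseteq> B"
  shows "card A dvd card B"
proof -
  have "subgroup A (G\<lparr>carrier := B\<rparr>)" by (rule subgroup_incl[OF assms])
  moreover have "group (G\<lparr>carrier := B\<rparr>)" by (rule subgroup_imp_group[OF assms(2)])
  ultimately have "card (rcosets\<^bsub>G\<lparr>carrier := B\<rparr>\<^esub> A) * card A = order (G\<lparr>carrier := B\<rparr>)"
    by (rule group.lagrange[rotated])
  then have "card B = card (rcosets\<^bsub>G\<lparr>carrier := B\<rparr>\<^esub> A) * card A" by (simp add: order_def)
  then show ?thesis by simp
qed

lemma finite_group_subgroup: "subgroup T G \<Longrightarrow> finite_group (G\<lparr>carrier := T\<rparr>)"
  by (simp add: finite_group_def finite_group_axioms_def subgroup_imp_group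
      finite_subset_carrier subgroup.subset)

lemma finite_group_Mod: "N \<lhd> G \<Longrightarrow> finite_group (G Mod N)"
  by (simp add: finite_group_def finite_group_axioms_def normal.factorgroup_is_group carrier_FactGroup)

lemma index_between:
  assumes "Factorial_Ring.prime p" "subgroup A G" "subgroup B G" "subgroup C G" "A \<subseteq> B" "B \<subseteq> C"
  shows "p_index p A C \<Longrightarrow> p_index p A B" "p_index p A C \<Longrightarrow> p_index p B C"
    and "p'_index p A C \<Longrightarrow> p'_index p A B" "p'_index p A C \<Longrightarrow> p'_index p B C"
proof -
  obtain u v where uv: "card B = u * card A" "card C = v * card B"
    using card_subgroup_dvd[OF assms(2,3,5)] card_subgroup_dvd[OF assms(3,4,6)]
    by (metis dvdE mult.commute)
  have pos: "card A > 0" "card B > 0" using assms(2,3) card_subgroup_pos by blast+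
  have *: "card C = u * v * card A" "card C = v * u * card A" using uv by simp_all
  show "p_index p A C \<Longrightarrow> p_index p A B" "p_index p A C \<Longrightarrow> p_index p B C"
    "p'_index p A C \<Longrightarrow> p'_index p A B" "p'_index p A C \<Longrightarrow> p'_index p B C"
    using index_factor[OF assms(1) *(1) pos(1) uv(1)] index_factor[OF assms(1) *(2) pos(2) uv(2)] pos
    by blast+
qed

end

locale finite_group_hom = group_hom G Q \<phi> for G (structure) and Q (structure) and \<phi> +
  assumes finG: "finite (carrier G)"
begin

sublocale G: finite_group G by unfold_locales (rule finG)

abbreviation "ker \<equiv> kernel G Q \<phi>"

text \<open>
  All fibres of the restriction to \<open>A\<close> are cosets of \<open>A \<inter> ker\<close>.
\<close>

lemma card_fibres:
  assumes A: "subgroup A G"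
  shows "card A = card (\<phi> ` A) * card (A \<inter> ker)"
proof -
  have f: "finite A" using G.finite_subset_carrier[OF subgroup.subset[OF A]] .
  interpret A: subgroup A G by (rule A)
  have *: "card {a \<in> A. \<phi> a = y} = card (A \<inter> ker)" if y: "y \<in> \<phi> ` A" for y
  proof -
    obtain a where a: "a \<in> A" "y = \<phi> a" using y by blast
    have "bij_betw (\<lambda>x. a \<otimes> x) (A \<inter> ker) {b \<in> A. \<phi> b = y}"
    proof (rule bij_betw_byWitness[where f' = "\<lambda>x. inv a \<otimes> x"])
      show "\<forall>x\<in>A \<inter> ker. inv a \<otimes> (a \<otimes> x) = x"
        using a by (auto simp: G.m_assoc[symmetric])
      show "\<forall>x\<in>{b \<in> A. \<phi> b = y}. a \<otimes> (inv a \<otimes> x) = x"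
        using a by (auto simp: G.m_assoc[symmetric])
      show "(\<otimes>) a ` (A \<inter> ker) \<subseteq> {b \<in> A. \<phi> b = y}"
        using a by (auto simp: kernel_def)
      show "(\<otimes>) (inv a) ` {b \<in> A. \<phi> b = y} \<subseteq> A \<inter> ker"
        using a by (auto simp: kernel_def)
    qed
    then show ?thesis by (metis bij_betw_same_card)
  qed
  have "card A = (\<Sum>a\<in>A. 1)" by simp
  also have "\<dots> = (\<Sum>y\<in>\<phi> ` A. \<Sum>a\<in>{a \<in> A. \<phi> a = y}. 1)"
    by (rule sum.image_gen[OF f])
  also have "\<dots> = (\<Sum>y\<in>\<phi> ` A. card (A \<inter> ker))" using * by simp
  finally show ?thesis by simp
qed

text \<open>
  By \<open>card_fibres\<close> the index of \<open>A\<close> in \<open>B\<close> is the product of the index of the images and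
  that of the intersections with the kernel.
\<close>

lemma index_image:
  assumes p: "Factorial_Ring.prime p" and A: "subgroup A G" and B: "subgroup B G" and AB: "A \<subseteq> B"
  shows "p_index p A B \<Longrightarrow> p_index p (\<phi> ` A) (\<phi> ` B)"
    and "p'_index p A B \<Longrightarrow> p'_index p (\<phi> ` A) (\<phi> ` B)"
    and "p_index p A B \<Longrightarrow> p_index p (A \<inter> ker) (B \<inter> ker)"
    and "p'_index p A B \<Longrightarrow> p'_index p (A \<inter> ker) (B \<inter> ker)"
proof -
  have k: "subgroup (A \<inter> ker) G" "subgroup (B \<inter> ker) G"
    using G.subgroups_Inter_pair[OF A subgroup_kernel] G.subgroups_Inter_pair[OF B subgroup_kernel] .
  have dk: "card (A \<inter> ker) dvd card (B \<inter> ker)"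
    using G.card_subgroup_dvd[OF k] AB by auto
  have im: "subgroup (\<phi> ` A) Q" "subgroup (\<phi> ` B) Q" using A B subgroup_img_is_subgroup by auto
  interpret Q: finite_group "Q\<lparr>carrier := \<phi> ` B\<rparr>"
    using H.subgroup_imp_group[OF im(2)] G.finite_subset_carrier[OF subgroup.subset[OF B]]
    by (simp add: finite_group_def finite_group_axioms_def)
  have d: "card (\<phi> ` A) dvd card (\<phi> ` B)"
  proof (rule Q.card_subgroup_dvd)
    show "subgroup (\<phi> ` A) (Q\<lparr>carrier := \<phi> ` B\<rparr>)" by (rule H.subgroup_incl[OF im]) (use AB in auto)
    show "subgroup (\<phi> ` B) (Q\<lparr>carrier := \<phi> ` B\<rparr>)" by (rule H.subgroup_incl[OF im(2) im(2)]) simp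
  qed (use AB in auto)
  obtain u where u: "card (\<phi> ` B) = u * card (\<phi> ` A)" using d by (metis dvdE mult.commute)
  obtain v where v: "card (B \<inter> ker) = v * card (A \<inter> ker)" using dk by (metis dvdE mult.commute)
  have *: "card B = u * v * card A" "card B = v * u * card A"
    using card_fibres[OF A] card_fibres[OF B] u v by auto
  have pA: "card A > 0" "card (A \<inter> ker) > 0" using A k G.card_subgroup_pos by auto
  have pi: "card (\<phi> ` A) > 0" using pA(1) card_fibres[OF A] by auto
  show "p_index p A B \<Longrightarrow> p_index p (\<phi> ` A) (\<phi> ` B)"
    "p'_index p A B \<Longrightarrow> p'_index p (\<phi> ` A) (\<phi> ` B)"
    "p_index p A B \<Longrightarrow> p_index p (A \<inter> ker) (B \<inter> ker)"
    "p'_index p A B \<Longrightarrow> p'_index p (A \<inter> ker) (B \<inter> ker)"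
    using index_factor[OF p *(1) pi u] index_factor[OF p *(2) pA(2) v] pA by blast+
qed

lemma card_image_above_ker:
  assumes "subgroup A G" "ker \<subseteq> A"
  shows "card A = card (\<phi> ` A) * card ker"
  using card_fibres[OF assms(1)] assms(2) by (simp add: Int_absorb1)

lemma ker_pos: "card ker > 0"
  using G.card_subgroup_pos subgroup_kernel by blast

lemma index_above_ker:
  assumes "subgroup A G" "ker \<subseteq> A" "subgroup B G" "ker \<subseteq> B"
  shows "card B = n * card A \<longleftrightarrow> card (\<phi> ` B) = n * card (\<phi> ` A)"
    and "p_index p (\<phi> ` A) (\<phi> ` B) \<longleftrightarrow> p_index p A B"
    and "p'_index p (\<phi> ` A) (\<phi> ` B) \<longleftrightarrow> p'_index p A B"
proof -
  have *: "card B = n * card A \<longleftrightarrow> card (\<phi> ` B) = n * card (\<phi> ` A)" for n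
  proof -
    have "card B = n * card A \<longleftrightarrow> card (\<phi> ` B) * card ker = (n * card (\<phi> ` A)) * card ker"
      using card_image_above_ker assms by (metis mult.assoc)
    also have "\<dots> \<longleftrightarrow> card (\<phi> ` B) = n * card (\<phi> ` A)" using ker_pos by (simp only: mult_cancel2) auto
    finally show ?thesis .
  qed
  then show "card B = n * card A \<longleftrightarrow> card (\<phi> ` B) = n * card (\<phi> ` A)"
    "p_index p (\<phi> ` A) (\<phi> ` B) \<longleftrightarrow> p_index p A B"
    "p'_index p (\<phi> ` A) (\<phi> ` B) \<longleftrightarrow> p'_index p A B"
    by (auto simp: p_index_def p'_index_def)
qed

definition preimg :: "'c set \<Rightarrow> 'a set" where "preimg Y = {x \<in> carrier G. \<phi> x \<in> Y}"

lemma preimg_subgroup: "subgroup Y Q \<Longrightarrow> subgroup (preimg Y) G"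
  unfolding preimg_def by (auto intro!: G.subgroupI simp: subgroup_def)

lemma ker_subset_preimg: "subgroup Y Q \<Longrightarrow> ker \<subseteq> preimg Y"
  unfolding preimg_def kernel_def by (auto simp: subgroup_def)

lemma preimg_normal: "Y \<lhd> Q \<Longrightarrow> preimg Y \<lhd> G"
  unfolding G.normal_inv_iff H.normal_inv_iff
  by (auto simp: preimg_subgroup) (auto simp: preimg_def)

lemma image_preimg: "Y \<subseteq> \<phi> ` carrier G \<Longrightarrow> \<phi> ` preimg Y = Y"
  unfolding preimg_def by auto

lemma preimg_image:
  assumes A: "subgroup A G" and kA: "ker \<subseteq> A"
  shows "preimg (\<phi> ` A) = A"
proof
  interpret A: subgroup A G by (rule A)
  show "preimg (\<phi> ` A) \<subseteq> A"
  proof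
    fix x assume "x \<in> preimg (\<phi> ` A)"
    then obtain a where a: "x \<in> carrier G" "a \<in> A" "\<phi> x = \<phi> a" by (auto simp: preimg_def)
    then have "x \<otimes> inv a \<in> ker" by (auto simp: kernel_def)
    then have "x \<otimes> inv a \<otimes> a \<in> A" using kA a by auto
    then show "x \<in> A" using a by (simp add: G.m_assoc)
  qed
  show "A \<subseteq> preimg (\<phi> ` A)" by (auto simp: preimg_def)
qed

lemma image_normal: "A \<lhd> G \<Longrightarrow> \<phi> ` carrier G = carrier Q \<Longrightarrow> \<phi> ` A \<lhd> Q"
proof -
  assume A: "A \<lhd> G" and s: "\<phi> ` carrier G = carrier Q"
  then have "subgroup A G" by (simp add: normal_imp_subgroup)
  then interpret A: subgroup A G .
  have "\<phi> x \<otimes>\<^bsub>Q\<^esub> \<phi> a \<otimes>\<^bsub>Q\<^esub> inv\<^bsub>Q\<^esub> \<phi> x \<in> \<phi> ` A" if "x \<in> carrier G" "a \<in> A" for x a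
  proof -
    have "\<phi> x \<otimes>\<^bsub>Q\<^esub> \<phi> a \<otimes>\<^bsub>Q\<^esub> inv\<^bsub>Q\<^esub> \<phi> x = \<phi> (x \<otimes> a \<otimes> inv x)" using that by simp
    moreover have "x \<otimes> a \<otimes> inv x \<in> A" using A that G.normal_inv_iff by blast
    ultimately show ?thesis by auto
  qed
  then show ?thesis unfolding H.normal_inv_iff using s subgroup_img_is_subgroup[of A] A.subgroup_axioms
    by (auto simp: s[symmetric])
qed

end

section \<open>Commutation modulo a normal subgroup, products and chief steps\<close>

definition commute_mod :: "('a, 'b) monoid_scheme \<Rightarrow> 'a set \<Rightarrow> 'a \<Rightarrow> 'a \<Rightarrow> bool" where
  "commute_mod G L g h \<longleftrightarrow> L #>\<^bsub>G\<^esub> (g \<otimes>\<^bsub>G\<^esub> h) = L #>\<^bsub>G\<^esub> (h \<otimes>\<^bsub>G\<^esub> g)"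

definition section_centralizer :: "('a, 'b) monoid_scheme \<Rightarrow> 'a set \<Rightarrow> 'a set \<Rightarrow> 'a set" where
  "section_centralizer G H L = {g \<in> carrier G. \<forall>h\<in>H. commute_mod G L g h}"

text \<open>
  \<open>H/K\<close> is a chief factor of \<open>G\<close> (\<open>chief_factor_iff\<close>).
\<close>

definition chief_step :: "('a, 'b) monoid_scheme \<Rightarrow> 'a set \<Rightarrow> 'a set \<Rightarrow> bool" where
  "chief_step G K H \<longleftrightarrow> K \<lhd> G \<and> H \<lhd> G \<and> K \<subset> H \<and>
     (\<forall>L. L \<lhd> G \<and> K \<subseteq> L \<and> L \<subseteq> H \<longrightarrow> L = K \<or> L = H)"

text \<open>
  The premise says that the sections \<open>H/K\<close> and \<open>H'/K'\<close> have the same order.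
\<close>

lemma index_cong:
  assumes "card H * card K' = card H' * card K" "card K > 0" "card K' > 0"
  shows "card H = n * card K \<longleftrightarrow> card H' = n * card K'"
    and "p_index p K H \<longleftrightarrow> p_index p K' H'" and "p'_index p K H \<longleftrightarrow> p'_index p K' H'"
proof -
  have *: "card H = n * card K \<longleftrightarrow> card H' = n * card K'" for n
  proof
    assume "card H = n * card K"
    then have "(n * card K') * card K = card H' * card K" using assms(1) by (simp add: ac_simps)
    then show "card H' = n * card K'" using assms by simp
  next
    assume "card H' = n * card K'"
    then have "card H * card K' = (n * card K) * card K'" using assms(1) by (simp add: ac_simps)
    then show "card H = n * card K" using assms by simp
  qed
  then show "card H = n * card K \<longleftrightarrow> card H' = n * card K'"
    "p_index p K H \<longleftrightarrow> p_index p K' H'" "p'_index p K H \<longleftrightarrow> p'_index p K' H'"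
    unfolding p_index_def p'_index_def by simp_all
qed

context finite_group
begin

lemma normal_subset: "N \<lhd> G \<Longrightarrow> N \<subseteq> carrier G"
  by (simp add: normal_imp_subgroup subgroup.subset)

lemma normal_conj: "N \<lhd> G \<Longrightarrow> x \<in> carrier G \<Longrightarrow> n \<in> N \<Longrightarrow> x \<otimes> n \<otimes> inv x \<in> N"
  using normal_inv_iff by blast

lemma card_normal_pos: "N \<lhd> G \<Longrightarrow> card N > 0"
  by (simp add: card_subgroup_pos normal_imp_subgroup)

lemma rcos_eq_iff:
  assumes "subgroup L G" "x \<in> carrier G" "y \<in> carrier G"
  shows "L #> x = L #> y \<longleftrightarrow> x \<otimes> inv y \<in> L"
proof -
  interpret L: subgroup L G by (rule assms)
  show ?thesis
  proof
    assume "L #> x = L #> y"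
    then have "x \<in> L #> y" using assms rcos_self by blast
    then show "x \<otimes> inv y \<in> L" using L.rcos_module_imp[OF is_group assms(3)] by simp
  next
    assume "x \<otimes> inv y \<in> L"
    then have "x \<in> L #> y" using L.rcos_module_rev[OF is_group] assms by simp
    then show "L #> x = L #> y" using repr_independence[OF _ assms(3,1)] by simp
  qed
qed

lemma Mod_hom:
  assumes N: "N \<lhd> G"
  shows "finite_group_hom G (G Mod N) ((#>) N)"
    and "kernel G (G Mod N) ((#>) N) = N"
    and "(#>) N ` carrier G = carrier (G Mod N)"
proof -
  interpret N: normal N G by (rule N)
  show "finite_group_hom G (G Mod N) ((#>) N)"
    unfolding finite_group_hom_def finite_group_hom_axioms_def group_hom_def group_hom_axioms_def
    using N.factorgroup_is_group N.r_coset_hom_Mod by auto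
  have "N #> x = N \<longleftrightarrow> x \<in> N" if "x \<in> carrier G" for x
    using that N.subgroup_axioms coset_join1[of N x] coset_join2[OF that] by blast
  then show "kernel G (G Mod N) ((#>) N) = N"
    using N.subset by (auto simp: kernel_def)
  show "(#>) N ` carrier G = carrier (G Mod N)" by (simp add: carrier_FactGroup)
qed

lemma Mod_eq_one_iff:
  assumes "N \<lhd> G" "x \<in> carrier G"
  shows "N #> x = \<one>\<^bsub>G Mod N\<^esub> \<longleftrightarrow> x \<in> N"
  using Mod_hom(2)[OF assms(1)] assms(2) by (auto simp: kernel_def simp del: one_FactGroup)

lemma p_index_Mod:
  assumes L: "L \<lhd> G" and P: "subgroup P G" "L \<subseteq> P" "p_index p L P"
  obtains k where "card ((#>) L ` P) = p ^ k"
proof -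
  interpret f: finite_group_hom G "G Mod L" "(#>) L" by (rule Mod_hom[OF L])
  have "card P = card ((#>) L ` P) * card L"
    using f.card_image_above_ker[OF P(1)] P(2) unfolding Mod_hom(2)[OF L] .
  moreover obtain k where "card P = p ^ k * card L" using P(3) by (auto simp: p_index_def)
  ultimately have "card ((#>) L ` P) = p ^ k" using card_normal_pos[OF L] by simp
  then show ?thesis by (rule that)
qed

text \<open>
  Commutation in the quotient; most rules below are the corresponding rules of the group
  \<open>G Mod N\<close>.
\<close>

lemma commute_mod_Mod:
  assumes N: "N \<lhd> G" and "x \<in> carrier G" "y \<in> carrier G"
  shows "commute_mod G N x y \<longleftrightarrow> (N #> x) \<otimes>\<^bsub>G Mod N\<^esub> (N #> y) = (N #> y) \<otimes>\<^bsub>G Mod N\<^esub> (N #> x)"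
  using normal.rcos_sum[OF N] assms by (simp add: commute_mod_def)

lemma commute_mod_sym: "commute_mod G N x y \<longleftrightarrow> commute_mod G N y x"
  by (auto simp: commute_mod_def)

lemma commute_mod_iff:
  assumes N: "N \<lhd> G" and "x \<in> carrier G" "y \<in> carrier G"
  shows "commute_mod G N x y \<longleftrightarrow> x \<otimes> y \<otimes> inv x \<otimes> inv y \<in> N"
proof -
  have "commute_mod G N x y \<longleftrightarrow> (x \<otimes> y) \<otimes> inv (y \<otimes> x) \<in> N"
    unfolding commute_mod_def using rcos_eq_iff[OF normal_imp_subgroup[OF N]] assms by simp
  then show ?thesis using assms by (simp add: inv_mult_group m_assoc)
qed

lemma commute_mod_in:
  assumes N: "N \<lhd> G" and "x \<in> carrier G" "y \<in> N"
  shows "commute_mod G N x y"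
proof -
  have y: "y \<in> carrier G" using N assms(3) normal_subset by blast
  have "x \<otimes> y \<otimes> inv x \<in> N" by (rule normal_conj[OF assms])
  then show ?thesis using commute_mod_iff[OF assms(1,2) y] N assms(3) 
    by (simp add: normal_imp_subgroup subgroup.m_closed subgroup.m_inv_closed)
qed

lemma commute_mod_mult:
  assumes N: "N \<lhd> G" and "x \<in> carrier G" "y \<in> carrier G" "z \<in> carrier G"
    and "commute_mod G N x y" "commute_mod G N x z"
  shows "commute_mod G N x (y \<otimes> z)"
proof -
  interpret N: normal N G by (rule N)
  interpret Q: group "G Mod N" by (rule N.factorgroup_is_group)
  have c: "N #> u \<in> carrier (G Mod N)" if "u \<in> carrier G" for u using that by (auto simp: carrier_FactGroup)
  have m: "N #> (u \<otimes> v) = (N #> u) \<otimes>\<^bsub>G Mod N\<^esub> (N #> v)" if "u \<in> carrier G" "v \<in> carrier G" for u v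
    using that by (simp add: N.rcos_sum)
  show ?thesis using assms c by (simp add: commute_mod_Mod m del: mult_FactGroup) (metis Q.m_assoc c)
qed

lemma commute_mod_inv:
  assumes N: "N \<lhd> G" and "x \<in> carrier G" "y \<in> carrier G" and "commute_mod G N x y"
  shows "commute_mod G N x (inv y)"
proof -
  interpret N: normal N G by (rule N)
  interpret f: finite_group_hom G "G Mod N" "(#>) N" by (rule Mod_hom[OF N])
  have "N #> x \<in> carrier (G Mod N)" "N #> y \<in> carrier (G Mod N)" using assms by auto
  moreover have "(N #> x) \<otimes>\<^bsub>G Mod N\<^esub> (N #> y) = (N #> y) \<otimes>\<^bsub>G Mod N\<^esub> (N #> x)"
    using commute_mod_Mod assms by blast
  ultimately have "(N #> x) \<otimes>\<^bsub>G Mod N\<^esub> inv\<^bsub>G Mod N\<^esub> (N #> y) = inv\<^bsub>G Mod N\<^esub> (N #> y) \<otimes>\<^bsub>G Mod N\<^esub> (N #> x)"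
    by (metis f.H.inv_closed f.H.inv_solve_left f.H.inv_solve_right f.H.m_assoc f.H.m_closed)
  then show ?thesis using assms f.hom_inv[of y] by (simp add: commute_mod_Mod del: mult_FactGroup)
qed

lemma commute_mod_conj:
  assumes N: "N \<lhd> G" and "x \<in> carrier G" "y \<in> carrier G" "g \<in> carrier G" and "commute_mod G N x y"
  shows "commute_mod G N (g \<otimes> x \<otimes> inv g) (g \<otimes> y \<otimes> inv g)"
proof -
  let ?c = "x \<otimes> y \<otimes> inv x \<otimes> inv y"
  have "g \<otimes> ?c \<otimes> inv g \<in> N" using assms commute_mod_iff normal_conj by blast
  moreover have "g \<otimes> x \<otimes> inv g \<otimes> (g \<otimes> y \<otimes> inv g) \<otimes> inv (g \<otimes> x \<otimes> inv g) \<otimes> inv (g \<otimes> y \<otimes> inv g) = g \<otimes> ?c \<otimes> inv g"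
    using assms(2-4) by (simp add: inv_mult_group m_assoc inv_solve_left')
  ultimately show ?thesis using assms commute_mod_iff by simp
qed

lemma section_centralizer_normal:
  assumes L: "L \<lhd> G" and H: "H \<lhd> G"
  shows "section_centralizer G H L \<lhd> G"
  unfolding normal_inv_iff
proof (intro conjI ballI)
  have Hc: "h \<in> carrier G" if "h \<in> H" for h using that H normal_subset by blast
  note c = commute_mod_sym
  show "subgroup (section_centralizer G H L) G"
  proof (rule subgroupI)
    have "commute_mod G L h \<one>" if "h \<in> H" for h
      using that Hc by (simp add: commute_mod_def)
    then show "section_centralizer G H L \<noteq> {}" using c by (auto simp: section_centralizer_def)
    fix a assume a: "a \<in> section_centralizer G H L"
    then show "inv a \<in> section_centralizer G H L"
      using commute_mod_inv[OF L] Hc c by (auto simp: section_centralizer_def)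
    fix b assume "b \<in> section_centralizer G H L"
    then show "a \<otimes> b \<in> section_centralizer G H L"
      using a commute_mod_mult[OF L] Hc c by (auto simp: section_centralizer_def)
  qed (auto simp: section_centralizer_def)
  fix x a assume x: "x \<in> carrier G" and a: "a \<in> section_centralizer G H L"
  have "commute_mod G L (x \<otimes> a \<otimes> inv x) h" if h: "h \<in> H" for h
  proof -
    have h': "inv x \<otimes> h \<otimes> x \<in> H" using normal_conj[OF H, of "inv x" h] x h by simp
    have "commute_mod G L (x \<otimes> a \<otimes> inv x) (x \<otimes> (inv x \<otimes> h \<otimes> x) \<otimes> inv x)"
      using a h' by (intro commute_mod_conj[OF L]) (auto simp: section_centralizer_def x Hc)
    moreover have "x \<otimes> (inv x \<otimes> h \<otimes> x) \<otimes> inv x = x \<otimes> (inv x \<otimes> h)"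
      using x Hc[OF h] by (simp add: m_assoc)
    moreover have "x \<otimes> (inv x \<otimes> h) = h" using x Hc[OF h] by (simp add: m_assoc[symmetric])
    ultimately show ?thesis by simp
  qed
  then show "x \<otimes> a \<otimes> inv x \<in> section_centralizer G H L"
    using x a by (auto simp: section_centralizer_def)
qed

lemma set_multI: "a \<in> A \<Longrightarrow> b \<in> B \<Longrightarrow> a \<otimes> b \<in> A <#> B"
  by (auto simp: set_mult_def)

lemma product_eq_preimg:
  assumes N: "N \<lhd> G" and A: "subgroup A G"
  shows "A <#> N = {x \<in> carrier G. N #> x \<in> (#>) N ` A}"
proof -
  interpret N: normal N G by (rule N)
  interpret A: subgroup A G by (rule A)
  have "A <#> N = N <#> A" by (rule commut_normal[OF A N])
  also have "\<dots> = {x \<in> carrier G. N #> x \<in> (#>) N ` A}"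
  proof (intro equalityI subsetI)
    fix x assume "x \<in> N <#> A"
    then obtain n a where na: "n \<in> N" "a \<in> A" "x = n \<otimes> a" by (auto simp: set_mult_def)
    then have "N #> x = N #> a" using rcos_eq_iff[OF N.subgroup_axioms, of x a] by (simp add: m_assoc)
    then show "x \<in> {x \<in> carrier G. N #> x \<in> (#>) N ` A}" using na by auto
  next
    fix x assume "x \<in> {x \<in> carrier G. N #> x \<in> (#>) N ` A}"
    then obtain a where a: "x \<in> carrier G" "a \<in> A" "N #> x = N #> a" by auto
    then have "x \<otimes> inv a \<in> N" using rcos_eq_iff[OF N.subgroup_axioms] by simp
    then have "x \<otimes> inv a \<otimes> a \<in> N <#> A" using a set_multI by blast
    then show "x \<in> N <#> A" using a by (simp add: m_assoc)
  qed
  finally show ?thesis .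
qed

lemma product_subgroup:
  assumes N: "N \<lhd> G" and A: "subgroup A G"
  shows "subgroup (A <#> N) G" "A \<subseteq> A <#> N" "N \<subseteq> A <#> N"
    and "subgroup C G \<Longrightarrow> A \<subseteq> C \<Longrightarrow> N \<subseteq> C \<Longrightarrow> A <#> N \<subseteq> C"
    and "(#>) N ` (A <#> N) = (#>) N ` A"
    and "A <#> N = N <#> A"
proof -
  interpret N: normal N G by (rule N)
  interpret A: subgroup A G by (rule A)
  interpret f: finite_group_hom G "G Mod N" "(#>) N" by (rule Mod_hom[OF N])
  have eq: "A <#> N = f.preimg ((#>) N ` A)" unfolding f.preimg_def by (rule product_eq_preimg[OF assms])
  show "subgroup (A <#> N) G" unfolding eq by (intro f.preimg_subgroup f.subgroup_img_is_subgroup A)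
  show "A \<subseteq> A <#> N" using set_multI[OF _ N.one_closed] by (metis A.mem_carrier r_one subsetI)
  show "N \<subseteq> A <#> N" using set_multI[OF A.one_closed] by (metis N.mem_carrier l_one subsetI)
  show "A <#> N = N <#> A" by (rule commut_normal[OF A N])
  show "A <#> N \<subseteq> C" if "subgroup C G" "A \<subseteq> C" "N \<subseteq> C"
    using that unfolding set_mult_def by (auto intro: subgroup.m_closed)
  show "(#>) N ` (A <#> N) = (#>) N ` A" unfolding eq using f.preimg_def by auto
qed

lemma product_normal:
  assumes N: "N \<lhd> G" and A: "A \<lhd> G"
  shows "A <#> N \<lhd> G"
proof -
  interpret f: finite_group_hom G "G Mod N" "(#>) N" by (rule Mod_hom[OF N])
  have "A <#> N = f.preimg ((#>) N ` A)" unfolding f.preimg_def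
    by (rule product_eq_preimg[OF N normal_imp_subgroup[OF A]])
  then show ?thesis using f.preimg_normal f.image_normal[OF A Mod_hom(3)[OF N]] by simp
qed

lemma card_product:
  assumes N: "N \<lhd> G" and A: "subgroup A G"
  shows "card (A <#> N) * card (A \<inter> N) = card A * card N"
proof -
  interpret f: finite_group_hom G "G Mod N" "(#>) N" by (rule Mod_hom[OF N])
  note P = product_subgroup[OF assms]
  have "card (A <#> N) = card ((#>) N ` A) * card N"
    using f.card_image_above_ker[OF P(1)] P(3) unfolding Mod_hom(2)[OF N] P(5) by simp
  moreover have "card A = card ((#>) N ` A) * card (A \<inter> N)"
    using f.card_fibres[OF A] unfolding Mod_hom(2)[OF N] .
  ultimately show ?thesis by simp
qed

lemma index_product:
  assumes N: "N \<lhd> G" and A: "subgroup A G"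
  shows "p_index p N (A <#> N) \<longleftrightarrow> p_index p (A \<inter> N) A"
    and "p'_index p N (A <#> N) \<longleftrightarrow> p'_index p (A \<inter> N) A"
proof -
  have "card (A \<inter> N) > 0" "card N > 0"
    using subgroups_Inter_pair[OF A] normal_imp_subgroup[OF N] card_subgroup_pos by auto
  then show "p_index p N (A <#> N) \<longleftrightarrow> p_index p (A \<inter> N) A" "p'_index p N (A <#> N) \<longleftrightarrow> p'_index p (A \<inter> N) A"
    using index_cong(2,3)[OF card_product[OF assms]] by auto
qed

lemma index_inter:
  assumes p: "Factorial_Ring.prime p" and A: "subgroup A G" and W: "W \<lhd> G" and Y: "subgroup Y G" and "W \<subseteq> Y"
  shows "p_index p W Y \<Longrightarrow> p_index p (A \<inter> W) (A \<inter> Y)"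
    and "p'_index p W Y \<Longrightarrow> p'_index p (A \<inter> W) (A \<inter> Y)"
proof -
  have AY: "subgroup (A \<inter> Y) G" using subgroups_Inter_pair[OF A Y] .
  note P = product_subgroup[OF W AY]
  have sub: "(A \<inter> Y) <#> W \<subseteq> Y" using P(4)[OF Y] assms(5) by blast
  have e: "(A \<inter> Y) \<inter> W = A \<inter> W" using assms(5) by blast
  show "p_index p W Y \<Longrightarrow> p_index p (A \<inter> W) (A \<inter> Y)"
    "p'_index p W Y \<Longrightarrow> p'_index p (A \<inter> W) (A \<inter> Y)"
    using index_between(1,3)[OF p normal_imp_subgroup[OF W] P(1) Y P(3) sub]
      index_product[OF W AY, of p] unfolding e by blast+
qed

lemma chief_step_above:
  assumes K: "K \<lhd> G" and H: "H \<lhd> G" and "K \<subset> H"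
  obtains M where "chief_step G K M" "M \<subseteq> H"
proof -
  let ?P = "\<lambda>M. M \<lhd> G \<and> K \<subset> M \<and> M \<subseteq> H"
  have "?P H" using assms by auto
  then obtain M where M: "?P M" and least: "\<And>M'. ?P M' \<Longrightarrow> card M \<le> card M'"
    using arg_min_natI[of ?P H card] arg_min_nat_le[of ?P _ card] by blast
  have "L = K \<or> L = M" if "L \<lhd> G" "K \<subseteq> L" "L \<subseteq> M" for L
  proof (rule ccontr)
    assume *: "\<not> (L = K \<or> L = M)"
    then have "card M \<le> card L" using least[of L] that M by blast
    moreover have "card L < card M"
      using * that M finite_subset_carrier[OF normal_subset] by (intro psubset_card_mono) auto
    ultimately show False by simp
  qed
  with M K have "chief_step G K M" "M \<subseteq> H" by (auto simp: chief_step_def)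
  then show ?thesis using that by blast
qed

lemma chief_step_below:
  assumes K: "K \<lhd> G" and H: "H \<lhd> G" and "K \<subset> H"
  obtains M where "chief_step G M H" "K \<subseteq> M"
proof -
  let ?P = "\<lambda>M. M \<lhd> G \<and> K \<subseteq> M \<and> M \<subset> H"
  have b: "\<forall>M. ?P M \<longrightarrow> card M < Suc (card H)"
    using finite_subset_carrier[OF normal_subset[OF H]] by (auto intro: less_SucI psubset_card_mono)
  have "?P K" using assms by auto
  then obtain M where M: "?P M" and greatest: "\<And>M'. ?P M' \<Longrightarrow> card M' \<le> card M"
    using ex_has_greatest_nat[of ?P K card "Suc (card H)"] b by blast
  have "L = M \<or> L = H" if "L \<lhd> G" "M \<subseteq> L" "L \<subseteq> H" for L
  proof (rule ccontr)
    assume *: "\<not> (L = M \<or> L = H)"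
    then have "card L \<le> card M" using greatest[of L] that M by blast
    moreover have "card M < card L"
      using * that M finite_subset_carrier[OF normal_subset] by (intro psubset_card_mono) auto
    ultimately show False by simp
  qed
  with M H have "chief_step G M H" "K \<subseteq> M" by (auto simp: chief_step_def)
  then show ?thesis using that by blast
qed

text \<open>
  Perspectivity in the modular lattice of normal subgroups: if \<open>N\<close> meets \<open>H\<close> inside \<open>K\<close>, then the
  chief factor \<open>H/K\<close> is carried isomorphically to \<open>HN/KN\<close>.
\<close>

lemma chief_step_up:
  assumes S: "chief_step G K H" and N: "N \<lhd> G" and HN: "H \<inter> N \<subseteq> K"
  shows "chief_step G (K <#> N) (H <#> N)"
    and "card (H <#> N) * card K = card H * card (K <#> N)"
proof -
  have K: "K \<lhd> G" and H: "H \<lhd> G" and KH: "K \<subset> H"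
    and b: "\<And>L. L \<lhd> G \<Longrightarrow> K \<subseteq> L \<Longrightarrow> L \<subseteq> H \<Longrightarrow> L = K \<or> L = H" using S by (auto simp: chief_step_def)
  note sK = normal_imp_subgroup[OF K] and sH = normal_imp_subgroup[OF H] and sN = normal_imp_subgroup[OF N]
  note PK = product_subgroup[OF N sK] and PH = product_subgroup[OF N sH]
  have e: "H \<inter> N = K \<inter> N" using HN KH by blast
  have c: "card (H <#> N) * card (K \<inter> N) = card H * card N"
     "card (K <#> N) * card (K \<inter> N) = card K * card N"
    using card_product[OF N sH] card_product[OF N sK] e by auto
  have pos: "card (K \<inter> N) > 0" "card K > 0" "card N > 0" "card H > 0"
    using card_normal_pos normal_subgroup_intersect K H N by auto
  have "card (H <#> N) * card K * (card (K \<inter> N) * card N) = card H * card (K <#> N) * (card (K \<inter> N) * card N)"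
  proof -
    have "card (H <#> N) * card K * (card (K \<inter> N) * card N) = (card (H <#> N) * card (K \<inter> N)) * (card K * card N)" by simp
    also have "\<dots> = (card H * card N) * (card (K <#> N) * card (K \<inter> N))" using c by simp
    finally show ?thesis by (simp add: ac_simps)
  qed
  then show idx: "card (H <#> N) * card K = card H * card (K <#> N)" using pos by simp
  have sub: "K <#> N \<subseteq> H <#> N" using PK(4)[OF PH(1)] PH(2,3) KH by blast
  have ne: "K <#> N \<noteq> H <#> N"
  proof
    assume "K <#> N = H <#> N"
    then have "card K = card H" using c pos by (metis mult_cancel2 less_not_refl)
    moreover have "card K < card H" using KH finite_subset_carrier[OF normal_subset[OF H]] by (rule psubset_card_mono[rotated])
    ultimately show False by simp
  qed
  have "Y = K <#> N \<or> Y = H <#> N" if Y: "Y \<lhd> G" "K <#> N \<subseteq> Y" "Y \<subseteq> H <#> N" for Y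
  proof -
    have sY: "subgroup Y G" using Y normal_imp_subgroup by blast
    have "Y \<inter> H = K \<or> Y \<inter> H = H" using b[of "Y \<inter> H"] normal_subgroup_intersect Y H PK(2) KH by blast
    then show ?thesis
    proof
      assume "Y \<inter> H = H"
      then have "H <#> N \<subseteq> Y" using PH(4)[OF sY] PK(3) Y by blast
      then show ?thesis using Y by blast
    next
      assume yh: "Y \<inter> H = K"
      have "Y \<subseteq> K <#> N"
      proof
        fix y assume y: "y \<in> Y"
        then obtain h n where hn: "h \<in> H" "n \<in> N" "y = h \<otimes> n" using Y by (force simp: set_mult_def)
        have cc: "h \<in> carrier G" "n \<in> carrier G" using hn H N normal_subset by auto
        have "h = y \<otimes> inv n" using hn cc by (simp add: m_assoc)
        moreover have "inv n \<in> Y" using subgroup.m_inv_closed[OF sN hn(2)] PK(3) Y(2) by blast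
        ultimately have "h \<in> Y" using y sY by (simp add: subgroup.m_closed)
        then have "h \<in> K" using yh hn by blast
        then show "y \<in> K <#> N" using hn set_multI by blast
      qed
      then show ?thesis using Y by blast
    qed
  qed
  then show "chief_step G (K <#> N) (H <#> N)"
    unfolding chief_step_def using product_normal N K H sub ne by blast
qed

text \<open>
  The opposite perspectivity: if \<open>N\<close> covers \<open>H\<close> modulo \<open>K\<close>, then \<open>H/K\<close> is isomorphic to
  \<open>(H \<inter> N)/(K \<inter> N)\<close>.
\<close>

lemma chief_step_down:
  assumes S: "chief_step G K H" and N: "N \<lhd> G" and HN: "H \<subseteq> K <#> N"
  shows "chief_step G (K \<inter> N) (H \<inter> N)"
    and "card H * card (K \<inter> N) = card (H \<inter> N) * card K"
proof -
  have K: "K \<lhd> G" and H: "H \<lhd> G" and KH: "K \<subset> H"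
    and b: "\<And>L. L \<lhd> G \<Longrightarrow> K \<subseteq> L \<Longrightarrow> L \<subseteq> H \<Longrightarrow> L = K \<or> L = H" using S by (auto simp: chief_step_def)
  note sK = normal_imp_subgroup[OF K] and sH = normal_imp_subgroup[OF H] and sN = normal_imp_subgroup[OF N]
  have split: "\<exists>k\<in>K. \<exists>n\<in>H \<inter> N. h = k \<otimes> n" if h: "h \<in> H" for h
  proof -
    obtain k n where kn: "k \<in> K" "n \<in> N" "h = k \<otimes> n" using h HN by (auto simp: set_mult_def)
    have cc: "k \<in> carrier G" "n \<in> carrier G" using kn K N normal_subset by auto
    have "n = inv k \<otimes> h" using kn cc by (simp add: m_assoc[symmetric])
    moreover have "inv k \<in> H" using subgroup.m_inv_closed[OF sK kn(1)] KH by blast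
    ultimately have "n \<in> H" using h sH by (simp add: subgroup.m_closed)
    then show ?thesis using kn by blast
  qed
  have nHN: "H \<inter> N \<lhd> G" "K \<inter> N \<lhd> G" using normal_subgroup_intersect H K N by auto
  have "K <#> (H \<inter> N) = H"
  proof
    show "K <#> (H \<inter> N) \<subseteq> H" using product_subgroup(4)[OF nHN(1) sK sH] KH by blast
    show "H \<subseteq> K <#> (H \<inter> N)" using split set_multI by blast
  qed
  then show "card H * card (K \<inter> N) = card (H \<inter> N) * card K"
    using card_product[OF nHN(1) sK] KH by (simp add: Int_absorb2 Int_assoc[symmetric] inf.absorb1 mult.commute psubset_imp_subset)
  have ne: "K \<inter> N \<noteq> H \<inter> N"
  proof
    assume "K \<inter> N = H \<inter> N"
    then have "H \<subseteq> K" using split sK by (metis IntD1 subgroup.m_closed subsetI)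
    then show False using KH by blast
  qed
  have "Y = K \<inter> N \<or> Y = H \<inter> N" if Y: "Y \<lhd> G" "K \<inter> N \<subseteq> Y" "Y \<subseteq> H \<inter> N" for Y
  proof -
    have sY: "subgroup Y G" using Y normal_imp_subgroup by blast
    note P = product_subgroup[OF Y(1) sK]
    have "K <#> Y = K \<or> K <#> Y = H"
      using b[of "K <#> Y"] product_normal[OF Y(1) K] P(2) P(4)[OF sH] KH Y(3) by blast
    then show ?thesis
    proof
      assume "K <#> Y = K" then show ?thesis using P(3) Y by blast
    next
      assume e: "K <#> Y = H"
      have "H \<inter> N \<subseteq> Y"
      proof
        fix x assume x: "x \<in> H \<inter> N"
        then obtain k y where ky: "k \<in> K" "y \<in> Y" "x = k \<otimes> y" using e by (force simp: set_mult_def)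
        have cc: "k \<in> carrier G" "y \<in> carrier G" using ky K Y normal_subset by auto
        have "k = x \<otimes> inv y" using ky cc by (simp add: m_assoc)
        moreover have "inv y \<in> N" using subgroup.m_inv_closed[OF sY ky(2)] Y(3) by blast
        ultimately have "k \<in> N" using x sN by (simp add: subgroup.m_closed)
        then have "k \<in> Y" using ky Y by blast
        then show "x \<in> Y" using ky sY by (simp add: subgroup.m_closed)
      qed
      then show ?thesis using Y by blast
    qed
  qed
  then show "chief_step G (K \<inter> N) (H \<inter> N)"
    unfolding chief_step_def using nHN ne KH by blast
qed

text \<open>
  Every normal \<open>N\<close> either avoids a chief factor or covers it, so exactly one of the two
  perspectivities above applies.
\<close>

lemma chief_step_dichotomy:
  assumes S: "chief_step G K H" and N: "N \<lhd> G" and "\<not> H \<inter> N \<subseteq> K"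
  shows "H \<subseteq> K <#> N"
proof -
  have K: "K \<lhd> G" and H: "H \<lhd> G" and KH: "K \<subset> H"
    and b: "\<And>L. L \<lhd> G \<Longrightarrow> K \<subseteq> L \<Longrightarrow> L \<subseteq> H \<Longrightarrow> L = K \<or> L = H" using S by (auto simp: chief_step_def)
  have nHN: "H \<inter> N \<lhd> G" using normal_subgroup_intersect H N by auto
  note P = product_subgroup[OF nHN normal_imp_subgroup[OF K]]
  have "K <#> (H \<inter> N) = K \<or> K <#> (H \<inter> N) = H"
    using b[of "K <#> (H \<inter> N)"] product_normal[OF nHN K] P(2) P(4)[OF normal_imp_subgroup[OF H]] KH by blast
  then have "K <#> (H \<inter> N) = H" using P(3) assms(3) by blast
  then show ?thesis using mono_set_mult[of K K "H \<inter> N" N] by blast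
qed

end

section \<open>Residuals modulo a normal subgroup\<close>

text \<open>
  For normal \<open>M\<close> this says that the quotient by \<open>M\<close> is \<open>p\<close>-supersolvable (\<open>p_supersolvable_Mod\<close>).
\<close>

definition supersolvable_above :: "nat \<Rightarrow> ('a, 'b) monoid_scheme \<Rightarrow> 'a set \<Rightarrow> bool" where
  "supersolvable_above p G M \<longleftrightarrow>
     (\<forall>K H. chief_step G K H \<and> M \<subseteq> K \<longrightarrow> card H = p * card K \<or> p'_index p K H)"

text \<open>
  The preimage in \<open>G\<close> of the residual of the quotient by \<open>N\<close>.
\<close>

definition residual_above :: "nat \<Rightarrow> ('a, 'b) monoid_scheme \<Rightarrow> 'a set \<Rightarrow> 'a set" where
  "residual_above p G N = \<Inter>{M. M \<lhd> G \<and> N \<subseteq> M \<and> supersolvable_above p G M}"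

lemma residual_aboveD:
  "x \<in> residual_above p G N \<Longrightarrow> M \<lhd> G \<Longrightarrow> N \<subseteq> M \<Longrightarrow> supersolvable_above p G M \<Longrightarrow> x \<in> M"
  unfolding residual_above_def by simp

context finite_group
begin

lemma carrier_normal: "carrier G \<lhd> G"
  using subgroup_self by (auto simp: normal_inv_iff)

lemma supersolvable_above_carrier: "supersolvable_above p G (carrier G)"
  unfolding supersolvable_above_def chief_step_def using normal_subset by blast

end

context finite_group_hom
begin

lemma image_subset_iff:
  assumes "subgroup A G" "ker \<subseteq> A" "subgroup B G" "ker \<subseteq> B"
  shows "\<phi> ` A \<subseteq> \<phi> ` B \<longleftrightarrow> A \<subseteq> B" "\<phi> ` A = \<phi> ` B \<longleftrightarrow> A = B"
proof -
  have "preimg Y \<subseteq> preimg Z" if "Y \<subseteq> Z" for Y Z using that by (auto simp: preimg_def)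
  then show "\<phi> ` A \<subseteq> \<phi> ` B \<longleftrightarrow> A \<subseteq> B" using preimg_image assms by (metis image_mono)
  show "\<phi> ` A = \<phi> ` B \<longleftrightarrow> A = B" using preimg_image assms by metis
qed

lemma chief_step_image:
  assumes s: "\<phi> ` carrier G = carrier Q"
    and A: "A \<lhd> G" "ker \<subseteq> A" and B: "B \<lhd> G" "ker \<subseteq> B"
  shows "chief_step Q (\<phi> ` A) (\<phi> ` B) \<longleftrightarrow> chief_step G A B"
proof -
  note sA = normal_imp_subgroup[OF A(1)] and sB = normal_imp_subgroup[OF B(1)]
  note nA = image_normal[OF A(1) s] and nB = image_normal[OF B(1) s]
  have lt: "\<phi> ` A \<subset> \<phi> ` B \<longleftrightarrow> A \<subset> B"
    using image_subset_iff[OF sA A(2) sB B(2)] by blast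
  have 1: "L = A \<or> L = B" if a: "\<forall>L. L \<lhd> Q \<and> \<phi> ` A \<subseteq> L \<and> L \<subseteq> \<phi> ` B \<longrightarrow> L = \<phi> ` A \<or> L = \<phi> ` B"
    and L: "L \<lhd> G" "A \<subseteq> L" "L \<subseteq> B" for L
  proof -
    have "\<phi> ` L = \<phi> ` A \<or> \<phi> ` L = \<phi> ` B" using a image_normal[OF L(1) s] L by blast
    then show ?thesis
      using image_subset_iff(2)[OF normal_imp_subgroup[OF L(1)] _ sA A(2)]
        image_subset_iff(2)[OF normal_imp_subgroup[OF L(1)] _ sB B(2)] A(2) L(2) by blast
  qed
  have 2: "L = \<phi> ` A \<or> L = \<phi> ` B" if a: "\<forall>L. L \<lhd> G \<and> A \<subseteq> L \<and> L \<subseteq> B \<longrightarrow> L = A \<or> L = B"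
    and L: "L \<lhd> Q" "\<phi> ` A \<subseteq> L" "L \<subseteq> \<phi> ` B" for L
  proof -
    have "A \<subseteq> preimg L" using L(2) G.normal_subset[OF A(1)] by (auto simp: preimg_def)
    moreover have "preimg L \<subseteq> preimg (\<phi> ` B)" using L(3) by (auto simp: preimg_def)
    ultimately have "preimg L = A \<or> preimg L = B"
      using a preimg_normal[OF L(1)] preimg_image[OF sB B(2)] by blast
    moreover have "\<phi> ` preimg L = L"
      using image_preimg[of L] s normal_imp_subgroup[OF L(1)] by (simp add: subgroup.subset)
    ultimately show ?thesis by auto
  qed
  show ?thesis
  proof
    assume "chief_step Q (\<phi> ` A) (\<phi> ` B)"
    then have "A \<subset> B" "\<forall>L. L \<lhd> Q \<and> \<phi> ` A \<subseteq> L \<and> L \<subseteq> \<phi> ` B \<longrightarrow> L = \<phi> ` A \<or> L = \<phi> ` B"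
      unfolding chief_step_def lt by simp_all
    then show "chief_step G A B" unfolding chief_step_def using A(1) B(1) 1 by simp
  next
    assume "chief_step G A B"
    then have "A \<subset> B" "\<forall>L. L \<lhd> G \<and> A \<subseteq> L \<and> L \<subseteq> B \<longrightarrow> L = A \<or> L = B"
      unfolding chief_step_def by simp_all
    then show "chief_step Q (\<phi> ` A) (\<phi> ` B)" unfolding chief_step_def lt using nA nB 2 by simp
  qed
qed

lemma supersolvable_above_preimg:
  assumes s: "\<phi> ` carrier G = carrier Q" and M: "M \<lhd> Q"
  shows "supersolvable_above p G (preimg M) \<longleftrightarrow> supersolvable_above p Q M"
proof
  have kM: "ker \<subseteq> preimg M" by (rule ker_subset_preimg[OF normal_imp_subgroup[OF M]])
  assume G: "supersolvable_above p G (preimg M)"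
  show "supersolvable_above p Q M"
    unfolding supersolvable_above_def
  proof (intro allI impI, elim conjE)
    fix K H assume KH: "chief_step Q K H" and MK: "M \<subseteq> K"
    have n: "K \<lhd> Q" "H \<lhd> Q" using KH by (auto simp: chief_step_def)
    have e: "\<phi> ` preimg K = K" "\<phi> ` preimg H = H"
      using image_preimg s n normal_imp_subgroup subgroup.subset by metis+
    have k: "ker \<subseteq> preimg K" "ker \<subseteq> preimg H" using n ker_subset_preimg normal_imp_subgroup by blast+
    have "chief_step G (preimg K) (preimg H)"
      using chief_step_image[OF s preimg_normal[OF n(1)] k(1) preimg_normal[OF n(2)] k(2)] e KH by simp
    moreover have "preimg M \<subseteq> preimg K" using MK by (auto simp: preimg_def)
    ultimately have "card (preimg H) = p * card (preimg K) \<or> p'_index p (preimg K) (preimg H)"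
      using G by (auto simp: supersolvable_above_def)
    then show "card H = p * card K \<or> p'_index p K H"
      using index_above_ker(1,3)[of "preimg K" "preimg H"] k e n preimg_subgroup normal_imp_subgroup
      by metis
  qed
next
  have kM: "ker \<subseteq> preimg M" by (rule ker_subset_preimg[OF normal_imp_subgroup[OF M]])
  assume Q: "supersolvable_above p Q M"
  show "supersolvable_above p G (preimg M)"
    unfolding supersolvable_above_def
  proof (intro allI impI, elim conjE)
    fix K H assume KH: "chief_step G K H" and MK: "preimg M \<subseteq> K"
    have n: "K \<lhd> G" "H \<lhd> G" using KH by (auto simp: chief_step_def)
    have k: "ker \<subseteq> K" "ker \<subseteq> H" using kM MK KH by (auto simp: chief_step_def)
    have "chief_step Q (\<phi> ` K) (\<phi> ` H)" using chief_step_image[OF s n(1) k(1) n(2) k(2)] KH by simp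
    moreover have "M \<subseteq> \<phi> ` K"
      using image_preimg[of M] MK s normal_imp_subgroup[OF M] subgroup.subset by (metis image_mono)
    ultimately have "card (\<phi> ` H) = p * card (\<phi> ` K) \<or> p'_index p (\<phi> ` K) (\<phi> ` H)"
      using Q by (auto simp: supersolvable_above_def)
    then show "card H = p * card K \<or> p'_index p K H"
      using index_above_ker(1,3)[OF normal_imp_subgroup[OF n(1)] k(1) normal_imp_subgroup[OF n(2)] k(2)]
      by blast
  qed
qed

lemma residual_above_preimg:
  assumes s: "\<phi> ` carrier G = carrier Q" and N: "N \<lhd> Q"
  shows "residual_above p G (preimg N) = preimg (residual_above p Q N)"
proof
  show "residual_above p G (preimg N) \<subseteq> preimg (residual_above p Q N)"
  proof
    fix x assume x: "x \<in> residual_above p G (preimg N)"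
    have "preimg N \<subseteq> carrier G" by (auto simp: preimg_def)
    then have "x \<in> carrier G"
      by (rule residual_aboveD[OF x G.carrier_normal _ G.supersolvable_above_carrier])
    moreover have "\<phi> x \<in> M" if M: "M \<lhd> Q" "N \<subseteq> M" "supersolvable_above p Q M" for M
    proof -
      have "preimg N \<subseteq> preimg M" using M(2) by (auto simp: preimg_def)
      then have "x \<in> preimg M"
        using residual_aboveD[OF x preimg_normal[OF M(1)]] supersolvable_above_preimg[OF s M(1)] M(3)
        by simp
      then show ?thesis by (simp add: preimg_def)
    qed
    ultimately show "x \<in> preimg (residual_above p Q N)"
      by (auto simp: preimg_def residual_above_def)
  qed
  show "preimg (residual_above p Q N) \<subseteq> residual_above p G (preimg N)"
  proof
    fix x assume x: "x \<in> preimg (residual_above p Q N)"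
    show "x \<in> residual_above p G (preimg N)"
      unfolding residual_above_def
    proof safe
      fix M assume M: "M \<lhd> G" "preimg N \<subseteq> M" "supersolvable_above p G M"
      have k: "ker \<subseteq> M" using M ker_subset_preimg[OF normal_imp_subgroup[OF N]] by blast
      have e: "preimg (\<phi> ` M) = M" by (rule preimg_image[OF normal_imp_subgroup[OF M(1)] k])
      have "supersolvable_above p Q (\<phi> ` M)"
        using supersolvable_above_preimg[OF s image_normal[OF M(1) s]] M(3) e by simp
      moreover have "N \<subseteq> \<phi> ` M"
        using image_preimg[of N] M(2) s normal_imp_subgroup[OF N] subgroup.subset by (metis image_mono)
      moreover have "\<phi> x \<in> residual_above p Q N" using x by (simp add: preimg_def)
      ultimately have "\<phi> x \<in> \<phi> ` M"
        using residual_aboveD[OF _ image_normal[OF M(1) s]] by blast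
      then show "x \<in> M" using e x by (auto simp: preimg_def)
    qed
  qed
qed

lemma finite_group_hom_restrict:
  assumes T: "subgroup T G"
  shows "finite_group_hom (G\<lparr>carrier := T\<rparr>) (Q\<lparr>carrier := \<phi> ` T\<rparr>) \<phi>"
proof -
  have "subgroup (\<phi> ` T) Q" by (rule subgroup_img_is_subgroup[OF T])
  moreover have "\<phi> \<in> hom (G\<lparr>carrier := T\<rparr>) (Q\<lparr>carrier := \<phi> ` T\<rparr>)"
    using subgroup.mem_carrier[OF T] by (auto simp: hom_def)
  ultimately show ?thesis
    using G.subgroup_imp_group[OF T] H.subgroup_imp_group G.finite_subset_carrier[OF subgroup.subset[OF T]]
    by (simp add: finite_group_hom_def finite_group_hom_axioms_def group_hom_def group_hom_axioms_def)
qed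

end

context finite_group
begin

lemma supersolvable_above_mono:
  "supersolvable_above p G M \<Longrightarrow> M \<subseteq> N \<Longrightarrow> supersolvable_above p G N"
  unfolding supersolvable_above_def by blast

text \<open>
  The class is closed under subdirect products, which is what makes the residual a member of the
  family that it is the intersection of. A chief factor above \<open>M \<inter> N\<close> is avoided by \<open>M\<close> and moves up to
  one above \<open>M\<close>, or is covered by \<open>M\<close>, moves down into \<open>M\<close>, and is then avoided by \<open>N\<close>.
\<close>

lemma supersolvable_above_inter:
  assumes M: "M \<lhd> G" and N: "N \<lhd> G"
    and sM: "supersolvable_above p G M" and sN: "supersolvable_above p G N"
  shows "supersolvable_above p G (M \<inter> N)"
  unfolding supersolvable_above_def
proof (intro allI impI, elim conjE)
  have up: "card H = p * card K \<or> p'_index p K H"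
    if KH: "chief_step G K H" and I: "I \<lhd> G" and sI: "supersolvable_above p G I" and c: "H \<inter> I \<subseteq> K" for K H I
  proof -
    have n: "K \<lhd> G" "H \<lhd> G" using KH by (auto simp: chief_step_def)
    note U = chief_step_up[OF KH I c]
    have "I \<subseteq> K <#> I" by (rule product_subgroup(3)[OF I normal_imp_subgroup[OF n(1)]])
    then have "card (H <#> I) = p * card (K <#> I) \<or> p'_index p (K <#> I) (H <#> I)"
      using U(1) sI by (auto simp: supersolvable_above_def)
    then show ?thesis
      using index_cong(1,3)[OF U(2) card_normal_pos[OF product_normal[OF I n(1)]] card_normal_pos[OF n(1)]]
      by simp
  qed
  fix K H assume KH: "chief_step G K H" and MN: "M \<inter> N \<subseteq> K"
  have n: "K \<lhd> G" "H \<lhd> G" using KH by (auto simp: chief_step_def)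
  show "card H = p * card K \<or> p'_index p K H"
  proof (cases "H \<inter> M \<subseteq> K")
    case True then show ?thesis by (rule up[OF KH M sM])
  next
    case False
    note D = chief_step_down[OF KH M chief_step_dichotomy[OF KH M False]]
    have "card (H \<inter> M) = p * card (K \<inter> M) \<or> p'_index p (K \<inter> M) (H \<inter> M)"
      by (rule up[OF D(1) N sN]) (use MN in blast)
    then show ?thesis
      using index_cong(1,3)[OF D(2) card_normal_pos[OF n(1)] card_normal_pos[OF normal_subgroup_intersect[OF n(1) M]]]
      by simp
  qed
qed

text \<open>
  In a finite group a member of least order of a family closed under intersection is contained
  in all others.
\<close>

lemma residual_above_mem:
  assumes N: "N \<subseteq> carrier G"
  shows "residual_above p G N \<lhd> G" "N \<subseteq> residual_above p G N"
    "supersolvable_above p G (residual_above p G N)"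
proof -
  let ?P = "\<lambda>M. M \<lhd> G \<and> N \<subseteq> M \<and> supersolvable_above p G M"
  have "?P (carrier G)" using N carrier_normal supersolvable_above_carrier by blast
  then obtain M where M: "?P M" and least: "\<And>M'. ?P M' \<Longrightarrow> card M \<le> card M'"
    using arg_min_natI[of ?P "carrier G" card] arg_min_nat_le[of ?P _ card] by blast
  have "M \<subseteq> M'" if M': "?P M'" for M'
  proof -
    have "?P (M \<inter> M')" using M M' normal_subgroup_intersect supersolvable_above_inter by blast
    then have "card M \<le> card (M \<inter> M')" by (rule least)
    moreover have "finite M" using M finite_subset_carrier normal_subset by blast
    ultimately have "M \<inter> M' = M" by (intro card_seteq) auto
    then show ?thesis by blast
  qed
  then have "residual_above p G N = M" using M unfolding residual_above_def by blast
  then show "residual_above p G N \<lhd> G" "N \<subseteq> residual_above p G N"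
    "supersolvable_above p G (residual_above p G N)" using M by auto
qed

lemma residual_above_least:
  "M \<lhd> G \<Longrightarrow> N \<subseteq> M \<Longrightarrow> supersolvable_above p G M \<Longrightarrow> residual_above p G N \<subseteq> M"
  unfolding residual_above_def by blast

lemma residual_above_mono: "N \<subseteq> L \<Longrightarrow> residual_above p G N \<subseteq> residual_above p G L"
  unfolding residual_above_def by blast

text \<open>
  Residuals are compatible with quotients. This allows passing from a term of the series \<open>N_U_series\<close>
  to a larger normal subgroup.
\<close>

lemma residual_above_product:
  assumes N: "N \<subseteq> L" and L: "L \<lhd> G"
  shows "residual_above p G L = residual_above p G N <#> L"
proof -
  have cN: "N \<subseteq> carrier G" and cL: "L \<subseteq> carrier G" using N L normal_subset by auto
  note RN = residual_above_mem[OF cN, of p] and RL = residual_above_mem[OF cL, of p]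
  note P = product_subgroup[OF L normal_imp_subgroup[OF RN(1)]]
  show ?thesis
  proof
    show "residual_above p G L \<subseteq> residual_above p G N <#> L"
      by (rule residual_above_least[OF product_normal[OF L RN(1)] P(3)])
        (rule supersolvable_above_mono[OF RN(3) P(2)])
    show "residual_above p G N <#> L \<subseteq> residual_above p G L"
      using P(4)[OF normal_imp_subgroup[OF RL(1)]] residual_above_mono[OF N] RL(2) by blast
  qed
qed

section \<open>The given notions in terms of chief steps\<close>

lemma order_section:
  assumes K: "K \<lhd> G" and H: "H \<lhd> G" and "K \<subseteq> H"
  shows "carrier (G\<lparr>carrier := H\<rparr> Mod K) = (#>) K ` H"
    and "card H = order (G\<lparr>carrier := H\<rparr> Mod K) * card K"
proof -
  show *: "carrier (G\<lparr>carrier := H\<rparr> Mod K) = (#>) K ` H"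
    by (simp add: carrier_FactGroup)
  interpret f: finite_group_hom G "G Mod K" "(#>) K" by (rule Mod_hom[OF K])
  show "card H = order (G\<lparr>carrier := H\<rparr> Mod K) * card K"
    unfolding order_def * using f.card_image_above_ker[OF normal_imp_subgroup[OF H]] assms(3)
    unfolding Mod_hom(2)[OF K] by blast
qed

lemma chief_factor_iff: "chief_factor G H K \<longleftrightarrow> chief_step G K H"
proof (cases "K \<lhd> G \<and> H \<lhd> G \<and> K \<subseteq> H")
  case True
  then have K: "K \<lhd> G" and H: "H \<lhd> G" and KH: "K \<subseteq> H" by auto
  interpret f: finite_group_hom G "G Mod K" "(#>) K" by (rule Mod_hom[OF K])
  note k = Mod_hom(2)[OF K] and s = Mod_hom(3)[OF K]
  have one: "(#>) K ` K = {\<one>\<^bsub>G Mod K\<^esub>}"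
    using f.hom_one normal_imp_subgroup[OF K] subgroup.one_closed[of K G]
      coset_join2[OF _ normal_imp_subgroup[OF K]] normal_subset[OF K] by force
  have sub1: "\<one>\<^bsub>G Mod K\<^esub> \<in> L" if "L \<lhd> G Mod K" for L
    using that normal_imp_subgroup subgroup.one_closed by blast
  have "chief_step G K H \<longleftrightarrow> chief_step (G Mod K) {\<one>\<^bsub>G Mod K\<^esub>} ((#>) K ` H)"
    using f.chief_step_image[OF s K _ H] KH unfolding k one by blast
  also have "\<dots> \<longleftrightarrow> minimal_normal ((#>) K ` H) (G Mod K)"
  proof (cases "(#>) K ` H \<lhd> G Mod K")
    case Y: True
    have "{\<one>\<^bsub>G Mod K\<^esub>} \<subset> (#>) K ` H \<longleftrightarrow> (#>) K ` H \<noteq> {\<one>\<^bsub>G Mod K\<^esub>}" using sub1[OF Y] by blast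
    moreover have "L \<lhd> G Mod K \<and> {\<one>\<^bsub>G Mod K\<^esub>} \<subseteq> L \<and> L \<subseteq> (#>) K ` H \<longleftrightarrow>
      L \<lhd> G Mod K \<and> L \<subseteq> (#>) K ` H" for L
      using sub1[of L] by auto
    ultimately show ?thesis
      unfolding chief_step_def minimal_normal_def by (simp only: f.H.one_is_normal Y simp_thms)
  qed (simp add: chief_step_def minimal_normal_def)
  finally show ?thesis
    unfolding chief_factor_def using True order_section(1)[OF K H KH] by simp
qed (auto simp: chief_factor_def chief_step_def)

lemma section_index:
  assumes "K \<lhd> G" "H \<lhd> G" "K \<subseteq> H"
  shows "order (G\<lparr>carrier := H\<rparr> Mod K) = n \<longleftrightarrow> card H = n * card K"
    and "p_group p (G\<lparr>carrier := H\<rparr> Mod K) \<longleftrightarrow> p_index p K H"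
    and "p'_group p (G\<lparr>carrier := H\<rparr> Mod K) \<longleftrightarrow> p'_index p K H"
proof -
  have *: "order (G\<lparr>carrier := H\<rparr> Mod K) = n \<longleftrightarrow> card H = n * card K" for n
    using order_section(2)[OF assms] card_normal_pos[OF assms(1)] by simp
  show "order (G\<lparr>carrier := H\<rparr> Mod K) = n \<longleftrightarrow> card H = n * card K" by (rule *)
  show "p_group p (G\<lparr>carrier := H\<rparr> Mod K) \<longleftrightarrow> p_index p K H"
    unfolding p_group_def p_index_def * ..
  show "p'_group p (G\<lparr>carrier := H\<rparr> Mod K) \<longleftrightarrow> p'_index p K H"
    unfolding p'_group_def p'_index_def *[symmetric] by simp
qed

lemma p_solvable_iff:
  "p_solvable p G \<longleftrightarrow> (\<forall>K H. chief_step G K H \<longrightarrow> p_index p K H \<or> p'_index p K H)"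
proof -
  have "p_group p (G\<lparr>carrier := H\<rparr> Mod K) \<longleftrightarrow> p_index p K H"
    "p'_group p (G\<lparr>carrier := H\<rparr> Mod K) \<longleftrightarrow> p'_index p K H" if "chief_step G K H" for K H
    using section_index(2,3)[of K H] that by (simp_all add: chief_step_def psubset_eq)
  then show ?thesis unfolding p_solvable_def chief_factor_iff by simp blast
qed

lemma p_supersolvable_iff: "p_supersolvable p G \<longleftrightarrow> supersolvable_above p G {\<one>}"
proof -
  have "order (G\<lparr>carrier := H\<rparr> Mod K) = p \<longleftrightarrow> card H = p * card K"
    "p'_group p (G\<lparr>carrier := H\<rparr> Mod K) \<longleftrightarrow> p'_index p K H" "{\<one>} \<subseteq> K" if "chief_step G K H" for K H
    using section_index(1,3)[of K H] that normal_imp_subgroup[of K G] subgroup.one_closed[of K G]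
    by (simp_all add: chief_step_def psubset_eq)
  then show ?thesis unfolding p_supersolvable_def supersolvable_above_def chief_factor_iff by simp blast
qed

lemma p_supersolvable_Mod:
  assumes N: "N \<lhd> G"
  shows "p_supersolvable p (G Mod N) \<longleftrightarrow> supersolvable_above p G N"
proof -
  interpret f: finite_group_hom G "G Mod N" "(#>) N" by (rule Mod_hom[OF N])
  interpret Q: finite_group "G Mod N" by (rule finite_group_Mod[OF N])
  have "f.preimg {\<one>\<^bsub>G Mod N\<^esub>} = f.ker" by (auto simp: f.preimg_def kernel_def)
  then have "supersolvable_above p G N \<longleftrightarrow> supersolvable_above p (G Mod N) {\<one>\<^bsub>G Mod N\<^esub>}"
    using f.supersolvable_above_preimg[OF Mod_hom(3)[OF N] f.H.one_is_normal] Mod_hom(2)[OF N] by metis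
  then show ?thesis using Q.p_supersolvable_iff by blast
qed

lemma U_residual_eq: "U_residual p G = residual_above p G {\<one>}"
proof -
  have "N \<lhd> G \<Longrightarrow> {\<one>} \<subseteq> N" for N using normal_imp_subgroup subgroup.one_closed by blast
  then have "N \<lhd> G \<and> p_supersolvable p (G Mod N) \<longleftrightarrow> N \<lhd> G \<and> {\<one>} \<subseteq> N \<and> supersolvable_above p G N" for N
    using p_supersolvable_Mod[of N p] by auto
  then show ?thesis unfolding U_residual_def residual_above_def by simp
qed


lemma U_residual_subgroup:
  assumes T: "subgroup T G"
  shows "U_residual p (G\<lparr>carrier := T\<rparr>) = residual_above p (G\<lparr>carrier := T\<rparr>) {\<one>}"
  using finite_group.U_residual_eq[OF finite_group_subgroup[OF T]] by simp

text \<open>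
  For a finite set it is enough that conjugation maps it into itself.
\<close>

lemma normalizer_iff:
  assumes Y: "Y \<subseteq> carrier G"
  shows "x \<in> normalizer G Y \<longleftrightarrow> x \<in> carrier G \<and> (\<forall>y\<in>Y. x \<otimes> y \<otimes> inv x \<in> Y)"
proof -
  have "x <# Y #> inv x = (\<lambda>y. x \<otimes> y \<otimes> inv x) ` Y" by (auto simp: l_coset_def r_coset_def)
  then have "x \<in> normalizer G Y \<longleftrightarrow> x \<in> carrier G \<and> (\<lambda>y. x \<otimes> y \<otimes> inv x) ` Y = Y"
    using Y by (simp add: normalizer_def stabilizer_def)
  moreover have "(\<lambda>y. x \<otimes> y \<otimes> inv x) ` Y = Y \<longleftrightarrow> (\<lambda>y. x \<otimes> y \<otimes> inv x) ` Y \<subseteq> Y" if x: "x \<in> carrier G"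
  proof -
    have "inj_on (\<lambda>y. x \<otimes> y \<otimes> inv x) Y" using x Y by (intro inj_onI) (metis conjugation_is_inj subsetD)
    then show ?thesis
      using endo_inj_surj[OF finite_subset_carrier[OF Y]] by blast
  qed
  ultimately show ?thesis by blast
qed

lemma N_U_iff:
  "x \<in> N_U p G \<longleftrightarrow> x \<in> carrier G \<and> (\<forall>T. subgroup T G \<longrightarrow>
     (\<forall>y\<in>residual_above p (G\<lparr>carrier := T\<rparr>) {\<one>}. x \<otimes> y \<otimes> inv x \<in> residual_above p (G\<lparr>carrier := T\<rparr>) {\<one>}))"
proof -
  have R: "residual_above p (G\<lparr>carrier := T\<rparr>) {\<one>} \<subseteq> carrier G" if T: "subgroup T G" for T
  proof -
    interpret T: finite_group "G\<lparr>carrier := T\<rparr>" by (rule finite_group_subgroup[OF T])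
    have "residual_above p (G\<lparr>carrier := T\<rparr>) {\<one>} \<subseteq> T"
      using T.normal_subset[OF T.residual_above_mem(1)[of "{\<one>}"]] subgroup.one_closed[OF T] by simp
    then show ?thesis using subgroup.subset[OF T] by blast
  qed
  have "x \<in> N_U p G \<longleftrightarrow> (\<forall>T. subgroup T G \<longrightarrow> x \<in> normalizer G (U_residual p (G\<lparr>carrier := T\<rparr>)))"
    unfolding N_U_def by auto
  also have "\<dots> \<longleftrightarrow> (\<forall>T. subgroup T G \<longrightarrow> x \<in> carrier G \<and>
     (\<forall>y\<in>residual_above p (G\<lparr>carrier := T\<rparr>) {\<one>}. x \<otimes> y \<otimes> inv x \<in> residual_above p (G\<lparr>carrier := T\<rparr>) {\<one>}))"
    using R normalizer_iff U_residual_subgroup by simp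
  finally show ?thesis using subgroup_self by blast
qed

lemma conj_hom:
  assumes g: "g \<in> carrier G" and S: "subgroup S G"
  defines "c \<equiv> \<lambda>x. g \<otimes> x \<otimes> inv g"
  shows "subgroup (c ` S) G" "finite_group_hom (G\<lparr>carrier := S\<rparr>) (G\<lparr>carrier := c ` S\<rparr>) c"
proof -
  have "c \<in> hom G G"
    using g by (auto simp: hom_def c_def m_assoc) (simp add: m_assoc[symmetric])
  then interpret c: finite_group_hom G G c
    by unfold_locales auto
  show "subgroup (c ` S) G" by (rule c.subgroup_img_is_subgroup[OF S])
  show "finite_group_hom (G\<lparr>carrier := S\<rparr>) (G\<lparr>carrier := c ` S\<rparr>) c"
    by (rule c.finite_group_hom_restrict[OF S])
qed

lemma residual_conj:
  assumes g: "g \<in> carrier G" and S: "subgroup S G"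
  shows "residual_above p (G\<lparr>carrier := S\<rparr>) {\<one>} =
    {x \<in> S. g \<otimes> x \<otimes> inv g \<in> residual_above p (G\<lparr>carrier := (\<lambda>x. g \<otimes> x \<otimes> inv g) ` S\<rparr>) {\<one>}}"
proof -
  interpret c: finite_group_hom "G\<lparr>carrier := S\<rparr>" "G\<lparr>carrier := (\<lambda>x. g \<otimes> x \<otimes> inv g) ` S\<rparr>" "\<lambda>x. g \<otimes> x \<otimes> inv g"
    by (rule conj_hom(2)[OF assms])
  have "x = \<one>" if "x \<in> S" "g \<otimes> x \<otimes> inv g = \<one>" for x
    using that g subgroup.mem_carrier[OF S]
    by (metis inv_closed inv_solve_right' l_cancel_one' m_closed r_inv r_one inv_inv)
  then have "c.preimg {\<one>} = {\<one>}" using g subgroup.one_closed[OF S] by (auto simp: c.preimg_def)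
  then show ?thesis
    using c.residual_above_preimg[OF _ c.H.one_is_normal, of p] by (simp add: c.preimg_def)
qed

text \<open>
  Conjugation by \<open>g\<close> permutes the subgroups \<open>T\<close> together with their residuals.
\<close>

lemma N_U_normal: "N_U p G \<lhd> G"
  unfolding normal_inv_iff
proof (intro conjI ballI)
  have "subgroup (normalizer G (U_residual p (G\<lparr>carrier := T\<rparr>))) G" if T: "subgroup T G" for T
  proof (rule normalizer_imp_subgroup)
    interpret T: finite_group "G\<lparr>carrier := T\<rparr>" by (rule finite_group_subgroup[OF T])
    have "residual_above p (G\<lparr>carrier := T\<rparr>) {\<one>} \<subseteq> T"
      using T.normal_subset[OF T.residual_above_mem(1)[of "{\<one>}"]] subgroup.one_closed[OF T] by simp
    then show "U_residual p (G\<lparr>carrier := T\<rparr>) \<subseteq> carrier G"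
      using subgroup.subset[OF T] U_residual_subgroup[OF T] by blast
  qed
  then show "subgroup (N_U p G) G"
    unfolding N_U_def using subgroup_self by (intro subgroups_Inter) auto
  fix g a assume g: "g \<in> carrier G" and a: "a \<in> N_U p G"
  have ac: "a \<in> carrier G" using a N_U_iff by blast
  show "g \<otimes> a \<otimes> inv g \<in> N_U p G"
    unfolding N_U_iff
  proof (intro conjI allI impI ballI)
    show "g \<otimes> a \<otimes> inv g \<in> carrier G" using g ac by simp
    fix T y assume T: "subgroup T G" and y: "y \<in> residual_above p (G\<lparr>carrier := T\<rparr>) {\<one>}"
    interpret T: finite_group "G\<lparr>carrier := T\<rparr>" by (rule finite_group_subgroup[OF T])
    have "y \<in> T"
      using y T.normal_subset[OF T.residual_above_mem(1)[of "{\<one>}"]] subgroup.one_closed[OF T] by auto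
    then have yc: "y \<in> carrier G" using subgroup.mem_carrier[OF T] by blast
    let ?S = "(\<lambda>x. inv g \<otimes> x \<otimes> g) ` T"
    have S: "subgroup ?S G" using conj_hom(1)[OF inv_closed[OF g] T] g by simp
    have e: "g \<otimes> (inv g \<otimes> x \<otimes> g) \<otimes> inv g = x" if "x \<in> carrier G" for x
    proof -
      have "g \<otimes> (inv g \<otimes> x \<otimes> g) \<otimes> inv g = g \<otimes> (inv g \<otimes> x)"
        using that g by (simp add: m_assoc)
      also have "\<dots> = x" using that g by (simp add: m_assoc[symmetric])
      finally show ?thesis .
    qed
    have "(\<lambda>x. g \<otimes> x \<otimes> inv g) ` ?S = (\<lambda>x. g \<otimes> (inv g \<otimes> x \<otimes> g) \<otimes> inv g) ` T" by (simp add: image_image)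
    also have "\<dots> = T" using e subgroup.mem_carrier[OF T] by auto
    finally have RS: "residual_above p (G\<lparr>carrier := ?S\<rparr>) {\<one>} =
        {x \<in> ?S. g \<otimes> x \<otimes> inv g \<in> residual_above p (G\<lparr>carrier := T\<rparr>) {\<one>}}"
      using residual_conj[OF g S, of p] by simp
    have "inv g \<otimes> y \<otimes> g \<in> residual_above p (G\<lparr>carrier := ?S\<rparr>) {\<one>}"
      unfolding RS using \<open>y \<in> T\<close> y e[OF yc] by auto
    then have "a \<otimes> (inv g \<otimes> y \<otimes> g) \<otimes> inv a \<in> residual_above p (G\<lparr>carrier := ?S\<rparr>) {\<one>}"
      using a S N_U_iff by blast
    then have "g \<otimes> (a \<otimes> (inv g \<otimes> y \<otimes> g) \<otimes> inv a) \<otimes> inv g \<in> residual_above p (G\<lparr>carrier := T\<rparr>) {\<one>}"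
      unfolding RS by blast
    moreover have "g \<otimes> (a \<otimes> (inv g \<otimes> y \<otimes> g) \<otimes> inv a) \<otimes> inv g = g \<otimes> a \<otimes> inv g \<otimes> y \<otimes> inv (g \<otimes> a \<otimes> inv g)"
      using g ac yc by (simp add: m_assoc inv_mult_group)
    ultimately show "g \<otimes> a \<otimes> inv g \<otimes> y \<otimes> inv (g \<otimes> a \<otimes> inv g) \<in> residual_above p (G\<lparr>carrier := T\<rparr>) {\<one>}"
      by simp
  qed
qed

lemma quotient_preimage_normal:
  assumes N: "N \<lhd> G" and Q: "Q \<lhd> G Mod N"
  shows "quotient_preimage G N Q \<lhd> G" "N \<subseteq> quotient_preimage G N Q"
proof -
  interpret f: finite_group_hom G "G Mod N" "(#>) N" by (rule Mod_hom[OF N])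
  have e: "quotient_preimage G N Q = f.preimg Q" by (simp add: f.preimg_def quotient_preimage_def)
  show "quotient_preimage G N Q \<lhd> G" unfolding e by (rule f.preimg_normal[OF Q])
  show "N \<subseteq> quotient_preimage G N Q"
    unfolding e using f.ker_subset_preimg[OF normal_imp_subgroup[OF Q]] Mod_hom(2)[OF N] by simp
qed

lemma N_U_series_normal: "N_U_series p G i \<lhd> G"
proof (induction i)
  case 0
  show ?case by (simp add: one_is_normal)
next
  case (Suc i)
  show ?case
    using quotient_preimage_normal(1)[OF Suc finite_group.N_U_normal[OF finite_group_Mod[OF Suc]]] by simp
qed

lemma N_U_series_mono: "N_U_series p G i \<subseteq> N_U_series p G (Suc i)"
  using quotient_preimage_normal(2)[OF N_U_series_normal finite_group.N_U_normal[OF finite_group_Mod[OF N_U_series_normal]]]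
  by simp

text \<open>
  This is all that the proof needs to know about the ascending series: the elements of its next term
  normalize the residuals modulo the current one.
\<close>

lemma N_U_series_normalises:
  assumes x: "x \<in> N_U_series p G (Suc i)" and T: "subgroup T G" and NT: "N_U_series p G i \<subseteq> T"
    and y: "y \<in> residual_above p (G\<lparr>carrier := T\<rparr>) (N_U_series p G i)"
  shows "x \<otimes> y \<otimes> inv x \<in> residual_above p (G\<lparr>carrier := T\<rparr>) (N_U_series p G i)"
proof -
  define N where "N = N_U_series p G i"
  have N: "N \<lhd> G" unfolding N_def by (rule N_U_series_normal)
  interpret Q: finite_group "G Mod N" by (rule finite_group_Mod[OF N])
  interpret f: finite_group_hom G "G Mod N" "(#>) N" by (rule Mod_hom[OF N])
  let ?T = "(#>) N ` T"
  interpret T: finite_group_hom "G\<lparr>carrier := T\<rparr>" "(G Mod N)\<lparr>carrier := ?T\<rparr>" "(#>) N"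
    by (rule f.finite_group_hom_restrict[OF T])
  have xc: "x \<in> carrier G" using x normal_subset[OF N_U_series_normal] by blast
  have Tc: "T \<subseteq> carrier G" by (rule subgroup.subset[OF T])
  have "N #> z = N \<longleftrightarrow> z \<in> N" if "z \<in> carrier G" for z
    using Mod_hom(2)[OF N] that by (auto simp: kernel_def)
  then have "T.preimg {\<one>\<^bsub>(G Mod N)\<lparr>carrier := ?T\<rparr>\<^esub>} = N"
    using NT Tc unfolding N_def[symmetric] by (auto simp: T.preimg_def)
  then have R: "residual_above p (G\<lparr>carrier := T\<rparr>) N =
      {z \<in> T. N #> z \<in> residual_above p ((G Mod N)\<lparr>carrier := ?T\<rparr>) {\<one>\<^bsub>G Mod N\<^esub>}}"
    using T.residual_above_preimg[OF _ T.H.one_is_normal, of p] by (simp add: T.preimg_def)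
  have "N #> x \<in> N_U p (G Mod N)" using x by (simp add: quotient_preimage_def N_def)
  moreover have sT: "subgroup ?T (G Mod N)" by (rule f.subgroup_img_is_subgroup[OF T])
  moreover have yT: "y \<in> T" "N #> y \<in> residual_above p ((G Mod N)\<lparr>carrier := ?T\<rparr>) {\<one>\<^bsub>G Mod N\<^esub>}"
    using y R by (auto simp: N_def)
  ultimately have "(N #> x) \<otimes>\<^bsub>G Mod N\<^esub> (N #> y) \<otimes>\<^bsub>G Mod N\<^esub> inv\<^bsub>G Mod N\<^esub> (N #> x)
      \<in> residual_above p ((G Mod N)\<lparr>carrier := ?T\<rparr>) {\<one>\<^bsub>G Mod N\<^esub>}"
    using Q.N_U_iff by blast
  moreover have yc: "y \<in> carrier G" using yT Tc by blast
  moreover have "(N #> x) \<otimes>\<^bsub>G Mod N\<^esub> (N #> y) \<otimes>\<^bsub>G Mod N\<^esub> inv\<^bsub>G Mod N\<^esub> (N #> x) = N #> (x \<otimes> y \<otimes> inv x)"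
    using xc yc f.hom_mult f.hom_inv by (metis inv_closed m_closed)
  ultimately have m: "N #> (x \<otimes> y \<otimes> inv x) \<in> residual_above p ((G Mod N)\<lparr>carrier := ?T\<rparr>) {\<one>\<^bsub>G Mod N\<^esub>}"
    by simp
  then have "N #> (x \<otimes> y \<otimes> inv x) \<in> ?T"
    using T.H.subgroup_self residual_aboveD[OF m] sT
      finite_group.residual_above_mem(1)[OF Q.finite_group_subgroup[OF sT], of "{\<one>\<^bsub>G Mod N\<^esub>}"]
      finite_group.normal_subset[OF Q.finite_group_subgroup[OF sT]] subgroup.one_closed[OF sT]
    by (metis (no_types, lifting) empty_subsetI insert_subset partial_object.select_convs(1) partial_object.surjective partial_object.update_convs(1) subsetD)
  then have "x \<otimes> y \<otimes> inv x \<in> f.preimg ?T" using xc yc by (simp add: f.preimg_def)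
  then have "x \<otimes> y \<otimes> inv x \<in> T"
    using f.preimg_image[OF T] NT Mod_hom(2)[OF N] by (simp add: N_def)
  then show ?thesis using m R by (simp add: N_def)
qed

end

section \<open>Fixed points of p-groups\<close>

context finite_group
begin

text \<open>
  The orbits of \<open>Y\<close> on \<open>V\<close> have order a power of \<open>p\<close>, because all stabilizers contain \<open>D\<close>. If
  \<open>1\<close> were the only fixed point, counting orbits would give \<open>card V\<close> congruent to \<open>1\<close> modulo \<open>p\<close>.
  The subgroup \<open>D\<close> is there because in the applications \<open>Y\<close> need not be a \<open>p\<close>-group, only to act as one.
\<close>

lemma p_group_fixed_point:
  assumes p: "Factorial_Ring.prime p"
    and V: "V \<lhd> G" "card V = p ^ k" "V \<noteq> {\<one>}"
    and Y: "subgroup Y G" and D: "subgroup D G" "D \<subseteq> Y" "p_index p D Y"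
    and c: "\<And>d v. d \<in> D \<Longrightarrow> v \<in> V \<Longrightarrow> d \<otimes> v = v \<otimes> d"
  shows "\<exists>v\<in>V. v \<noteq> \<one> \<and> (\<forall>y\<in>Y. y \<otimes> v = v \<otimes> y)"
proof (rule ccontr)
  assume no: "\<not> ?thesis"
  let ?act = "\<lambda>g. \<lambda>h\<in>carrier G. g \<otimes> h \<otimes> inv g"
  let ?Y = "G\<lparr>carrier := Y\<rparr>"
  have act: "group_action G (carrier G) ?act" by (rule action_by_conjugation)
  have actY: "group_action ?Y (carrier G) ?act" by (rule group_action.induced_action[OF act Y])
  note Y_sym = group_action.orbit_sym[OF actY] and Y_trans = group_action.orbit_trans[OF actY]
  have sV: "subgroup V G" using V(1) by (rule normal_imp_subgroup)
  have Vc: "v \<in> carrier G" if "v \<in> V" for v using that V(1) normal_subset by blast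
  have Yc: "y \<in> carrier G" if "y \<in> Y" for y using subgroup.mem_carrier[OF Y that] .
  have oneV: "\<one> \<in> V" by (rule subgroup.one_closed[OF sV])
  define orb where "orb v = orbit ?Y ?act v" for v
  have orb: "orb v = (\<lambda>y. y \<otimes> v \<otimes> inv y) ` Y" if "v \<in> V" for v
    using Vc[OF that] unfolding orb_def orbit_def by auto
  have orbV: "orb v \<subseteq> V" if "v \<in> V" for v
    unfolding orb[OF that] using normal_conj[OF V(1)] Yc that by auto
  have self: "v \<in> orb v" if "v \<in> V" for v
    unfolding orb[OF that] using subgroup.one_closed[OF Y] Vc[OF that] by force
  have meet: "orb v = orb w" if vw: "v \<in> V" "w \<in> V" "orb v \<inter> orb w \<noteq> {}" for v w
  proof -
    obtain x where x: "x \<in> orb v" "x \<in> orb w" using vw by blast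
    have xc: "x \<in> carrier G" using x orbV[OF vw(1)] Vc by blast
    have "orb u = orb x" if u: "u \<in> V" "x \<in> orb u" for u
    proof -
      have sub: "z \<in> carrier G" if "z \<in> orb w" "w \<in> V" for z w using orbV[of w] that Vc by blast
      have xV: "x \<in> V" using orbV u by blast
      have "u \<in> orb x" using Y_sym[of u x] Vc[OF u(1)] xc u(2) unfolding orb_def by simp
      then show ?thesis
        using Y_trans[of u x] Y_trans[of x u] Vc[OF u(1)] xc u sub xV
        unfolding orb_def by blast
    qed
    then have "orb v = orb x" "orb w = orb x" using vw x by blast+
    then show ?thesis by simp
  qed
  have cY: "card Y > 0" "card D > 0" using card_subgroup_pos Y D by auto
  have pw: "\<exists>j. card (orb v) = p ^ j" if v: "v \<in> V" for v
  proof -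
    let ?S = "stabilizer ?Y ?act v"
    have s: "subgroup ?S ?Y" by (rule group_action.stabilizer_subgroup[OF actY Vc[OF v]])
    then have S: "subgroup ?S G" by (rule incl_subgroup[OF Y])
    have "y \<otimes> v \<otimes> inv y = v" if "y \<in> D" for y
      using c[OF that v] Yc[of y] that D(2) Vc[OF v] by (simp add: subsetD m_assoc)
    then have DS: "D \<subseteq> ?S" using D(2) Vc[OF v] by (auto simp: stabilizer_def)
    obtain u where u: "card ?S = u * card D" using card_subgroup_dvd[OF D(1) S DS] unfolding dvd_def by (metis mult.commute)
    have "card (orb v) * card ?S = card Y"
      using group_action.orbit_stabilizer_theorem[OF actY Vc[OF v]] by (simp add: orb_def order_def)
    moreover obtain m where "card Y = p ^ m * card D" using D(3) by (auto simp: p_index_def)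
    ultimately have "(card (orb v) * u) * card D = p ^ m * card D" using u by (simp only: mult.assoc)
    then have "card (orb v) * u = p ^ m" using cY by simp
    then have "card (orb v) dvd p ^ m" by (metis dvd_triv_left)
    then show ?thesis using divides_primepow_nat[OF p] by blast
  qed
  have dv: "p dvd card (orb v)" if v: "v \<in> V" "v \<noteq> \<one>" for v
  proof -
    obtain y where y: "y \<in> Y" "y \<otimes> v \<noteq> v \<otimes> y" using no v by blast
    have "y \<otimes> v \<otimes> inv y \<noteq> v"
    proof
      assume "y \<otimes> v \<otimes> inv y = v"
      then have "y \<otimes> v = v \<otimes> y" using Yc[OF y(1)] Vc[OF v(1)] by (metis inv_solve_right m_closed)
      then show False using y(2) by simp
    qed
    moreover have "y \<otimes> v \<otimes> inv y \<in> orb v" using orb[OF v(1)] y(1) by blast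
    ultimately have "card (orb v) \<noteq> 1" using self[OF v(1)] by (metis card_1_singletonE singletonD)
    then show ?thesis using pw[OF v(1)] by (metis dvd_power power_0 not_gr0)
  qed
  have o1: "orb \<one> = {\<one>}" unfolding orb[OF oneV] using Yc subgroup.one_closed[OF Y] by force
  have fV: "finite V" using finite_subset_carrier normal_subset V(1) by blast
  have "card V = (\<Sum>B\<in>orb ` V. card B)"
  proof -
    have "V = \<Union>(orb ` V)" using orbV self by blast
    moreover have "card (\<Union>(orb ` V)) = (\<Sum>B\<in>orb ` V. card B)"
    proof (rule card_Union_disjoint)
      show "disjoint (orb ` V)" unfolding disjoint_def using meet by blast
      show "\<And>A. A \<in> orb ` V \<Longrightarrow> finite A" using orbV fV finite_subset by blast
    qed
    ultimately show ?thesis by simp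
  qed
  also have "\<dots> = card (orb \<one>) + (\<Sum>B\<in>orb ` V - {orb \<one>}. card B)"
    using oneV fV by (simp add: sum.remove)
  finally have e: "card V = 1 + (\<Sum>B\<in>orb ` V - {orb \<one>}. card B)" using o1 by simp
  have "p dvd (\<Sum>B\<in>orb ` V - {orb \<one>}. card B)"
    by (rule dvd_sum) (use dv in blast)
  moreover have "p dvd card V"
  proof -
    have "card V \<noteq> 1" using V(3) oneV by (metis card_1_singletonE singletonD)
    then show ?thesis using V(2) by (cases k) auto
  qed
  ultimately have "p dvd 1" using e by (metis dvd_add_left_iff)
  then show False using p by (simp add: prime_nat_iff)
qed

lemma section_fixed_point:
  assumes p: "Factorial_Ring.prime p" and L: "L \<lhd> G" and H: "H \<lhd> G" "L \<subset> H" "p_index p L H"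
    and Y: "subgroup Y G" and D: "subgroup D G" "D \<subseteq> Y" "p_index p D Y"
    and c: "\<And>d h. d \<in> D \<Longrightarrow> h \<in> H \<Longrightarrow> commute_mod G L d h"
  shows "\<exists>h\<in>H. h \<notin> L \<and> (\<forall>y\<in>Y. commute_mod G L y h)"
proof -
  interpret f: finite_group_hom G "G Mod L" "(#>) L" by (rule Mod_hom[OF L])
  interpret Q: finite_group "G Mod L" by (rule finite_group_Mod[OF L])
  have Hc: "h \<in> carrier G" if "h \<in> H" for h using that H(1) normal_subset by blast
  have Yc: "y \<in> carrier G" if "y \<in> Y" for y using subgroup.mem_carrier[OF Y that] .
  note one = Mod_eq_one_iff[OF L]
  obtain n where n: "card ((#>) L ` H) = p ^ n"
    using p_index_Mod[OF L normal_imp_subgroup[OF H(1)] _ H(3)] H(2) by blast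
  have "\<exists>v\<in>(#>) L ` H. v \<noteq> \<one>\<^bsub>G Mod L\<^esub> \<and> (\<forall>y\<in>(#>) L ` Y. y \<otimes>\<^bsub>G Mod L\<^esub> v = v \<otimes>\<^bsub>G Mod L\<^esub> y)"
  proof (rule Q.p_group_fixed_point[OF p _ n])
    show "(#>) L ` H \<lhd> G Mod L" by (rule f.image_normal[OF H(1) Mod_hom(3)[OF L]])
    obtain h where "h \<in> H" "h \<notin> L" using H(2) by blast
    then have "L #> h \<in> (#>) L ` H" "L #> h \<noteq> \<one>\<^bsub>G Mod L\<^esub>" using one[of h] Hc[of h] by simp_all
    then show "(#>) L ` H \<noteq> {\<one>\<^bsub>G Mod L\<^esub>}" by (metis singletonD)
    show "subgroup ((#>) L ` Y) (G Mod L)" "subgroup ((#>) L ` D) (G Mod L)"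
      using f.subgroup_img_is_subgroup[OF Y] f.subgroup_img_is_subgroup[OF D(1)] .
    show "(#>) L ` D \<subseteq> (#>) L ` Y" using D(2) by blast
    show "p_index p ((#>) L ` D) ((#>) L ` Y)" by (rule f.index_image(1)[OF p D(1) Y D(2,3)])
    fix d v assume "d \<in> (#>) L ` D" "v \<in> (#>) L ` H"
    then obtain d' v' where "d' \<in> D" "v' \<in> H" "d = L #> d'" "v = L #> v'" by blast
    then show "d \<otimes>\<^bsub>G Mod L\<^esub> v = v \<otimes>\<^bsub>G Mod L\<^esub> d"
      using c[of d' v'] commute_mod_Mod[OF L, of d' v'] Hc[of v'] Yc[of d'] D(2) by (simp add: subsetD)
  qed
  then obtain h where "h \<in> H" "L #> h \<noteq> \<one>\<^bsub>G Mod L\<^esub>"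
    "\<forall>y\<in>Y. (L #> y) \<otimes>\<^bsub>G Mod L\<^esub> (L #> h) = (L #> h) \<otimes>\<^bsub>G Mod L\<^esub> (L #> y)" by blast
  then have "h \<in> H" "h \<notin> L" "\<forall>y\<in>Y. commute_mod G L y h"
    using one[of h] Hc[of h] commute_mod_Mod[OF L _ Hc[of h]] Yc by simp_all
  then show ?thesis by blast
qed

text \<open>
  The fixed points of \<open>Y\<close> on \<open>H/L\<close> form a normal section, nontrivial by the previous lemma, hence all
  of \<open>H/L\<close>. With \<open>D\<close> the centralizer of \<open>H/L\<close> this says that the quotient by that centralizer has no nontrivial
  normal \<open>p\<close>-subgroup; with \<open>Y = H\<close> and \<open>D = L\<close> it says that \<open>H/L\<close> is abelian.
\<close>

lemma chief_p_centralized: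
  assumes p: "Factorial_Ring.prime p" and S: "chief_step G L H" and pi: "p_index p L H"
    and Y: "Y \<lhd> G" and D: "subgroup D G" "D \<subseteq> Y" "p_index p D Y"
    and c: "\<And>d h. d \<in> D \<Longrightarrow> h \<in> H \<Longrightarrow> commute_mod G L d h"
  shows "Y \<subseteq> section_centralizer G H L"
proof -
  have L: "L \<lhd> G" and H: "H \<lhd> G" "L \<subset> H" using S by (auto simp: chief_step_def)
  have Yc: "Y \<subseteq> carrier G" by (rule normal_subset[OF Y])
  obtain h where h: "h \<in> H" "h \<notin> L" "\<forall>y\<in>Y. commute_mod G L y h"
    using section_fixed_point[OF p L H pi normal_imp_subgroup[OF Y] D c] by blast
  let ?Z = "H \<inter> section_centralizer G Y L"
  have "?Z \<lhd> G" by (rule normal_subgroup_intersect[OF H(1) section_centralizer_normal[OF L Y]])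
  moreover have "L \<subseteq> ?Z"
  proof
    fix l assume l: "l \<in> L"
    have "commute_mod G L l y" if "y \<in> Y" for y
      using commute_mod_in[OF L _ l, of y] commute_mod_sym[of L y l] that Yc by blast
    then show "l \<in> ?Z" using l H(2) normal_subset[OF L] by (auto simp: section_centralizer_def)
  qed
  moreover have "h \<in> ?Z"
  proof -
    have "commute_mod G L h y" if "y \<in> Y" for y using h(3) commute_mod_sym[of L y h] that by blast
    then show ?thesis using h(1) normal_subset[OF H(1)] by (auto simp: section_centralizer_def)
  qed
  ultimately have "?Z = H" using S h(2) by (auto simp: chief_step_def)
  have "commute_mod G L y x" if "y \<in> Y" "x \<in> H" for x y
  proof -
    have "x \<in> section_centralizer G Y L" using \<open>?Z = H\<close> that(2) by blast
    then show ?thesis using that(1) commute_mod_sym[of L x y] by (simp add: section_centralizer_def)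
  qed
  then show ?thesis using Yc by (auto simp: section_centralizer_def)
qed

lemma chief_p_abelian:
  assumes p: "Factorial_Ring.prime p" and S: "chief_step G L H" and pi: "p_index p L H"
    and "x \<in> H" "y \<in> H"
  shows "commute_mod G L x y"
proof -
  have L: "L \<lhd> G" and H: "H \<lhd> G" "L \<subset> H" using S by (auto simp: chief_step_def)
  have "H \<subseteq> section_centralizer G H L"
  proof (rule chief_p_centralized[OF p S pi H(1) normal_imp_subgroup[OF L] _ pi])
    show "L \<subseteq> H" using H(2) by blast
    fix d h assume "d \<in> L" "h \<in> H"
    then show "commute_mod G L d h"
      using commute_mod_in[OF L, of h d] commute_mod_sym[of L h d] normal_subset[OF H(1)] by blast
  qed
  then show ?thesis using assms(4,5) by (auto simp: section_centralizer_def)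
qed

text \<open>
  Such a \<open>D\<close> contains a Sylow \<open>p\<close>-subgroup.
\<close>

lemma p'_index_if_contains_p_elements:
  assumes p: "Factorial_Ring.prime p" and D: "subgroup D G"
    and c: "\<And>x j. x \<in> carrier G \<Longrightarrow> x [^] (p ^ j) = \<one> \<Longrightarrow> x \<in> D"
  shows "p'_index p D (carrier G)"
proof -
  have pos: "order G \<noteq> 0" using fin by (simp add: order_gt_0_iff_finite)
  obtain m where m: "order G = p ^ multiplicity p (order G) * m" "\<not> p dvd m"
    using multiplicity_decompose'[of "order G" p] pos not_prime_unit[of p] p by metis
  define a where "a = multiplicity p (order G)"
  obtain S where S: "subgroup S G" "card S = p ^ a"
    using sylow_thm[OF p is_group m(1) fin] unfolding a_def by blast
  have "S \<subseteq> D"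
  proof
    fix x assume x: "x \<in> S"
    interpret S: group "G\<lparr>carrier := S\<rparr>" by (rule subgroup_imp_group[OF S(1)])
    have "x [^]\<^bsub>G\<lparr>carrier := S\<rparr>\<^esub> order (G\<lparr>carrier := S\<rparr>) = \<one>"
      using S.pow_order_eq_1[of x] x by simp
    then have "x [^] (p ^ a) = \<one>" using S(2) by (simp add: order_def nat_pow_def)
    then show "x \<in> D" using c x subgroup.mem_carrier[OF S(1)] by blast
  qed
  then have "p ^ a dvd card D" using card_subgroup_dvd[OF S(1) D] S(2) by simp
  then obtain u where u: "card D = p ^ a * u" by blast
  have "card D dvd card (carrier G)" by (rule card_subgroup_dvd[OF D subgroup_self subgroup.subset[OF D]])
  then obtain k where k: "card (carrier G) = card D * k" by blast
  have "p ^ a * (u * k) = p ^ a * m" using u k m(1) by (simp add: order_def a_def)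
  then have "u * k = m" using prime_gt_0_nat[OF p] by simp
  then have "\<not> p dvd k" using m(2) by auto
  then show ?thesis using k unfolding p'_index_def by (metis mult.commute)
qed

end

section \<open>The Schur-Zassenhaus theorem with the Frattini argument\<close>

lemma (in comm_group) hom_finprod:
  assumes "k \<in> hom G G" "u \<in> I \<rightarrow> carrier G"
  shows "k (finprod G u I) = finprod G (\<lambda>i. k (u i)) I"
proof -
  have k: "k x \<in> carrier G" if "x \<in> carrier G" for x using assms(1) that by (auto simp: hom_def)
  have "group_hom G G k" using assms(1) by unfold_locales auto
  then have one: "k \<one> = \<one>" by (rule group_hom.hom_one)
  show ?thesis using assms(2)
  proof (induction I rule: infinite_finite_induct)
    case (insert i I)
    then have "(\<lambda>i. k (u i)) \<in> I \<rightarrow> carrier G" "k (u i) \<in> carrier G" using k by auto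
    moreover have "u i \<in> carrier G" "u \<in> I \<rightarrow> carrier G" using insert by auto
    ultimately show ?case using insert assms(1) by (simp add: hom_mult)
  qed (simp_all add: one)
qed

text \<open>
  An abelian normal subgroup \<open>ker\<close> of \<open>G\<close> that is a Hall subgroup of a larger normal subgroup \<open>M\<close>. A
  complement of \<open>ker\<close> in \<open>M\<close> is obtained by averaging: each transversal of \<open>ker\<close> defines a crossed homomorphism
  on \<open>M\<close> by a product over the cosets, and the zero set of that crossed homomorphism is a complement.
  That any two transversals give conjugate complements yields the Frattini argument at the same time.
\<close>

locale coprime_abelian_kernel = finite_group_hom +
  fixes M
  assumes surj: "\<phi> ` carrier G = carrier Q"
    and M: "M \<lhd> G" and kerM: "ker \<subseteq> M"
    and comm: "\<And>x y. x \<in> ker \<Longrightarrow> y \<in> ker \<Longrightarrow> x \<otimes> y = y \<otimes> x"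
    and cop: "coprime (card ker) (card (\<phi> ` M))"
begin

abbreviation "A \<equiv> G\<lparr>carrier := ker\<rparr>"
abbreviation "I \<equiv> \<phi> ` M"
abbreviation "n \<equiv> card I"

lemma A_comm_group: "comm_group A"
proof -
  have "group A" by (rule G.subgroup_imp_group[OF subgroup_kernel])
  then show ?thesis by (rule group.group_comm_groupI) (use comm in auto)
qed

sublocale A: comm_group A by (rule A_comm_group)

definition transversal :: "('c \<Rightarrow> 'a) \<Rightarrow> bool" where
  "transversal r \<longleftrightarrow> (\<forall>c\<in>carrier Q. r c \<in> carrier G \<and> \<phi> (r c) = c)"

text \<open>
  The product over all cosets \<open>c\<close> of the elements by which \<open>g\<close> moves the transversal \<open>r\<close> off
  itself. It lies in the abelian group \<open>ker\<close>, so the order of the factors does not matter.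
\<close>

definition cocycle :: "('c \<Rightarrow> 'a) \<Rightarrow> 'a \<Rightarrow> 'a" where
  "cocycle r g = finprod A (\<lambda>c. g \<otimes> r c \<otimes> inv (r (\<phi> g \<otimes>\<^bsub>Q\<^esub> c))) I"

lemma M_sub: "subgroup M G" by (rule normal_imp_subgroup[OF M])

lemma MG: "x \<in> M \<Longrightarrow> x \<in> carrier G" using subgroup.mem_carrier[OF M_sub] .
lemma kG: "x \<in> ker \<Longrightarrow> x \<in> carrier G" by (simp add: kernel_def)
lemma ker_iff: "x \<in> ker \<longleftrightarrow> x \<in> carrier G \<and> \<phi> x = \<one>\<^bsub>Q\<^esub>" by (simp add: kernel_def)

lemma I_sub: "subgroup I Q" by (rule subgroup_img_is_subgroup[OF M_sub])
lemma IQ: "c \<in> I \<Longrightarrow> c \<in> carrier Q" using subgroup.mem_carrier[OF I_sub] .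
lemma I_mult: "g \<in> M \<Longrightarrow> c \<in> I \<Longrightarrow> \<phi> g \<otimes>\<^bsub>Q\<^esub> c \<in> I" using subgroup.m_closed[OF I_sub] by blast

lemma term_in_ker:
  assumes "transversal r" "g \<in> carrier G" "c \<in> carrier Q"
  shows "g \<otimes> r c \<otimes> inv (r (\<phi> g \<otimes>\<^bsub>Q\<^esub> c)) \<in> ker"
proof -
  have "\<phi> g \<otimes>\<^bsub>Q\<^esub> c \<in> carrier Q" using assms by simp
  then show ?thesis using assms by (simp add: transversal_def ker_iff)
qed

lemma quot_in_ker:
  assumes "transversal r" "transversal s" "c \<in> carrier Q"
  shows "r c \<otimes> inv (s c) \<in> ker"
  using assms by (simp add: transversal_def ker_iff)

lemma conj_ker: "g \<in> carrier G \<Longrightarrow> x \<in> ker \<Longrightarrow> g \<otimes> x \<otimes> inv g \<in> ker"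
  by (rule G.normal_conj[OF normal_kernel])

lemma conj_hom_ker: "g \<in> carrier G \<Longrightarrow> (\<lambda>x. g \<otimes> x \<otimes> inv g) \<in> hom A A"
proof -
  assume g: "g \<in> carrier G"
  have "g \<otimes> (x \<otimes> y) \<otimes> inv g = g \<otimes> x \<otimes> inv g \<otimes> (g \<otimes> y \<otimes> inv g)" if "x \<in> carrier G" "y \<in> carrier G" for x y
  proof -
    have "inv g \<otimes> (g \<otimes> (y \<otimes> inv g)) = y \<otimes> inv g" using g that by (simp add: G.m_assoc[symmetric])
    then show ?thesis using g that by (simp add: G.m_assoc)
  qed
  then show ?thesis using g conj_ker[OF g] kG by (auto simp: hom_def)
qed

lemma conj_finprod:
  assumes "g \<in> carrier G" "u \<in> J \<rightarrow> ker"
  shows "g \<otimes> finprod A u J \<otimes> inv g = finprod A (\<lambda>c. g \<otimes> u c \<otimes> inv g) J"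
  using A.hom_finprod[OF conj_hom_ker[OF assms(1)], of u J] assms(2) by simp

lemma finprod_ker: "u \<in> J \<rightarrow> ker \<Longrightarrow> finprod A u J \<in> ker"
  using A.finprod_closed[of u J] by simp

lemma cocycle_in_ker: "transversal r \<Longrightarrow> g \<in> carrier G \<Longrightarrow> cocycle r g \<in> ker"
  unfolding cocycle_def by (rule finprod_ker) (use term_in_ker IQ in blast)

lemma shift_bij:
  assumes "g \<in> M"
  shows "(\<lambda>c. \<phi> g \<otimes>\<^bsub>Q\<^esub> c) ` I = I" "inj_on (\<lambda>c. \<phi> g \<otimes>\<^bsub>Q\<^esub> c) I"
proof -
  have g: "\<phi> g \<in> carrier Q" using MG[OF assms] by simp
  show inj: "inj_on (\<lambda>c. \<phi> g \<otimes>\<^bsub>Q\<^esub> c) I" using g IQ by (intro inj_onI) simp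
  have "finite I" using G.finite_subset_carrier[OF subgroup.subset[OF M_sub]] by simp
  then show "(\<lambda>c. \<phi> g \<otimes>\<^bsub>Q\<^esub> c) ` I = I" by (rule endo_inj_surj) (use I_mult[OF assms] inj in auto)
qed

lemma finprod_shift:
  assumes "g \<in> M" "u \<in> I \<rightarrow> ker"
  shows "finprod A (\<lambda>c. u (\<phi> g \<otimes>\<^bsub>Q\<^esub> c)) I = finprod A u I"
  using A.finprod_reindex[of u "\<lambda>c. \<phi> g \<otimes>\<^bsub>Q\<^esub> c" I] shift_bij[OF assms(1)] assms(2) by simp

lemma finprod_mult:
  assumes "u \<in> J \<rightarrow> ker" "v \<in> J \<rightarrow> ker"
  shows "finprod A (\<lambda>c. u c \<otimes> v c) J = finprod A u J \<otimes> finprod A v J"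
  using A.finprod_multf[of u J v] assms by simp

lemma finprod_eq:
  assumes "\<And>c. c \<in> J \<Longrightarrow> u c = v c" "v \<in> J \<rightarrow> ker"
  shows "finprod A u J = finprod A v J"
  by (rule A.finprod_cong') (use assms in auto)

text \<open>
  The crossed homomorphism law; the factors of \<open>h\<close> are conjugated by \<open>g\<close>, and those of \<open>g\<close> are
  reindexed by the shift with \<open>h\<close>.
\<close>

lemma cocycle_mult:
  assumes r: "transversal r" and g: "g \<in> M" and h: "h \<in> M"
  shows "cocycle r (g \<otimes> h) = g \<otimes> cocycle r h \<otimes> inv g \<otimes> cocycle r g"
proof -
  note gG = MG[OF g] and hG = MG[OF h]
  let ?t = "\<lambda>g c. g \<otimes> r c \<otimes> inv (r (\<phi> g \<otimes>\<^bsub>Q\<^esub> c))"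
  have t: "?t h \<in> I \<rightarrow> ker" "?t g \<in> I \<rightarrow> ker" using term_in_ker[OF r] gG hG IQ by auto
  have "cocycle r (g \<otimes> h) = finprod A (\<lambda>c. (g \<otimes> ?t h c \<otimes> inv g) \<otimes> ?t g (\<phi> h \<otimes>\<^bsub>Q\<^esub> c)) I"
    unfolding cocycle_def
  proof (rule finprod_eq)
    show "(\<lambda>c. (g \<otimes> ?t h c \<otimes> inv g) \<otimes> ?t g (\<phi> h \<otimes>\<^bsub>Q\<^esub> c)) \<in> I \<rightarrow> ker"
    proof
      fix c assume c: "c \<in> I"
      have "g \<otimes> ?t h c \<otimes> inv g \<in> ker" using conj_ker[OF gG] t(1) c by blast
      moreover have "?t g (\<phi> h \<otimes>\<^bsub>Q\<^esub> c) \<in> ker" using t(2) I_mult[OF h c] by blast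
      ultimately show "(g \<otimes> ?t h c \<otimes> inv g) \<otimes> ?t g (\<phi> h \<otimes>\<^bsub>Q\<^esub> c) \<in> ker"
        by (rule subgroup.m_closed[OF subgroup_kernel])
    qed
    fix c assume "c \<in> I"
    then have c: "c \<in> carrier Q" "\<phi> h \<otimes>\<^bsub>Q\<^esub> c \<in> carrier Q" using IQ hG by auto
    have R: "r c \<in> carrier G" "r (\<phi> h \<otimes>\<^bsub>Q\<^esub> c) \<in> carrier G"
      "r (\<phi> g \<otimes>\<^bsub>Q\<^esub> (\<phi> h \<otimes>\<^bsub>Q\<^esub> c)) \<in> carrier G"
      using r c gG by (auto simp: transversal_def)
    have "\<phi> (g \<otimes> h) \<otimes>\<^bsub>Q\<^esub> c = \<phi> g \<otimes>\<^bsub>Q\<^esub> (\<phi> h \<otimes>\<^bsub>Q\<^esub> c)" using gG hG c by (simp add: H.m_assoc)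
    moreover define s where "s = r (\<phi> h \<otimes>\<^bsub>Q\<^esub> c)"
    moreover have "(g \<otimes> h) \<otimes> r c \<otimes> inv v = g \<otimes> (h \<otimes> r c \<otimes> inv s) \<otimes> inv g \<otimes> (g \<otimes> s \<otimes> inv v)"
      if "v \<in> carrier G" for v
    proof -
      have s: "s \<in> carrier G" using R s_def by simp
      have "inv g \<otimes> (g \<otimes> (s \<otimes> inv v)) = s \<otimes> inv v" "inv s \<otimes> (s \<otimes> inv v) = inv v"
        using gG s that by (simp_all add: G.m_assoc[symmetric])
      then show ?thesis using gG hG R s that by (simp add: G.m_assoc)
    qed
    ultimately show "(g \<otimes> h) \<otimes> r c \<otimes> inv (r (\<phi> (g \<otimes> h) \<otimes>\<^bsub>Q\<^esub> c)) =
        (g \<otimes> ?t h c \<otimes> inv g) \<otimes> ?t g (\<phi> h \<otimes>\<^bsub>Q\<^esub> c)"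
      using R by simp
  qed
  also have "\<dots> = finprod A (\<lambda>c. g \<otimes> ?t h c \<otimes> inv g) I \<otimes> finprod A (\<lambda>c. ?t g (\<phi> h \<otimes>\<^bsub>Q\<^esub> c)) I"
  proof (rule finprod_mult)
    show "(\<lambda>c. g \<otimes> ?t h c \<otimes> inv g) \<in> I \<rightarrow> ker" using t(1) conj_ker[OF gG] by blast
    show "(\<lambda>c. ?t g (\<phi> h \<otimes>\<^bsub>Q\<^esub> c)) \<in> I \<rightarrow> ker" using t(2) I_mult[OF h] by blast
  qed
  also have "\<dots> = g \<otimes> cocycle r h \<otimes> inv g \<otimes> cocycle r g"
    using conj_finprod[OF gG t(1)] finprod_shift[OF h t(2)] unfolding cocycle_def by simp
  finally show ?thesis .
qed

text \<open>
  An element of the kernel fixes all cosets, so each of the \<open>n\<close> factors is that element.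
\<close>

lemma cocycle_ker:
  assumes r: "transversal r" and x: "x \<in> ker"
  shows "cocycle r x = x [^] n"
proof -
  have "cocycle r x = finprod A (\<lambda>c. x) I"
    unfolding cocycle_def
  proof (rule finprod_eq)
    fix c assume "c \<in> I"
    then have c: "c \<in> carrier Q" by (rule IQ)
    then have "r c \<in> carrier G" using r by (simp add: transversal_def)
    then show "x \<otimes> r c \<otimes> inv (r (\<phi> x \<otimes>\<^bsub>Q\<^esub> c)) = x"
      using x c by (simp add: ker_iff G.m_assoc)
  qed (use x in auto)
  also have "\<dots> = x [^]\<^bsub>A\<^esub> n" using A.finprod_const[of x I] x by simp
  finally show ?thesis by (simp add: nat_pow_def)
qed

lemma ker_power_eq_one: "x \<in> ker \<Longrightarrow> x [^] n = \<one> \<Longrightarrow> x = \<one>"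
proof -
  assume x: "x \<in> ker" and e: "x [^] n = \<one>"
  have "x [^]\<^bsub>A\<^esub> n = \<one>\<^bsub>A\<^esub>" using e by (simp add: nat_pow_def)
  then have "A.ord x dvd n" using A.pow_eq_id[of x n] x by simp
  moreover have "A.ord x dvd card ker" using A.ord_dvd_group_order[of x] x by (simp add: order_def)
  ultimately have "A.ord x = 1" using cop coprime_common_divisor_nat by blast
  then show "x = \<one>" using A.ord_eq_1[of x] x by simp
qed


text \<open>
  Taking \<open>n\<close>-th powers is injective on \<open>ker\<close> since \<open>n\<close> is prime to its order, hence surjective.
\<close>

lemma ker_nth_root:
  assumes "y \<in> ker"
  obtains x where "x \<in> ker" "x [^] n = y"
proof -
  have eq: "x [^]\<^bsub>A\<^esub> n = x [^] n" for x by (simp add: nat_pow_def)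
  have "inj_on (\<lambda>x. x [^]\<^bsub>A\<^esub> n) ker"
  proof (rule inj_onI)
    fix x z assume x: "x \<in> ker" and z: "z \<in> ker" and e: "x [^]\<^bsub>A\<^esub> n = z [^]\<^bsub>A\<^esub> n"
    have c: "x \<in> carrier A" "z \<in> carrier A" using x z by simp_all
    then have "(x \<otimes>\<^bsub>A\<^esub> inv\<^bsub>A\<^esub> z) [^]\<^bsub>A\<^esub> n = \<one>\<^bsub>A\<^esub>"
      using e by (simp only: A.nat_pow_distrib A.inv_closed A.nat_pow_inv A.r_inv A.nat_pow_closed)
    moreover have "x \<otimes>\<^bsub>A\<^esub> inv\<^bsub>A\<^esub> z \<in> ker" using A.m_closed[OF c(1) A.inv_closed[OF c(2)]] by simp
    ultimately have "x \<otimes>\<^bsub>A\<^esub> inv\<^bsub>A\<^esub> z = \<one>\<^bsub>A\<^esub>" using ker_power_eq_one unfolding eq by simp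
    then have "inv\<^bsub>A\<^esub> (inv\<^bsub>A\<^esub> z) = x" using A.inv_equality c A.inv_closed by metis
    then show "x = z" using A.inv_inv[OF c(2)] by metis
  qed
  moreover have "(\<lambda>x. x [^]\<^bsub>A\<^esub> n) ` ker \<subseteq> ker"
  proof (rule image_subsetI)
    fix x assume "x \<in> ker"
    then show "x [^]\<^bsub>A\<^esub> n \<in> ker" using A.nat_pow_closed[of x n] by simp
  qed
  moreover have "finite ker" by (rule G.finite_subset_carrier[OF subgroup.subset[OF subgroup_kernel]])
  ultimately have "(\<lambda>x. x [^]\<^bsub>A\<^esub> n) ` ker = ker" using endo_inj_surj[of ker] by simp
  then obtain x where "x \<in> ker" "y = x [^]\<^bsub>A\<^esub> n" using assms by blast
  then show ?thesis using that[of x] eq[of x] by simp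
qed

text \<open>
  Conjugating the transversal conjugates the crossed homomorphism.
\<close>

lemma cocycle_conj:
  assumes r: "transversal r" and t: "t \<in> carrier G" and g: "g \<in> M"
  defines "s \<equiv> \<lambda>c. t \<otimes> r (inv\<^bsub>Q\<^esub> (\<phi> t) \<otimes>\<^bsub>Q\<^esub> c \<otimes>\<^bsub>Q\<^esub> \<phi> t) \<otimes> inv t"
  shows "transversal s" "cocycle s (t \<otimes> g \<otimes> inv t) = t \<otimes> cocycle r g \<otimes> inv t"
proof -
  let ?T = "\<phi> t"
  have T: "?T \<in> carrier Q" using t by simp
  note gG = MG[OF g]
  have conj1: "inv\<^bsub>Q\<^esub> ?T \<otimes>\<^bsub>Q\<^esub> (?T \<otimes>\<^bsub>Q\<^esub> c \<otimes>\<^bsub>Q\<^esub> inv\<^bsub>Q\<^esub> ?T) \<otimes>\<^bsub>Q\<^esub> ?T = c" if "c \<in> carrier Q" for c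
  proof -
    have "inv\<^bsub>Q\<^esub> ?T \<otimes>\<^bsub>Q\<^esub> (?T \<otimes>\<^bsub>Q\<^esub> c \<otimes>\<^bsub>Q\<^esub> inv\<^bsub>Q\<^esub> ?T) \<otimes>\<^bsub>Q\<^esub> ?T = inv\<^bsub>Q\<^esub> ?T \<otimes>\<^bsub>Q\<^esub> (?T \<otimes>\<^bsub>Q\<^esub> c)"
      using T that by (simp add: H.m_assoc)
    also have "\<dots> = c" using T that by (simp add: H.m_assoc[symmetric])
    finally show ?thesis .
  qed
  have conj2: "?T \<otimes>\<^bsub>Q\<^esub> (inv\<^bsub>Q\<^esub> ?T \<otimes>\<^bsub>Q\<^esub> c \<otimes>\<^bsub>Q\<^esub> ?T) \<otimes>\<^bsub>Q\<^esub> inv\<^bsub>Q\<^esub> ?T = c" if "c \<in> carrier Q" for c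
  proof -
    have "?T \<otimes>\<^bsub>Q\<^esub> (inv\<^bsub>Q\<^esub> ?T \<otimes>\<^bsub>Q\<^esub> c \<otimes>\<^bsub>Q\<^esub> ?T) \<otimes>\<^bsub>Q\<^esub> inv\<^bsub>Q\<^esub> ?T = ?T \<otimes>\<^bsub>Q\<^esub> (inv\<^bsub>Q\<^esub> ?T \<otimes>\<^bsub>Q\<^esub> c)"
      using T that by (simp add: H.m_assoc)
    also have "\<dots> = c" using T that by (simp add: H.m_assoc[symmetric])
    finally show ?thesis .
  qed
  have rc: "r c \<in> carrier G" "\<phi> (r c) = c" if "c \<in> carrier Q" for c
    using r that by (auto simp: transversal_def)
  show s: "transversal s"
    unfolding transversal_def
  proof
    fix c assume c: "c \<in> carrier Q"
    let ?c = "inv\<^bsub>Q\<^esub> ?T \<otimes>\<^bsub>Q\<^esub> c \<otimes>\<^bsub>Q\<^esub> ?T"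
    have "?c \<in> carrier Q" using T c by simp
    then show "s c \<in> carrier G \<and> \<phi> (s c) = c"
      using rc[of ?c] t conj2[OF c] by (simp add: s_def)
  qed
  let ?g = "t \<otimes> g \<otimes> inv t"
  have gM: "?g \<in> M" using G.normal_conj[OF M t g] .
  let ?k = "\<lambda>c. ?T \<otimes>\<^bsub>Q\<^esub> c \<otimes>\<^bsub>Q\<^esub> inv\<^bsub>Q\<^esub> ?T"
  have nI: "I \<lhd> Q" by (rule image_normal[OF M surj])
  have kI: "?k c \<in> I" if "c \<in> I" for c using nI T that H.normal_inv_iff by blast
  have inj: "inj_on ?k I"
    by (rule inj_on_inverseI[where g = "\<lambda>c. inv\<^bsub>Q\<^esub> ?T \<otimes>\<^bsub>Q\<^esub> c \<otimes>\<^bsub>Q\<^esub> ?T"]) (use conj1 IQ in blast)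
  have fI: "finite I" using G.finite_subset_carrier[OF subgroup.subset[OF M_sub]] by simp
  have im: "?k ` I = I" by (rule endo_inj_surj[OF fI _ inj]) (use kI in blast)
  let ?t = "\<lambda>c. ?g \<otimes> s c \<otimes> inv (s (\<phi> ?g \<otimes>\<^bsub>Q\<^esub> c))"
  have tk: "?t \<in> I \<rightarrow> ker" using term_in_ker[OF s MG[OF gM]] IQ by auto
  have "cocycle s ?g = finprod A (\<lambda>c. ?t (?k c)) I"
    unfolding cocycle_def using A.finprod_reindex[of ?t ?k I] inj im tk by simp
  also have "\<dots> = finprod A (\<lambda>c. t \<otimes> (g \<otimes> r c \<otimes> inv (r (\<phi> g \<otimes>\<^bsub>Q\<^esub> c))) \<otimes> inv t) I"
  proof (rule finprod_eq)
    show "(\<lambda>c. t \<otimes> (g \<otimes> r c \<otimes> inv (r (\<phi> g \<otimes>\<^bsub>Q\<^esub> c))) \<otimes> inv t) \<in> I \<rightarrow> ker"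
      using conj_ker[OF t] term_in_ker[OF r gG] IQ by blast
    fix c assume "c \<in> I"
    then have c: "c \<in> carrier Q" by (rule IQ)
    have gc: "\<phi> g \<otimes>\<^bsub>Q\<^esub> c \<in> carrier Q" using gG c by simp
    have s1: "s (?k c) = t \<otimes> r c \<otimes> inv t" unfolding s_def conj1[OF c] ..
    have "\<phi> ?g \<otimes>\<^bsub>Q\<^esub> ?k c = ?T \<otimes>\<^bsub>Q\<^esub> \<phi> g \<otimes>\<^bsub>Q\<^esub> (inv\<^bsub>Q\<^esub> ?T \<otimes>\<^bsub>Q\<^esub> (?T \<otimes>\<^bsub>Q\<^esub> (c \<otimes>\<^bsub>Q\<^esub> inv\<^bsub>Q\<^esub> ?T)))"
      using t gG c by (simp add: H.m_assoc)
    also have "inv\<^bsub>Q\<^esub> ?T \<otimes>\<^bsub>Q\<^esub> (?T \<otimes>\<^bsub>Q\<^esub> (c \<otimes>\<^bsub>Q\<^esub> inv\<^bsub>Q\<^esub> ?T)) = c \<otimes>\<^bsub>Q\<^esub> inv\<^bsub>Q\<^esub> ?T"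
      using T c by (simp add: H.m_assoc[symmetric])
    finally have "\<phi> ?g \<otimes>\<^bsub>Q\<^esub> ?k c = ?k (\<phi> g \<otimes>\<^bsub>Q\<^esub> c)" using T gG c by (simp add: H.m_assoc)
    then have s2: "s (\<phi> ?g \<otimes>\<^bsub>Q\<^esub> ?k c) = t \<otimes> r (\<phi> g \<otimes>\<^bsub>Q\<^esub> c) \<otimes> inv t"
      using conj1[OF gc] by (simp add: s_def)
    define u v where "u = r c" and "v = r (\<phi> g \<otimes>\<^bsub>Q\<^esub> c)"
    have uv: "u \<in> carrier G" "v \<in> carrier G" using rc(1)[OF c] rc(1)[OF gc] by (simp_all add: u_def v_def)
    have i: "inv t \<otimes> (t \<otimes> w) = w" if "w \<in> carrier G" for w
      using t that by (simp add: G.m_assoc[symmetric])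
    show "?t (?k c) = t \<otimes> (g \<otimes> r c \<otimes> inv (r (\<phi> g \<otimes>\<^bsub>Q\<^esub> c))) \<otimes> inv t"
      unfolding s1 s2 u_def[symmetric] v_def[symmetric]
      using t gG uv by (simp add: G.m_assoc G.inv_mult_group i)
  qed
  also have "\<dots> = t \<otimes> cocycle r g \<otimes> inv t"
    unfolding cocycle_def using conj_finprod[OF t, of "\<lambda>c. g \<otimes> r c \<otimes> inv (r (\<phi> g \<otimes>\<^bsub>Q\<^esub> c))" I]
      term_in_ker[OF r gG] IQ by auto
  finally show "cocycle s ?g = t \<otimes> cocycle r g \<otimes> inv t" .
qed

text \<open>
  Two transversals give crossed homomorphisms that differ by the coboundary of the product \<open>e\<close> of the
  quotients \<open>s c \<otimes> inv (r c)\<close>.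
\<close>

lemma cocycle_change:
  assumes r: "transversal r" and s: "transversal s"
  obtains e where "e \<in> ker" "\<And>g. g \<in> M \<Longrightarrow> cocycle s g = g \<otimes> e \<otimes> inv g \<otimes> cocycle r g \<otimes> inv e"
proof -
  let ?d = "\<lambda>c. s c \<otimes> inv (r c)"
  have d: "?d \<in> I \<rightarrow> ker" using quot_in_ker[OF s r] IQ by blast
  define e where "e = finprod A ?d I"
  have e: "e \<in> ker" unfolding e_def by (rule finprod_ker[OF d])
  have "cocycle s g = g \<otimes> e \<otimes> inv g \<otimes> cocycle r g \<otimes> inv e" if g: "g \<in> M" for g
  proof -
    note gG = MG[OF g]
    let ?t = "\<lambda>c. g \<otimes> r c \<otimes> inv (r (\<phi> g \<otimes>\<^bsub>Q\<^esub> c))"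
    let ?u = "\<lambda>c. g \<otimes> s c \<otimes> inv (s (\<phi> g \<otimes>\<^bsub>Q\<^esub> c))"
    have t: "?t \<in> I \<rightarrow> ker" using term_in_ker[OF r gG] IQ by blast
    have u: "?u \<in> I \<rightarrow> ker" using term_in_ker[OF s gG] IQ by blast
    have cd: "(\<lambda>c. g \<otimes> ?d c \<otimes> inv g) \<in> I \<rightarrow> ker" using conj_ker[OF gG] d by blast
    have sd: "(\<lambda>c. ?d (\<phi> g \<otimes>\<^bsub>Q\<^esub> c)) \<in> I \<rightarrow> ker" using d I_mult[OF g] by blast
    have "cocycle s g \<otimes> e = finprod A ?u I \<otimes> finprod A (\<lambda>c. ?d (\<phi> g \<otimes>\<^bsub>Q\<^esub> c)) I"
      using finprod_shift[OF g d] by (simp add: cocycle_def e_def)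
    also have "\<dots> = finprod A (\<lambda>c. ?u c \<otimes> ?d (\<phi> g \<otimes>\<^bsub>Q\<^esub> c)) I"
      by (rule finprod_mult[OF u sd, symmetric])
    also have "\<dots> = finprod A (\<lambda>c. (g \<otimes> ?d c \<otimes> inv g) \<otimes> ?t c) I"
    proof (rule finprod_eq)
      show "(\<lambda>c. (g \<otimes> ?d c \<otimes> inv g) \<otimes> ?t c) \<in> I \<rightarrow> ker"
        using cd t subgroup.m_closed[OF subgroup_kernel] by blast
      fix c assume "c \<in> I"
      then have c: "c \<in> carrier Q" "\<phi> g \<otimes>\<^bsub>Q\<^esub> c \<in> carrier Q" using IQ gG by auto
      define a b a' b' where ab: "a = r c" "b = s c" "a' = r (\<phi> g \<otimes>\<^bsub>Q\<^esub> c)" "b' = s (\<phi> g \<otimes>\<^bsub>Q\<^esub> c)"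
      have abG: "a \<in> carrier G" "b \<in> carrier G" "a' \<in> carrier G" "b' \<in> carrier G"
        using r s c by (simp_all add: transversal_def ab)
      have i: "inv x \<otimes> (x \<otimes> w) = w" if "w \<in> carrier G" "x \<in> carrier G" for w x
        using that by (simp add: G.m_assoc[symmetric])
      show "?u c \<otimes> ?d (\<phi> g \<otimes>\<^bsub>Q\<^esub> c) = (g \<otimes> ?d c \<otimes> inv g) \<otimes> ?t c"
        unfolding ab[symmetric] using gG abG by (simp add: G.m_assoc i)
    qed
    also have "\<dots> = (g \<otimes> e \<otimes> inv g) \<otimes> cocycle r g"
      using finprod_mult[OF cd t] conj_finprod[OF gG d] by (simp add: cocycle_def e_def)
    finally have "cocycle s g \<otimes> e = (g \<otimes> e \<otimes> inv g) \<otimes> cocycle r g" .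
    moreover have "cocycle s g \<in> carrier G" "cocycle r g \<in> carrier G" "e \<in> carrier G"
      using cocycle_in_ker r s gG e kG by blast+
    ultimately show ?thesis using gG by (metis G.inv_solve_right G.m_closed G.inv_closed)
  qed
  then show ?thesis using that e by blast
qed

text \<open>
  The complement is the zero set of the crossed homomorphism of \<open>r\<close>. Conjugation by \<open>t\<close> turns it into
  the zero set for another transversal, and by \<open>cocycle_change\<close> conjugation by a suitable \<open>h\<close> of the kernel
  turns it back.
\<close>

theorem complement_frattini:
  "\<exists>C. subgroup C G \<and> C \<subseteq> M \<and> C <#> ker = M \<and> C \<inter> ker = {\<one>} \<and>
     (\<forall>t\<in>carrier G. \<exists>h\<in>ker. \<forall>q\<in>C. (h \<otimes> t) \<otimes> q \<otimes> inv (h \<otimes> t) \<in> C)"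
proof -
  have "\<forall>c\<in>carrier Q. \<exists>x. x \<in> carrier G \<and> \<phi> x = c" using surj by (metis image_iff)
  then obtain r where r: "transversal r" unfolding transversal_def by metis
  define C where "C = {g \<in> M. cocycle r g = \<one>}"
  have fG: "cocycle r g \<in> carrier G" "cocycle r g \<in> ker" if "g \<in> M" for g
    using cocycle_in_ker[OF r MG[OF that]] kG by auto
  have oneM: "\<one> \<in> M" by (rule subgroup.one_closed[OF M_sub])
  have one: "cocycle r \<one> = \<one>" using cocycle_ker[OF r subgroup.one_closed[OF subgroup_kernel]] by simp
  have C: "subgroup C G"
  proof (rule G.subgroupI)
    show "C \<subseteq> carrier G" using MG by (auto simp: C_def)
    show "C \<noteq> {}" using one oneM by (auto simp: C_def)
    fix a assume a: "a \<in> C"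
    then have aM: "a \<in> M" "cocycle r a = \<one>" by (auto simp: C_def)
    have iM: "inv a \<in> M" by (rule subgroup.m_inv_closed[OF M_sub aM(1)])
    have "cocycle r (inv a \<otimes> a) = inv a \<otimes> cocycle r a \<otimes> inv (inv a) \<otimes> cocycle r (inv a)"
      by (rule cocycle_mult[OF r iM aM(1)])
    then have "cocycle r (inv a) = \<one>" using one aM(2) MG[OF aM(1)] fG(1)[OF iM] by simp
    then show "inv a \<in> C" using iM by (simp add: C_def)
    fix b assume "b \<in> C"
    then have bM: "b \<in> M" "cocycle r b = \<one>" by (auto simp: C_def)
    have "cocycle r (a \<otimes> b) = \<one>" using cocycle_mult[OF r aM(1) bM(1)] aM bM(2) MG[OF aM(1)] by simp
    then show "a \<otimes> b \<in> C" using subgroup.m_closed[OF M_sub aM(1) bM(1)] by (simp add: C_def)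
  qed
  have CM: "C \<subseteq> M" by (auto simp: C_def)
  have Ck: "C \<inter> ker = {\<one>}"
  proof
    show "C \<inter> ker \<subseteq> {\<one>}"
    proof
      fix x assume x: "x \<in> C \<inter> ker"
      then have "x [^] n = \<one>" using cocycle_ker[OF r, of x] by (simp add: C_def)
      then show "x \<in> {\<one>}" using ker_power_eq_one x by simp
    qed
    show "{\<one>} \<subseteq> C \<inter> ker" using subgroup.one_closed[OF C] subgroup.one_closed[OF subgroup_kernel] by simp
  qed
  have kk: "x \<otimes> y \<otimes> inv x = y" if "x \<in> ker" "y \<in> ker" for x y
    using comm[OF that] kG[OF that(1)] kG[OF that(2)] by (simp add: G.m_assoc)
  have CkM: "C <#> ker = M"
  proof
    show "C <#> ker \<subseteq> M" using G.product_subgroup(4)[OF normal_kernel C M_sub CM kerM] .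
    show "M \<subseteq> C <#> ker"
    proof
      fix g assume g: "g \<in> M"
      obtain x where x: "x \<in> ker" "x [^] n = inv (cocycle r g)"
        using ker_nth_root[of "inv (cocycle r g)"] fG(2)[OF g] subgroup.m_inv_closed[OF subgroup_kernel] by blast
      have xM: "x \<in> M" using x kerM by blast
      have "cocycle r (x \<otimes> g) = x \<otimes> cocycle r g \<otimes> inv x \<otimes> cocycle r x" by (rule cocycle_mult[OF r xM g])
      also have "\<dots> = \<one>" using kk[OF x(1) fG(2)[OF g]] cocycle_ker[OF r x(1)] x(2) fG(1)[OF g] by simp
      finally have xg: "x \<otimes> g \<in> C" using subgroup.m_closed[OF M_sub xM g] by (simp add: C_def)
      have "inv x \<otimes> (x \<otimes> g) = g" using MG[OF g] kG[OF x(1)] by (simp add: G.m_assoc[symmetric])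
      then have "g \<in> ker <#> C" using G.set_multI[OF subgroup.m_inv_closed[OF subgroup_kernel x(1)] xg] by simp
      then show "g \<in> C <#> ker" using G.product_subgroup(6)[OF normal_kernel C] by simp
    qed
  qed
  have "\<exists>h\<in>ker. \<forall>q\<in>C. (h \<otimes> t) \<otimes> q \<otimes> inv (h \<otimes> t) \<in> C" if t: "t \<in> carrier G" for t
  proof -
    define s where "s = (\<lambda>c. t \<otimes> r (inv\<^bsub>Q\<^esub> (\<phi> t) \<otimes>\<^bsub>Q\<^esub> c \<otimes>\<^bsub>Q\<^esub> \<phi> t) \<otimes> inv t)"
    note sp = cocycle_conj[OF r t, folded s_def]
    have s: "transversal s" by (rule sp(1)[OF oneM])
    obtain e where e: "e \<in> ker" "\<And>g. g \<in> M \<Longrightarrow> cocycle s g = g \<otimes> e \<otimes> inv g \<otimes> cocycle r g \<otimes> inv e"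
      using cocycle_change[OF r s] by blast
    \<comment> \<open>With this \<open>h\<close> the coboundary of \<open>h\<close> cancels that of \<open>e\<close>.\<close>
    obtain h where h: "h \<in> ker" "h [^] n = inv e"
      using ker_nth_root[of "inv e"] subgroup.m_inv_closed[OF subgroup_kernel e(1)] by blast
    have hM: "h \<in> M" using h(1) kerM by blast
    note ihk = subgroup.m_inv_closed[OF subgroup_kernel h(1)]
    have ihM: "inv h \<in> M" using ihk kerM by blast
    have fh: "cocycle r h = inv e" using cocycle_ker[OF r h(1)] h(2) by simp
    have fih: "cocycle r (inv h) = e"
    proof -
      have "cocycle r (h \<otimes> inv h) = h \<otimes> cocycle r (inv h) \<otimes> inv h \<otimes> cocycle r h"
        by (rule cocycle_mult[OF r hM ihM])
      then have "cocycle r (inv h) \<otimes> inv e = \<one>" using kk[OF h(1) fG(2)[OF ihM]] fh one kG[OF h(1)] by simp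
      then show ?thesis using kG[OF e(1)] fG(1)[OF ihM]
        by (metis G.inv_equality G.inv_closed G.inv_inv)
    qed
    have key: "cocycle r (h \<otimes> g \<otimes> inv h) = cocycle s g" if g: "g \<in> M" for g
    proof -
      have gi: "g \<otimes> inv h \<in> M" by (rule subgroup.m_closed[OF M_sub g ihM])
      have "cocycle r (h \<otimes> (g \<otimes> inv h)) = h \<otimes> cocycle r (g \<otimes> inv h) \<otimes> inv h \<otimes> cocycle r h"
        by (rule cocycle_mult[OF r hM gi])
      also have "\<dots> = cocycle r (g \<otimes> inv h) \<otimes> inv e" using kk[OF h(1) fG(2)[OF gi]] fh by simp
      also have "cocycle r (g \<otimes> inv h) = g \<otimes> e \<otimes> inv g \<otimes> cocycle r g"
        using cocycle_mult[OF r g ihM] fih by simp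
      finally show ?thesis using e(2)[OF g] MG[OF g] kG[OF h(1)] by (simp add: G.m_assoc)
    qed
    have "(h \<otimes> t) \<otimes> q \<otimes> inv (h \<otimes> t) \<in> C" if q: "q \<in> C" for q
    proof -
      have qM: "q \<in> M" "cocycle r q = \<one>" using q by (auto simp: C_def)
      let ?q = "t \<otimes> q \<otimes> inv t"
      have tq: "?q \<in> M" by (rule G.normal_conj[OF M t qM(1)])
      have "cocycle s ?q = \<one>" using sp(2)[OF qM(1)] qM(2) t by simp
      then have "cocycle r (h \<otimes> ?q \<otimes> inv h) = \<one>" using key[OF tq] by simp
      moreover have "h \<otimes> ?q \<otimes> inv h \<in> M" by (rule G.normal_conj[OF M kG[OF h(1)] tq])
      moreover have "h \<otimes> ?q \<otimes> inv h = (h \<otimes> t) \<otimes> q \<otimes> inv (h \<otimes> t)"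
        using t kG[OF h(1)] MG[OF qM(1)] by (simp add: G.m_assoc G.inv_mult_group)
      ultimately show ?thesis by (simp add: C_def)
    qed
    then show ?thesis using h(1) by blast
  qed
  then show ?thesis using C CM CkM Ck by blast
qed

end

context finite_group
begin

text \<open>
  The form in which complements are used: \<open>C\<close> complements \<open>H/L\<close> in \<open>M/L\<close>, and \<open>G\<close> is the product of
  \<open>H\<close> and the normalizer of \<open>C\<close>. When \<open>H\<close> normalizes \<open>C\<close>, or lies in something Frattini-like, \<open>C\<close> is
  therefore normal.
\<close>

lemma schur_zassenhaus_frattini:
  assumes p: "Factorial_Ring.prime p" and L: "L \<lhd> G" and H: "H \<lhd> G" and M: "M \<lhd> G"
    and LH: "L \<subseteq> H" and HM: "H \<subseteq> M" and pi: "p_index p L H" and p'i: "p'_index p H M"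
    and ab: "\<And>x y. x \<in> H \<Longrightarrow> y \<in> H \<Longrightarrow> commute_mod G L x y"
  obtains C where "subgroup C G" "L \<subseteq> C" "C \<subseteq> M" "C <#> H = M" "C \<inter> H = L"
    "\<And>t. t \<in> carrier G \<Longrightarrow> \<exists>h\<in>H. \<forall>q\<in>C. (h \<otimes> t) \<otimes> q \<otimes> inv (h \<otimes> t) \<in> C"
proof -
  interpret f: finite_group_hom G "G Mod L" "(#>) L" by (rule Mod_hom[OF L])
  note kL = Mod_hom(2)[OF L] and sL = Mod_hom(3)[OF L]
  interpret B: finite_group "G Mod L" by (rule finite_group_Mod[OF L])
  let ?H = "(#>) L ` H" and ?M = "(#>) L ` M"
  have nH: "?H \<lhd> G Mod L" and nM: "?M \<lhd> G Mod L" using f.image_normal[OF _ sL] H M by auto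
  interpret g: finite_group_hom "G Mod L" "(G Mod L) Mod ?H" "(#>\<^bsub>G Mod L\<^esub>) ?H" by (rule B.Mod_hom[OF nH])
  note kg = B.Mod_hom(2)[OF nH] and sg = B.Mod_hom(3)[OF nH]
  note sub = normal_imp_subgroup
  have LM: "L \<subseteq> M" using LH HM by blast
  have Hc: "x \<in> carrier G" if "x \<in> H" for x using that normal_subset[OF H] by blast
  have K: "coprime_abelian_kernel (G Mod L) (G Mod L Mod ?H) ((#>\<^bsub>G Mod L\<^esub>) ?H) ?M"
  proof (rule coprime_abelian_kernel.intro[OF g.finite_group_hom_axioms], rule coprime_abelian_kernel_axioms.intro)
    show "(#>\<^bsub>G Mod L\<^esub>) ?H ` carrier (G Mod L) = carrier (G Mod L Mod ?H)" by (rule sg)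
    show "?M \<lhd> G Mod L" by (rule nM)
    show "g.ker \<subseteq> ?M" unfolding kg using HM by blast
    fix x y assume "x \<in> g.ker" "y \<in> g.ker"
    then obtain u v where uv: "u \<in> H" "v \<in> H" "x = L #> u" "y = L #> v" unfolding kg by blast
    then show "x \<otimes>\<^bsub>G Mod L\<^esub> y = y \<otimes>\<^bsub>G Mod L\<^esub> x" using ab[OF uv(1,2)] commute_mod_Mod[OF L Hc[OF uv(1)] Hc[OF uv(2)]] uv(3,4) by simp
  next
    obtain j where j: "card ?H = p ^ j" using p_index_Mod[OF L sub[OF H] LH pi] by blast
    have "p'_index p ?H ?M"
      using f.index_above_ker(3)[OF sub[OF H] _ sub[OF M]] p'i LH LM unfolding kL by blast
    then obtain k where k: "\<not> p dvd k" "card ?M = k * card ?H" by (auto simp: p'_index_def)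
    have "card ?M = card ((#>\<^bsub>G Mod L\<^esub>) ?H ` ?M) * card ?H"
      using g.card_image_above_ker[OF sub[OF nM]] HM unfolding kg by blast
    then have "card ((#>\<^bsub>G Mod L\<^esub>) ?H ` ?M) = k" using k(2) B.card_normal_pos[OF nH] by auto
    then show "coprime (card g.ker) (card ((#>\<^bsub>G Mod L\<^esub>) ?H ` ?M))"
      unfolding kg j using k(1) p by (simp add: prime_imp_coprime)
  qed
  obtain C where C: "subgroup C (G Mod L)" "C \<subseteq> ?M" "C <#>\<^bsub>G Mod L\<^esub> ?H = ?M" "C \<inter> ?H = {\<one>\<^bsub>G Mod L\<^esub>}"
    "\<forall>t\<in>carrier (G Mod L). \<exists>h\<in>?H. \<forall>q\<in>C. (h \<otimes>\<^bsub>G Mod L\<^esub> t) \<otimes>\<^bsub>G Mod L\<^esub> q \<otimes>\<^bsub>G Mod L\<^esub> inv\<^bsub>G Mod L\<^esub> (h \<otimes>\<^bsub>G Mod L\<^esub> t) \<in> C"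
    using coprime_abelian_kernel.complement_frattini[OF K, unfolded kg] by (elim exE conjE) (rule that)
  let ?C = "f.preimg C"
  have pM: "f.preimg ?M = M" by (rule f.preimg_image[OF sub[OF M]]) (use kL LM in simp)
  have pH: "f.preimg ?H = H" by (rule f.preimg_image[OF sub[OF H]]) (use kL LH in simp)
  have 1: "subgroup ?C G" by (rule f.preimg_subgroup[OF C(1)])
  have 2: "L \<subseteq> ?C" using f.ker_subset_preimg[OF C(1)] kL by simp
  have 3: "?C \<subseteq> M" using C(2) pM by (auto simp: f.preimg_def)
  have 5: "?C \<inter> H = L"
  proof -
    have "?C \<inter> H = {x \<in> carrier G. L #> x \<in> C \<inter> ?H}" using pH by (auto simp: f.preimg_def)
    also have "\<dots> = f.ker" unfolding C(4) by (auto simp: kernel_def)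
    finally show ?thesis using kL by simp
  qed
  have 4: "?C <#> H = M"
  proof
    show "?C <#> H \<subseteq> M" by (rule product_subgroup(4)[OF H 1 sub[OF M] 3 HM])
    show "M \<subseteq> ?C <#> H"
    proof
      fix m assume m: "m \<in> M"
      then have mG: "m \<in> carrier G" using normal_subset[OF M] by blast
      have "L #> m \<in> C <#>\<^bsub>G Mod L\<^esub> ?H" using m C(3) by blast
      then obtain c h where ch: "c \<in> C" "h \<in> H" "L #> m = c \<otimes>\<^bsub>G Mod L\<^esub> (L #> h)"
        by (auto simp: set_mult_def[of "G Mod L"] simp del: mult_FactGroup)
      have hG: "h \<in> carrier G" by (rule Hc[OF ch(2)])
      have cc: "c \<in> carrier (G Mod L)" using subgroup.mem_carrier[OF C(1) ch(1)] .
      have "L #> (m \<otimes> inv h) = (L #> m) \<otimes>\<^bsub>G Mod L\<^esub> inv\<^bsub>G Mod L\<^esub> (L #> h)"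
        using mG hG f.hom_mult f.hom_inv inv_closed by metis
      also have "\<dots> = c" unfolding ch(3) using cc f.hom_closed[OF hG]
        by (simp add: f.H.m_assoc del: mult_FactGroup one_FactGroup)
      finally have "m \<otimes> inv h \<in> ?C" using ch(1) mG hG by (simp add: f.preimg_def)
      then have "m \<otimes> inv h \<otimes> h \<in> ?C <#> H" using ch(2) by (rule set_multI)
      then show "m \<in> ?C <#> H" using mG hG by (simp add: m_assoc)
    qed
  qed
  have 6: "\<exists>h\<in>H. \<forall>q\<in>?C. (h \<otimes> t) \<otimes> q \<otimes> inv (h \<otimes> t) \<in> ?C" if t: "t \<in> carrier G" for t
  proof -
    obtain h where h: "h \<in> H" "\<forall>q\<in>C. ((L #> h) \<otimes>\<^bsub>G Mod L\<^esub> (L #> t)) \<otimes>\<^bsub>G Mod L\<^esub> q \<otimes>\<^bsub>G Mod L\<^esub>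
        inv\<^bsub>G Mod L\<^esub> ((L #> h) \<otimes>\<^bsub>G Mod L\<^esub> (L #> t)) \<in> C"
      using C(5) f.hom_closed[OF t] by blast
    have "(h \<otimes> t) \<otimes> q \<otimes> inv (h \<otimes> t) \<in> ?C" if q: "q \<in> ?C" for q
    proof -
      have qC: "L #> q \<in> C" "q \<in> carrier G" using q by (auto simp: f.preimg_def)
      have "L #> ((h \<otimes> t) \<otimes> q \<otimes> inv (h \<otimes> t)) = ((L #> h) \<otimes>\<^bsub>G Mod L\<^esub> (L #> t)) \<otimes>\<^bsub>G Mod L\<^esub> (L #> q) \<otimes>\<^bsub>G Mod L\<^esub>
        inv\<^bsub>G Mod L\<^esub> ((L #> h) \<otimes>\<^bsub>G Mod L\<^esub> (L #> t))"
        using t qC(2) Hc[OF h(1)] by (simp add: f.hom_mult f.hom_inv del: mult_FactGroup)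
      then show ?thesis using h(2) qC t Hc[OF h(1)] by (simp add: f.preimg_def del: mult_FactGroup)
    qed
    then show ?thesis using h(1) by blast
  qed
  show ?thesis by (rule that[OF 1 2 3 4 5 6])
qed

end

section \<open>Automorphisms of p-groups of order prime to p\<close>

context finite_group
begin

lemma power_past:
  assumes x: "x \<in> carrier G" and y: "y \<in> carrier G" and z: "z \<in> carrier G"
    and zx: "z \<otimes> x = x \<otimes> z" and xy: "x \<otimes> y = z \<otimes> (y \<otimes> x)"
  shows "x [^] (j::nat) \<otimes> y = z [^] j \<otimes> (y \<otimes> x [^] j)"
proof (induction j)
  case 0
  then show ?case using y by simp
next
  case (Suc j)
  have xjz: "x [^] j \<otimes> z = z \<otimes> x [^] j" by (rule group_commutes_pow[OF zx[symmetric] x z])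
  have "x [^] Suc j \<otimes> y = x [^] j \<otimes> (x \<otimes> y)" using x y by (simp add: m_assoc)
  also have "\<dots> = (x [^] j \<otimes> z) \<otimes> y \<otimes> x" unfolding xy using x y z by (simp add: m_assoc)
  also have "\<dots> = z \<otimes> (x [^] j \<otimes> y) \<otimes> x" unfolding xjz using x y z by (simp add: m_assoc)
  also have "\<dots> = (z \<otimes> z [^] j) \<otimes> (y \<otimes> (x [^] j \<otimes> x))" unfolding Suc using x y z by (simp add: m_assoc)
  also have "z \<otimes> z [^] j = z [^] Suc j" using nat_pow_Suc2[OF z] by simp
  finally show ?case by simp
qed

text \<open>
  Sorting the factors of the power takes \<open>j(j - 1)/2\<close> transpositions, each at the cost of one \<open>z\<close>.
\<close>

lemma power_commutator:
  assumes x: "x \<in> carrier G" and y: "y \<in> carrier G" and z: "z \<in> carrier G"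
    and zx: "z \<otimes> x = x \<otimes> z" and zy: "z \<otimes> y = y \<otimes> z" and xy: "x \<otimes> y = z \<otimes> (y \<otimes> x)"
  shows "(y \<otimes> x) [^] (j::nat) = z [^] (j * (j - 1) div 2) \<otimes> (y [^] j \<otimes> x [^] j)"
proof -
  have zpy: "y [^] (i::nat) \<otimes> z [^] (j::nat) = z [^] j \<otimes> y [^] i" for i j
    by (rule group_commutes_pow[OF group_commutes_pow[OF zy z y, symmetric] y nat_pow_closed[OF z]])
  show "(y \<otimes> x) [^] j = z [^] (j * (j - 1) div 2) \<otimes> (y [^] j \<otimes> x [^] j)"
  proof (induction j)
    case 0 then show ?case by simp
  next
    case (Suc j)
    let ?T = "j * (j - 1) div 2"
    have T: "Suc j * (Suc j - 1) div 2 = ?T + j"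
    proof -
      have "Suc j * (Suc j - 1) = j * (j - 1) + j * 2" by (cases j) (simp_all add: algebra_simps)
      then show ?thesis by simp
    qed
    have zyj: "y [^] j \<otimes> z [^] j = z [^] j \<otimes> y [^] j" by (rule zpy)
    have "(y \<otimes> x) [^] Suc j = z [^] ?T \<otimes> (y [^] j \<otimes> (x [^] j \<otimes> y) \<otimes> x)"
      using Suc x y z by (simp add: m_assoc)
    also have "x [^] j \<otimes> y = z [^] j \<otimes> (y \<otimes> x [^] j)" by (rule power_past[OF x y z zx xy])
    also have "y [^] j \<otimes> (z [^] j \<otimes> (y \<otimes> x [^] j)) \<otimes> x = (y [^] j \<otimes> z [^] j) \<otimes> (y \<otimes> (x [^] j \<otimes> x))"
      using x y z by (simp add: m_assoc)
    also have "\<dots> = z [^] j \<otimes> (y [^] Suc j \<otimes> x [^] Suc j)" using zyj x y z by (simp add: m_assoc)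
    also have "z [^] ?T \<otimes> \<dots> = z [^] (?T + j) \<otimes> (y [^] Suc j \<otimes> x [^] Suc j)"
      using x y z nat_pow_mult[OF z, of ?T j] by (simp add: m_assoc[symmetric])
    finally show ?case unfolding T .
  qed
qed

lemma coprime_exponents_one:
  assumes "c \<in> carrier G" "c [^] (m::nat) = \<one>" "c [^] (k::nat) = \<one>" "coprime m k"
  shows "c = \<one>"
proof -
  have "ord c dvd m" "ord c dvd k" using assms pow_eq_id by auto
  then have "ord c = 1" using assms(4) coprime_common_divisor_nat by blast
  then show ?thesis using ord_eq_1 assms(1) by blast
qed

text \<open>
  A minimal counterexample: \<open>\<alpha>\<close> is trivial on all proper \<open>\<alpha>\<close>-invariant subgroups, so each of them
  lies in the group \<open>C\<close> of fixed points. It follows that \<open>G/C\<close> is elementary abelian, that \<open>G\<close> is generated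
  by the elements \<open>inv g \<otimes> \<alpha> g\<close>, and that \<open>C\<close> is central, so \<open>G\<close> has class two with commutators of order
  \<open>p\<close>. Then \<open>n\<close>-th powers are multiplicative and lie in \<open>C\<close>, whence
  \<open>g\<^sup>n = \<alpha> (g\<^sup>n) = (g \<otimes> s)\<^sup>n = g\<^sup>n \<otimes> s\<^sup>n\<close> for \<open>s = inv g \<otimes> \<alpha> g\<close>. So the generators \<open>s\<close> satisfy
  \<open>s\<^sup>n = 1\<close> and are fixed by assumption.
\<close>

lemma minimal_automorphism_trivial:
  fixes k m :: nat
  assumes p: "Factorial_Ring.prime p" and ordG: "order G = p ^ k" and a: "\<alpha> \<in> hom G G"
    and am: "\<And>x. x \<in> carrier G \<Longrightarrow> (\<alpha> ^^ m) x = x" and cop: "coprime m p"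
    and min: "\<And>S. subgroup S G \<Longrightarrow> \<alpha> ` S \<subseteq> S \<Longrightarrow> S \<noteq> carrier G \<Longrightarrow> \<forall>x\<in>S. \<alpha> x = x"
    and fixp: "\<And>x. x \<in> carrier G \<Longrightarrow> x [^] (if p = 2 then 4 else p) = \<one> \<Longrightarrow> \<alpha> x = x"
  shows "\<forall>x\<in>carrier G. \<alpha> x = x"
proof (rule ccontr)
  assume nontriv: "\<not> ?thesis"
  interpret a: group_hom G G \<alpha> using a by unfold_locales
  have mpos: "m > 0" using cop p by (cases m) (auto simp: prime_nat_iff)
  define C where "C = {x \<in> carrier G. \<alpha> x = x}"
  have C: "subgroup C G" unfolding C_def by (rule subgroupI) auto
  have CG: "C \<noteq> carrier G" using nontriv by (auto simp: C_def)
  have big: "S = carrier G" if "subgroup S G" "\<alpha> ` S \<subseteq> S" "\<not> S \<subseteq> C" for S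
    using min[OF that(1,2)] that(3) subgroup.subset[OF that(1)] by (auto simp: C_def)
  have iter: "(\<alpha> ^^ j) x \<in> carrier G" if "x \<in> carrier G" for j x using that by (induction j) auto
  have surj: "\<exists>y\<in>carrier G. \<alpha> y = x" if "x \<in> carrier G" for x
  proof -
    have "\<alpha> ((\<alpha> ^^ (m - 1)) x) = x" using am[OF that] mpos by (cases m) auto
    then show ?thesis using iter[OF that] by blast
  qed
  have pG: "x [^] (p ^ k) = \<one>" if "x \<in> carrier G" for x using pow_order_eq_1[OF that] ordG by simp
  have one_sub: "subgroup {\<one>} G" using one_is_normal normal_imp_subgroup by blast
  have pi1: "p_index p {\<one>} (carrier G)" using ordG by (auto simp: p_index_def order_def)
  have "\<exists>N. N \<lhd> G \<and> \<alpha> ` N \<subseteq> N \<and> N \<noteq> carrier G \<and>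
     (\<forall>N'. N' \<lhd> G \<and> \<alpha> ` N' \<subseteq> N' \<and> N' \<noteq> carrier G \<longrightarrow> card N' \<le> card N)"
  proof -
    let ?P = "\<lambda>N. N \<lhd> G \<and> \<alpha> ` N \<subseteq> N \<and> N \<noteq> carrier G"
    have "carrier G \<noteq> {\<one>}"
    proof
      assume "carrier G = {\<one>}"
      then show False using nontriv a.hom_one by (metis singletonD)
    qed
    then have "?P {\<one>}" using one_is_normal by auto
    moreover have "\<forall>N. ?P N \<longrightarrow> card N < Suc (card (carrier G))"
      using normal_subset by (auto intro!: le_imp_less_Suc card_mono)
    ultimately show ?thesis using ex_has_greatest_nat[of ?P "{\<one>}" card "Suc (card (carrier G))"] by blast
  qed
  then obtain N where N: "N \<lhd> G" "\<alpha> ` N \<subseteq> N" "N \<noteq> carrier G"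
    and maxN: "\<And>N'. N' \<lhd> G \<Longrightarrow> \<alpha> ` N' \<subseteq> N' \<Longrightarrow> N' \<noteq> carrier G \<Longrightarrow> card N' \<le> card N" by blast
  note sN = normal_imp_subgroup[OF N(1)]
  have NC: "N \<subseteq> C" using big[OF sN N(2)] N(3) by blast
  let ?Z = "section_centralizer G (carrier G) N"
  have Z: "?Z \<lhd> G" by (rule section_centralizer_normal[OF N(1) carrier_normal])
  have one_N: "{\<one>} \<subseteq> N" using subgroup.one_closed[OF sN] by simp
  have NZ: "N \<subseteq> ?Z"
  proof
    fix x assume x: "x \<in> N"
    have "commute_mod G N x y" if "y \<in> carrier G" for y
      using commute_mod_in[OF N(1) that x] commute_mod_sym[of N x y] by blast
    then show "x \<in> ?Z" using x normal_subset[OF N(1)] by (auto simp: section_centralizer_def)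
  qed
  have "\<exists>h\<in>carrier G. h \<notin> N \<and> (\<forall>y\<in>carrier G. commute_mod G N y h)"
  proof (rule section_fixed_point[OF p N(1) carrier_normal _ _ subgroup_self sN])
    show "N \<subset> carrier G" using N(3) normal_subset[OF N(1)] by blast
    show "N \<subseteq> carrier G" by (rule normal_subset[OF N(1)])
    show "p_index p N (carrier G)" "p_index p N (carrier G)"
      by (rule index_between(2)[OF p one_sub sN subgroup_self one_N normal_subset[OF N(1)] pi1])+
    fix d h assume d: "d \<in> N" and h: "h \<in> carrier G"
    show "commute_mod G N d h" using NZ d h by (auto simp: section_centralizer_def)
  qed
  then obtain h where h: "h \<in> carrier G" "h \<notin> N" "\<forall>y\<in>carrier G. commute_mod G N y h" by blast
  have "h \<in> ?Z" using h commute_mod_sym[of N h] by (auto simp: section_centralizer_def)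
  have aZ: "\<alpha> ` ?Z \<subseteq> ?Z"
  proof (rule image_subsetI)
    fix z assume z: "z \<in> ?Z"
    then have zG: "z \<in> carrier G" by (simp add: section_centralizer_def)
    have "commute_mod G N (\<alpha> z) y" if y: "y \<in> carrier G" for y
    proof -
      obtain y' where y': "y' \<in> carrier G" "\<alpha> y' = y" using surj[OF y] by blast
      have "z \<otimes> y' \<otimes> inv z \<otimes> inv y' \<in> N"
        using z y' commute_mod_iff[OF N(1) zG y'(1)] by (simp add: section_centralizer_def)
      then have "\<alpha> (z \<otimes> y' \<otimes> inv z \<otimes> inv y') \<in> N" using N(2) by blast
      then show ?thesis using commute_mod_iff[OF N(1) _ y, of "\<alpha> z"] y' zG by simp
    qed
    then show "\<alpha> z \<in> ?Z" using zG by (simp add: section_centralizer_def)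
  qed
  \<comment> \<open>The centre of \<open>G/N\<close> is nontrivial and invariant, so by the choice of \<open>N\<close> it is everything.\<close>
  have ZG: "?Z = carrier G"
  proof (rule ccontr)
    assume "?Z \<noteq> carrier G"
    then have "card ?Z \<le> card N" by (rule maxN[OF Z aZ])
    moreover have "card N < card ?Z"
      using NZ \<open>h \<in> ?Z\<close> h(2) finite_subset_carrier[OF normal_subset[OF Z]] by (intro psubset_card_mono) auto
    ultimately show False by simp
  qed
  have comm: "x \<otimes> y \<otimes> inv x \<otimes> inv y \<in> C" if "x \<in> carrier G" "y \<in> carrier G" for x y
  proof -
    have "x \<in> ?Z" using ZG that by simp
    then have "x \<otimes> y \<otimes> inv x \<otimes> inv y \<in> N"
      using that commute_mod_iff[OF N(1) that] by (simp add: section_centralizer_def)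
    then show ?thesis using NC by blast
  qed
  have Cc: "x \<in> carrier G" if "x \<in> C" for x using that by (simp add: C_def)
  have nC: "C \<lhd> G"
    unfolding normal_inv_iff
  proof (intro conjI ballI)
    fix x c assume x: "x \<in> carrier G" and c: "c \<in> C"
    have "(x \<otimes> c \<otimes> inv x \<otimes> inv c) \<otimes> c \<in> C" by (rule subgroup.m_closed[OF C comm[OF x Cc[OF c]] c])
    then show "x \<otimes> c \<otimes> inv x \<in> C" using x Cc[OF c] by (simp add: m_assoc)
  qed (rule C)
  interpret f: finite_group_hom G "G Mod C" "(#>) C" by (rule Mod_hom[OF nC])
  note kC = Mod_eq_one_iff[OF nC]
  have "comm_group (G Mod C)"
  proof (rule f.H.group_comm_groupI)
    fix u v assume "u \<in> carrier (G Mod C)" "v \<in> carrier (G Mod C)"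
    then obtain x y where xy: "x \<in> carrier G" "y \<in> carrier G" "u = C #> x" "v = C #> y"
      unfolding carrier_FactGroup by blast
    have "commute_mod G C x y" using comm[OF xy(1,2)] commute_mod_iff[OF nC xy(1,2)] by simp
    then show "u \<otimes>\<^bsub>G Mod C\<^esub> v = v \<otimes>\<^bsub>G Mod C\<^esub> u" using commute_mod_Mod[OF nC xy(1,2)] xy by simp
  qed
  then interpret Q: comm_group "G Mod C" .
  have pw: "C #> (x [^] j) = (C #> x) [^]\<^bsub>G Mod C\<^esub> (j::nat)" if "x \<in> carrier G" for x j
    using f.hom_nat_pow[OF that] .
  define W where "W = {x \<in> carrier G. x [^] p \<in> C}"
  have W_iff: "x \<in> W \<longleftrightarrow> (C #> x) [^]\<^bsub>G Mod C\<^esub> p = \<one>\<^bsub>G Mod C\<^esub>" if "x \<in> carrier G" for x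
    using that kC[of "x [^] p"] pw[OF that] by (simp add: W_def del: one_FactGroup)
  have W: "subgroup W G"
  proof (rule subgroupI)
    show "W \<subseteq> carrier G" by (auto simp: W_def)
    show "W \<noteq> {}" using subgroup.one_closed[OF C] by (auto simp: W_def intro!: exI[of _ \<one>])
    fix x assume "x \<in> W"
    then have x: "x \<in> carrier G" "x [^] p \<in> C" by (auto simp: W_def)
    then show "inv x \<in> W" using subgroup.m_inv_closed[OF C x(2)] by (simp add: W_def nat_pow_inv)
    fix y assume y: "y \<in> W"
    then have yG: "y \<in> carrier G" by (simp add: W_def)
    have "(C #> (x \<otimes> y)) [^]\<^bsub>G Mod C\<^esub> p = \<one>\<^bsub>G Mod C\<^esub>"
      using W_iff[OF x(1)] W_iff[OF yG] y \<open>x \<in> W\<close> x(1) yG Q.nat_pow_distrib[of "C #> x" "C #> y" p]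
        f.hom_closed
      by (simp add: f.hom_mult del: one_FactGroup mult_FactGroup)
    then show "x \<otimes> y \<in> W" using W_iff[of "x \<otimes> y"] x(1) yG by simp
  qed
  have aW: "\<alpha> ` W \<subseteq> W"
  proof (rule image_subsetI)
    fix x assume "x \<in> W"
    then have x: "x \<in> carrier G" "x [^] p \<in> C" by (auto simp: W_def)
    have "\<alpha> x [^] p = \<alpha> (x [^] p)" using a.hom_nat_pow[OF x(1)] by simp
    also have "\<dots> = x [^] p" using x(2) by (simp add: C_def)
    finally show "\<alpha> x \<in> W" using x by (simp add: W_def)
  qed
  \<comment> \<open>Among the iterated \<open>p\<close>-th powers of some \<open>g\<close> outside \<open>C\<close>, take the last one outside \<open>C\<close>.\<close>
  have "\<not> W \<subseteq> C"
  proof -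
    obtain g where g: "g \<in> carrier G" "g \<notin> C" using CG subgroup.subset[OF C] by blast
    define j where "j = (LEAST j. g [^] (p ^ j) \<in> C)"
    have "g [^] (p ^ k) \<in> C" using pG[OF g(1)] subgroup.one_closed[OF C] by simp
    then have j: "g [^] (p ^ j) \<in> C" unfolding j_def by (rule LeastI)
    have "j \<noteq> 0" using j g by (cases j) auto
    then obtain i where i: "j = Suc i" by (cases j) auto
    have "g [^] (p ^ i) \<notin> C" using not_less_Least[of i "\<lambda>j. g [^] (p ^ j) \<in> C"] i unfolding j_def by simp
    moreover have "g [^] (p ^ i) \<in> W"
      using j g(1) nat_pow_pow[OF g(1), of "p ^ i" p] by (simp add: i W_def mult.commute)
    ultimately show ?thesis by blast
  qed
  then have WG: "W = carrier G" by (rule big[OF W aW])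
  have pC: "x [^] p \<in> C" if "x \<in> carrier G" for x using WG that by (auto simp: W_def)
  define S where "S = (\<lambda>g. inv g \<otimes> \<alpha> g) ` carrier G"
  have SG: "S \<subseteq> carrier G" by (auto simp: S_def)
  have gS: "generate G S = carrier G"
  proof (rule big)
    show "subgroup (generate G S) G" by (rule generate_is_subgroup[OF SG])
    have "\<alpha> ` S \<subseteq> S"
    proof (rule image_subsetI)
      fix s assume "s \<in> S"
      then obtain g where g: "g \<in> carrier G" "s = inv g \<otimes> \<alpha> g" by (auto simp: S_def)
      then have "\<alpha> s = inv (\<alpha> g) \<otimes> \<alpha> (\<alpha> g)" by simp
      then show "\<alpha> s \<in> S" using g(1) unfolding S_def by (intro image_eqI[of _ _ "\<alpha> g"]) auto
    qed
    then have "generate G (\<alpha> ` S) \<subseteq> generate G S" by (rule mono_generate)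
    then show "\<alpha> ` generate G S \<subseteq> generate G S" using a.generate_img[OF SG] by simp
    \<comment> \<open>Otherwise \<open>\<alpha>\<close> multiplies each \<open>g\<close> by some \<open>c\<close> that it fixes, so \<open>\<alpha>\<^sup>j g = g \<otimes> c\<^sup>j\<close>, and the order of
      \<open>c\<close> divides both \<open>m\<close> and a power of \<open>p\<close>.\<close>
    show "\<not> generate G S \<subseteq> C"
    proof
      assume "generate G S \<subseteq> C"
      then have sc: "inv g \<otimes> \<alpha> g \<in> C" if "g \<in> carrier G" for g
        using that generate.incl[of "inv g \<otimes> \<alpha> g" S G] by (auto simp: S_def)
      have "\<alpha> g = g" if g: "g \<in> carrier G" for g
      proof -
        define c where "c = inv g \<otimes> \<alpha> g"
        have c: "c \<in> C" "c \<in> carrier G" using sc[OF g] g by (simp_all add: c_def)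
        have ag: "\<alpha> g = g \<otimes> c" using g by (simp add: c_def m_assoc[symmetric])
        have "(\<alpha> ^^ j) g = g \<otimes> c [^] j" for j
        proof (induction j)
          case 0 show ?case using g by simp
        next
          case (Suc j)
          have "\<alpha> (c [^] j) = c [^] j" using c a.hom_nat_pow[OF c(2)] by (simp add: C_def)
          then have "(\<alpha> ^^ Suc j) g = g \<otimes> c \<otimes> c [^] j" using Suc g c ag by simp
          then show ?case using g c nat_pow_comm[OF c(2), of 1 j] by (simp add: m_assoc)
        qed
        then have "g \<otimes> c [^] m = g" using am[OF g] by metis
        then have cm: "c [^] m = \<one>" using g c(2) by simp
        have "coprime m (p ^ k)" using cop by simp
        then have "c = \<one>" by (rule coprime_exponents_one[OF c(2) cm pG[OF c(2)]])
        then show ?thesis using ag g by simp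
      qed
      then show False using nontriv by blast
    qed
  qed
  \<comment> \<open>Since \<open>\<alpha>\<close> fixes \<open>c\<close> and \<open>g \<otimes> c \<otimes> inv g\<close>, the element \<open>inv g \<otimes> \<alpha> g\<close> commutes with \<open>c\<close>.\<close>
  have central: "c \<otimes> x = x \<otimes> c" if c: "c \<in> C" and x: "x \<in> carrier G" for c x
  proof -
    let ?D = "{x \<in> carrier G. c \<otimes> x = x \<otimes> c}"
    note cG = Cc[OF c]
    have D: "subgroup ?D G"
    proof (rule subgroupI)
      show "?D \<noteq> {}" using cG by (auto intro!: exI[of _ \<one>])
      fix u assume "u \<in> ?D"
      then have u: "u \<in> carrier G" "c \<otimes> u = u \<otimes> c" by auto
      then have "inv u \<otimes> c = c \<otimes> inv u" using cG by (metis inv_closed inv_solve_left inv_solve_right m_assoc m_closed)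
      then show "inv u \<in> ?D" using u by simp
      fix v assume "v \<in> ?D"
      then have v: "v \<in> carrier G" "c \<otimes> v = v \<otimes> c" by auto
      have "c \<otimes> (u \<otimes> v) = u \<otimes> v \<otimes> c" using u v cG by (metis m_assoc)
      then show "u \<otimes> v \<in> ?D" using u v by simp
    qed auto
    have "S \<subseteq> ?D"
    proof
      fix s assume "s \<in> S"
      then obtain g where g: "g \<in> carrier G" "s = inv g \<otimes> \<alpha> g" by (auto simp: S_def)
      have y: "g \<otimes> c \<otimes> inv g \<in> C" by (rule normal_conj[OF nC g(1) c])
      have "\<alpha> g \<otimes> c \<otimes> inv (\<alpha> g) = \<alpha> (g \<otimes> c \<otimes> inv g)" using g c cG by (simp add: C_def)
      also have "\<dots> = g \<otimes> c \<otimes> inv g" using y by (simp add: C_def)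
      finally have e: "\<alpha> g \<otimes> c \<otimes> inv (\<alpha> g) = g \<otimes> c \<otimes> inv g" .
      have "c \<otimes> s = inv g \<otimes> (g \<otimes> c \<otimes> inv g) \<otimes> \<alpha> g" using g cG by (simp add: m_assoc[symmetric])
      also have "\<dots> = inv g \<otimes> (\<alpha> g \<otimes> c)" unfolding e[symmetric] using g cG by (simp add: m_assoc)
      also have "\<dots> = s \<otimes> c" using g cG by (simp add: m_assoc)
      finally show "s \<in> ?D" using g by simp
    qed
    then have "generate G S \<subseteq> ?D" using generate_subgroup_incl[OF _ D] by blast
    then show ?thesis using gS x by blast
  qed
  define n where "n = (if p = 2 then 4 else p)"
  have pn: "p dvd n" by (simp add: n_def)
  \<comment> \<open>This is why \<open>4\<close> replaces \<open>2\<close> for \<open>p = 2\<close>: the exponent \<open>n(n - 1)/2\<close> must be divisible by \<open>p\<close>.\<close>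
  have pn2: "p dvd n * (n - 1) div 2"
  proof (cases "p = 2")
    case True then show ?thesis by (simp add: n_def)
  next
    case False
    then have "odd p" using p primes_dvd_imp_eq two_is_prime_nat by blast
    then have "even (p - 1)" by simp
    then have "n * (n - 1) div 2 = p * ((p - 1) div 2)" using False by (simp add: n_def div_mult_swap)
    then show ?thesis by simp
  qed
  have "S \<subseteq> C"
  proof
    fix s assume "s \<in> S"
    then obtain g where g: "g \<in> carrier G" "s = inv g \<otimes> \<alpha> g" by (auto simp: S_def)
    have s: "s \<in> carrier G" using g by simp
    have ag: "\<alpha> g = g \<otimes> s" using g by (simp add: m_assoc[symmetric])
    define z where "z = s \<otimes> g \<otimes> inv s \<otimes> inv g"
    have z: "z \<in> C" unfolding z_def by (rule comm[OF s g(1)])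
    note zG = Cc[OF z]
    have sg: "s \<otimes> g = z \<otimes> (g \<otimes> s)"
    proof -
      have "z \<otimes> (g \<otimes> s) = s \<otimes> g \<otimes> inv s \<otimes> (inv g \<otimes> (g \<otimes> s))" using s g(1) by (simp add: z_def m_assoc)
      also have "inv g \<otimes> (g \<otimes> s) = s" using s g(1) by (simp add: m_assoc[symmetric])
      finally show ?thesis using s g(1) by (simp add: m_assoc)
    qed
    have zp: "z [^] p = \<one>"
    proof -
      have "z [^] p \<otimes> (g \<otimes> s [^] p) = g \<otimes> s [^] p"
        using power_past[OF s g(1) zG central[OF z s] sg, of p] central[OF pC[OF s] g(1)] by simp
      moreover have "g \<otimes> s [^] p \<in> carrier G" "z [^] p \<in> carrier G" using zG g(1) s by simp_all
      ultimately show ?thesis by (simp only: r_cancel_one)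
    qed
    obtain q where q: "n * (n - 1) div 2 = p * q" using pn2 by blast
    have zq: "z [^] (p * q) = \<one>" using nat_pow_pow[OF zG, of p q] zp by simp
    have "\<alpha> g [^] n = (g \<otimes> s) [^] n" unfolding ag ..
    also have "\<dots> = g [^] n \<otimes> s [^] n" unfolding power_commutator[OF s g(1) zG central[OF z s] central[OF z g(1)] sg, of n] q zq
      using g(1) s by simp
    finally have "\<alpha> g [^] n = g [^] n \<otimes> s [^] n" .
    moreover have "\<alpha> g [^] n = g [^] n"
    proof -
      obtain q' where q': "n = p * q'" using pn by blast
      have "g [^] n = (g [^] p) [^] q'" using nat_pow_pow[OF g(1), of p q'] q' by simp
      then have "g [^] n \<in> C" using subgroup_int_pow_closed[OF C pC[OF g(1)], of "int q'"] by (simp add: int_pow_int)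
      then have "\<alpha> (g [^] n) = g [^] n" by (simp add: C_def)
      then show ?thesis using a.hom_nat_pow[OF g(1), of n] by simp
    qed
    ultimately have "s [^] n = \<one>" using g(1) s by simp
    then have "\<alpha> s = s" using fixp[OF s] by (simp add: n_def)
    then show "s \<in> C" using s by (simp add: C_def)
  qed
  then have "generate G S \<subseteq> C" by (rule generate_subgroup_incl[OF _ C])
  then show False using gS CG subgroup.subset[OF C] by blast
qed

text \<open>
  Induction over the invariant subgroups reduces to the minimal case above.
\<close>

theorem p'_automorphism_trivial:
  fixes k m :: nat
  assumes p: "Factorial_Ring.prime p" and ordG: "order G = p ^ k" and a: "\<alpha> \<in> hom G G"
    and am: "\<And>x. x \<in> carrier G \<Longrightarrow> (\<alpha> ^^ m) x = x" and cop: "coprime m p"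
    and fixp: "\<And>x. x \<in> carrier G \<Longrightarrow> x [^] (if p = 2 then 4 else p) = \<one> \<Longrightarrow> \<alpha> x = x"
    and x: "x \<in> carrier G"
  shows "\<alpha> x = x"
proof -
  have "\<forall>x\<in>S. \<alpha> x = x" if "subgroup S G" "\<alpha> ` S \<subseteq> S" for S
    using that
  proof (induction "card S" arbitrary: S rule: less_induct)
    case less
    note S = less.prems
    interpret S: finite_group "G\<lparr>carrier := S\<rparr>" by (rule finite_group_subgroup[OF S(1)])
    have Sc: "y \<in> carrier G" if "y \<in> S" for y using subgroup.mem_carrier[OF S(1) that] .
    have "card S dvd p ^ k"
      using card_subgroup_dvd[OF S(1) subgroup_self subgroup.subset[OF S(1)]] ordG by (simp add: order_def)
    then obtain j where j: "card S = p ^ j" using divides_primepow_nat[OF p] by blast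
    have "\<forall>x\<in>carrier (G\<lparr>carrier := S\<rparr>). \<alpha> x = x"
    proof (rule S.minimal_automorphism_trivial[OF p _ _ _ cop])
      show "order (G\<lparr>carrier := S\<rparr>) = p ^ j" using j by (simp add: order_def)
      show "\<alpha> \<in> hom (G\<lparr>carrier := S\<rparr>) (G\<lparr>carrier := S\<rparr>)"
        using a S(2) Sc by (auto simp: hom_def)
      show "(\<alpha> ^^ m) y = y" if "y \<in> carrier (G\<lparr>carrier := S\<rparr>)" for y using am Sc that by simp
      show "\<alpha> y = y" if "y \<in> carrier (G\<lparr>carrier := S\<rparr>)"
          "y [^]\<^bsub>G\<lparr>carrier := S\<rparr>\<^esub> (if p = 2 then 4 else p) = \<one>\<^bsub>G\<lparr>carrier := S\<rparr>\<^esub>" for y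
        using fixp[of y] Sc[of y] that by (simp add: nat_pow_def)
      fix R assume R: "subgroup R (G\<lparr>carrier := S\<rparr>)" "\<alpha> ` R \<subseteq> R" "R \<noteq> carrier (G\<lparr>carrier := S\<rparr>)"
      have "R \<subset> S" using subgroup.subset[OF R(1)] R(3) by auto
      then have "card R < card S"
        using finite_subset_carrier[OF subgroup.subset[OF S(1)]] by (rule psubset_card_mono[rotated])
      moreover have "subgroup R G" by (rule incl_subgroup[OF S(1) R(1)])
      ultimately show "\<forall>y\<in>R. \<alpha> y = y" using less.hyps R(2) by blast
    qed
    then show ?case by simp
  qed
  moreover have "\<alpha> ` carrier G \<subseteq> carrier G" using a by (auto simp: hom_def)
  ultimately show ?thesis using subgroup_self x by blast
qed

lemma coprime_conjugation_trivial:
  fixes k m :: nat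
  assumes p: "Factorial_Ring.prime p" and V: "V \<lhd> G" "card V = p ^ k"
    and x: "x \<in> carrier G" "x [^] m = \<one>" and cop: "coprime m p"
    and fixp: "\<And>v. v \<in> V \<Longrightarrow> v [^] (if p = 2 then 4 else p) = \<one> \<Longrightarrow> x \<otimes> v = v \<otimes> x"
    and v: "v \<in> V"
  shows "x \<otimes> v = v \<otimes> x"
proof -
  let ?\<alpha> = "\<lambda>v. x \<otimes> v \<otimes> inv x"
  interpret V: finite_group "G\<lparr>carrier := V\<rparr>" by (rule finite_group_subgroup[OF normal_imp_subgroup[OF V(1)]])
  have Vc: "u \<in> carrier G" if "u \<in> V" for u using that normal_subset[OF V(1)] by blast
  have iff: "?\<alpha> u = u \<longleftrightarrow> x \<otimes> u = u \<otimes> x" if "u \<in> V" for u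
    using inv_solve_right[of u "x \<otimes> u" x] Vc[OF that] x(1) by (auto simp: eq_commute)
  have "?\<alpha> v = v"
  proof (rule V.p'_automorphism_trivial[OF p _ _ _ cop])
    show "order (G\<lparr>carrier := V\<rparr>) = p ^ k" using V(2) by (simp add: order_def)
    have "x \<otimes> (u \<otimes> w) \<otimes> inv x = x \<otimes> u \<otimes> inv x \<otimes> (x \<otimes> w \<otimes> inv x)" if "u \<in> carrier G" "w \<in> carrier G" for u w
    proof -
      have "inv x \<otimes> (x \<otimes> (w \<otimes> inv x)) = w \<otimes> inv x" using x(1) that by (simp add: m_assoc[symmetric])
      then show ?thesis using x(1) that by (simp add: m_assoc)
    qed
    then show "?\<alpha> \<in> hom (G\<lparr>carrier := V\<rparr>) (G\<lparr>carrier := V\<rparr>)"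
      using normal_conj[OF V(1) x(1)] Vc by (auto simp: hom_def)
    show "(?\<alpha> ^^ m) u = u" if "u \<in> carrier (G\<lparr>carrier := V\<rparr>)" for u
    proof -
      have u: "u \<in> carrier G" using that Vc by simp
      have "(?\<alpha> ^^ j) u = x [^] j \<otimes> u \<otimes> inv (x [^] j)" for j
      proof (induction j)
        case 0 show ?case using u by simp
      next
        case (Suc j)
        have xs: "x [^] Suc j = x \<otimes> x [^] j" using nat_pow_Suc2[OF x(1)] .
        have "(?\<alpha> ^^ Suc j) u = x \<otimes> (x [^] j \<otimes> u \<otimes> inv (x [^] j)) \<otimes> inv x" using Suc by simp
        also have "\<dots> = x [^] Suc j \<otimes> u \<otimes> inv (x [^] Suc j)"
          unfolding xs using x(1) u by (simp add: m_assoc inv_mult_group)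
        finally show ?case .
      qed
      then show ?thesis using x(2) u by simp
    qed
    show "?\<alpha> u = u" if "u \<in> carrier (G\<lparr>carrier := V\<rparr>)"
       "u [^]\<^bsub>G\<lparr>carrier := V\<rparr>\<^esub> (if p = 2 then 4 else p) = \<one>\<^bsub>G\<lparr>carrier := V\<rparr>\<^esub>" for u
      using fixp[of u] iff[of u] that by (simp add: nat_pow_def)
    show "v \<in> carrier (G\<lparr>carrier := V\<rparr>)" using v by simp
  qed
  then show ?thesis using iff[OF v] by simp
qed

lemma coprime_section_trivial:
  fixes m :: nat
  assumes p: "Factorial_Ring.prime p" and L: "L \<lhd> G" and P: "P \<lhd> G" and LP: "L \<subseteq> P"
    and pi: "p_index p L P" and x: "x \<in> carrier G" "x [^] m = \<one>" and cop: "coprime m p"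
    and fixp: "\<And>y. y \<in> P \<Longrightarrow> y [^] (if p = 2 then 4 else p) \<in> L \<Longrightarrow> commute_mod G L x y"
    and y: "y \<in> P"
  shows "commute_mod G L x y"
proof -
  interpret f: finite_group_hom G "G Mod L" "(#>) L" by (rule Mod_hom[OF L])
  interpret B: finite_group "G Mod L" by (rule finite_group_Mod[OF L])
  note sL = Mod_hom(3)[OF L]
  have Pc: "u \<in> carrier G" if "u \<in> P" for u using that normal_subset[OF P] by blast
  obtain k where k: "card ((#>) L ` P) = p ^ k"
    using p_index_Mod[OF L normal_imp_subgroup[OF P] LP pi] by blast
  note one = Mod_eq_one_iff[OF L]
  have "(L #> x) \<otimes>\<^bsub>G Mod L\<^esub> (L #> y) = (L #> y) \<otimes>\<^bsub>G Mod L\<^esub> (L #> x)"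
  proof (rule B.coprime_conjugation_trivial[OF p f.image_normal[OF P sL] k f.hom_closed[OF x(1)] _ cop])
    show "(L #> x) [^]\<^bsub>G Mod L\<^esub> m = \<one>\<^bsub>G Mod L\<^esub>" using f.hom_nat_pow[OF x(1), of m] x(2) f.hom_one by simp
    show "L #> y \<in> (#>) L ` P" using y by blast
    fix v assume v: "v \<in> (#>) L ` P" "v [^]\<^bsub>G Mod L\<^esub> (if p = 2 then 4 else p) = \<one>\<^bsub>G Mod L\<^esub>"
    then obtain u where u: "u \<in> P" "v = L #> u" by blast
    have "u [^] (if p = 2 then 4 else p) \<in> L"
      using v(2) u one[of "u [^] (if p = 2 then 4 else p)"] f.hom_nat_pow[OF Pc[OF u(1)]] Pc[OF u(1)]
      by (simp del: one_FactGroup)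
    then show "(L #> x) \<otimes>\<^bsub>G Mod L\<^esub> v = v \<otimes>\<^bsub>G Mod L\<^esub> (L #> x)"
      using fixp[OF u(1)] commute_mod_Mod[OF L x(1) Pc[OF u(1)]] u(2) by simp
  qed
  then show ?thesis using commute_mod_Mod[OF L x(1) Pc[OF y]] by simp
qed

end

section \<open>Chief factors whose elements normalize residuals\<close>

context finite_group
begin

text \<open>
  Take \<open>W\<close> maximal among the normal subgroups of \<open>G\<close> that avoid \<open>H/K\<close>, and a chief step from \<open>W\<close> to \<open>V\<close>. As \<open>V\<close>
  covers \<open>H/K\<close>, this section is perspective to one between \<open>H \<inter> W\<close> and \<open>H \<inter> V\<close>, and its order divides
  that of \<open>V/W\<close>.
\<close>

lemma subgroup_p_solvable:
  assumes p: "Factorial_Ring.prime p" and ps: "p_solvable p G"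
    and T: "subgroup T G" and S: "chief_step (G\<lparr>carrier := T\<rparr>) K H"
  shows "p_index p K H \<or> p'_index p K H"
proof -
  interpret T: finite_group "G\<lparr>carrier := T\<rparr>" by (rule finite_group_subgroup[OF T])
  have nK: "K \<lhd> G\<lparr>carrier := T\<rparr>" and nH: "H \<lhd> G\<lparr>carrier := T\<rparr>" and KH: "K \<subset> H"
    using S by (auto simp: chief_step_def)
  have HT: "H \<subseteq> T" using T.normal_subset[OF nH] by simp
  have sK: "subgroup K G" and sH: "subgroup H G"
    using incl_subgroup[OF T normal_imp_subgroup] nK nH by auto
  let ?P = "\<lambda>W. W \<lhd> G \<and> H \<inter> W \<subseteq> K"
  have "?P {\<one>}" using one_is_normal subgroup.one_closed[OF sK] by auto
  moreover have "\<forall>W. ?P W \<longrightarrow> card W < Suc (card (carrier G))"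
    using normal_subset by (auto intro!: le_imp_less_Suc card_mono)
  ultimately obtain W where W: "W \<lhd> G" "H \<inter> W \<subseteq> K" and max: "\<And>W'. ?P W' \<Longrightarrow> card W' \<le> card W"
    using ex_has_greatest_nat[of ?P "{\<one>}" card "Suc (card (carrier G))"] by blast
  have "W \<noteq> carrier G" using W(2) KH HT subgroup.subset[OF T] by blast
  then have "W \<subset> carrier G" using normal_subset[OF W(1)] by blast
  then obtain V where V: "chief_step G W V" using chief_step_above[OF W(1) carrier_normal] by blast
  have nV: "V \<lhd> G" and WV: "W \<subset> V" using V by (auto simp: chief_step_def)
  have "card W < card V" using WV finite_subset_carrier[OF normal_subset[OF nV]] by (rule psubset_card_mono[rotated])
  then have HV: "\<not> H \<inter> V \<subseteq> K" using max[of V] nV by auto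
  have nVT: "V \<inter> T \<lhd> G\<lparr>carrier := T\<rparr>" using normal_Int_subgroup[OF T nV] .
  have e: "H \<inter> (V \<inter> T) = H \<inter> V" "K \<inter> (V \<inter> T) = K \<inter> V" using HT KH by auto
  have "H \<subseteq> K <#>\<^bsub>G\<lparr>carrier := T\<rparr>\<^esub> (V \<inter> T)"
    using T.chief_step_dichotomy[OF S nVT] HV e by simp
  then have idx: "card H * card (K \<inter> V) = card (H \<inter> V) * card K"
    using T.chief_step_down(2)[OF S nVT] e by simp
  have sV: "subgroup V G" and sW: "subgroup W G" using nV W(1) normal_imp_subgroup by auto
  have s: "subgroup (H \<inter> W) G" "subgroup (K \<inter> V) G" "subgroup (H \<inter> V) G"
    using subgroups_Inter_pair sH sK sV sW by auto
  have sub: "H \<inter> W \<subseteq> K \<inter> V" "K \<inter> V \<subseteq> H \<inter> V" using W(2) WV KH by auto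
  have "p_index p W V \<or> p'_index p W V" using ps V p_solvable_iff by blast
  then have "p_index p (H \<inter> W) (H \<inter> V) \<or> p'_index p (H \<inter> W) (H \<inter> V)"
    using index_inter[OF p sH W(1) sV] WV by blast
  then have "p_index p (K \<inter> V) (H \<inter> V) \<or> p'_index p (K \<inter> V) (H \<inter> V)"
    using index_between(2,4)[OF p s sub] by blast
  then show ?thesis
    using index_cong(2,3)[OF idx card_subgroup_pos[OF sK] card_subgroup_pos[OF s(2)]] by simp
qed

lemma normalizer_subgroup_iff:
  assumes "subgroup C G"
  shows "x \<in> normalizer G C \<longleftrightarrow> x \<in> carrier G \<and> (\<forall>y\<in>C. x \<otimes> y \<otimes> inv x \<in> C)"
    and "subgroup (normalizer G C) G" and "C \<subseteq> normalizer G C"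
proof -
  note sub = subgroup.subset[OF assms]
  show "x \<in> normalizer G C \<longleftrightarrow> x \<in> carrier G \<and> (\<forall>y\<in>C. x \<otimes> y \<otimes> inv x \<in> C)"
    by (rule normalizer_iff[OF sub])
  show "subgroup (normalizer G C) G" by (rule normalizer_imp_subgroup[OF sub])
  show "C \<subseteq> normalizer G C"
  proof
    fix x assume "x \<in> C"
    then show "x \<in> normalizer G C"
      unfolding normalizer_iff[OF sub] using subgroup.m_closed[OF assms] subgroup.m_inv_closed[OF assms] sub by blast
  qed
qed

text \<open>
  The assumption on supplements says that \<open>E\<close> behaves modulo \<open>L\<close> like a subgroup of the Frattini
  subgroup. Take \<open>A\<close> minimal with \<open>AE = B\<close>. If \<open>A/L\<close> were not a \<open>p'\<close>-group, it would have a chief factor \<open>Z/Y\<close>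
  that is a \<open>p\<close>-group with \<open>A/Z\<close> a \<open>p'\<close>-group. A complement of \<open>Z/Y\<close> in \<open>A/Y\<close> is normal by the Frattini argument,
  because \<open>Z\<close> lies in \<open>E\<close>, and it would be a smaller choice for \<open>A\<close>.
\<close>

lemma normal_p'_supplement:
  assumes p: "Factorial_Ring.prime p"
    and ps: "\<And>K H. chief_step G K H \<Longrightarrow> p_index p K H \<or> p'_index p K H"
    and L: "L \<lhd> G" and E: "E \<lhd> G" and B: "B \<lhd> G" and LE: "L \<subseteq> E" and EB: "E \<subseteq> B"
    and p'i: "p'_index p E B"
    and frattini: "\<And>N. subgroup N G \<Longrightarrow> L \<subseteq> N \<Longrightarrow> N <#> E = carrier G \<Longrightarrow> N = carrier G"
  obtains A where "A \<lhd> G" "L \<subseteq> A" "p'_index p L A" "A <#> E = B"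
proof -
  note sub = normal_imp_subgroup
  let ?P = "\<lambda>A. A \<lhd> G \<and> L \<subseteq> A \<and> A <#> E = B"
  have "B <#> E = B"
    using product_subgroup(2)[OF E sub[OF B]] product_subgroup(4)[OF E sub[OF B] sub[OF B]] EB by blast
  then have "?P B" using B LE EB by blast
  then obtain A where A: "A \<lhd> G" "L \<subseteq> A" "A <#> E = B" and minA: "\<And>A'. ?P A' \<Longrightarrow> card A \<le> card A'"
    using arg_min_natI[of ?P B card] arg_min_nat_le[of ?P _ card] by blast
  let ?R = "\<lambda>Z. Z \<lhd> G \<and> L \<subseteq> Z \<and> Z \<subseteq> A \<and> p'_index p Z A"
  have "?R A" using A p'_index_refl[OF p] by blast
  then obtain Z where Z: "Z \<lhd> G" "L \<subseteq> Z" "Z \<subseteq> A" "p'_index p Z A" and minZ: "\<And>Z'. ?R Z' \<Longrightarrow> card Z \<le> card Z'"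
    using arg_min_natI[of ?R A card] arg_min_nat_le[of ?R _ card] by blast
  have fZ: "finite Z" and fA: "finite A" using finite_subset_carrier normal_subset Z(1) A(1) by blast+
  have "Z = L"
  proof (rule ccontr)
    assume "Z \<noteq> L"
    then have LZ: "L \<subset> Z" using Z(2) by blast
    have AE: "p'_index p (A \<inter> E) A" using index_product(2)[OF E sub[OF A(1)], of p] A(3) p'i by simp
    have "p'_index p (Z \<inter> (A \<inter> E)) (Z \<inter> A)"
      using index_inter(2)[OF p sub[OF Z(1)] normal_subgroup_intersect[OF A(1) E] sub[OF A(1)] _ AE] by blast
    moreover have "Z \<inter> A = Z" "Z \<inter> (A \<inter> E) = Z \<inter> E" using Z(3) by auto
    ultimately have "p'_index p (Z \<inter> E) A" using p'_index_trans[OF p _ Z(4)] by simp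
    \<comment> \<open>Minimality of \<open>Z\<close> puts it inside \<open>E\<close>.\<close>
    then have "card Z \<le> card (Z \<inter> E)" using minZ[of "Z \<inter> E"] normal_subgroup_intersect[OF Z(1) E] Z LE by blast
    then have "Z \<inter> E = Z" using fZ by (intro card_seteq) auto
    then have ZE: "Z \<subseteq> E" by blast
    obtain Y where Y: "chief_step G Y Z" "L \<subseteq> Y" using chief_step_below[OF L Z(1) LZ] by blast
    have nY: "Y \<lhd> G" and YZ: "Y \<subset> Z" using Y(1) by (auto simp: chief_step_def)
    have cYZ: "card Y < card Z" using YZ fZ by (rule psubset_card_mono[rotated])
    have "\<not> p'_index p Y Z"
    proof
      assume "p'_index p Y Z"
      then have "p'_index p Y A" using p'_index_trans[OF p _ Z(4)] by blast
      then have "card Z \<le> card Y" using minZ[of Y] nY Y(2) YZ Z(3) by blast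
      then show False using cYZ by simp
    qed
    then have pYZ: "p_index p Y Z" using ps[OF Y(1)] by blast
    obtain C where C: "subgroup C G" "Y \<subseteq> C" "C \<subseteq> A" "C <#> Z = A" "C \<inter> Z = Y"
      and fr: "\<And>t. t \<in> carrier G \<Longrightarrow> \<exists>h\<in>Z. \<forall>q\<in>C. (h \<otimes> t) \<otimes> q \<otimes> inv (h \<otimes> t) \<in> C"
      using schur_zassenhaus_frattini[OF p nY Z(1) A(1) _ Z(3) pYZ Z(4) chief_p_abelian[OF p Y(1) pYZ]] YZ
      by blast
    note nrm = normalizer_subgroup_iff[OF C(1)]
    let ?N = "normalizer G C"
    note PN = product_subgroup[OF E nrm(2)]
    \<comment> \<open>The normalizer of the complement supplements \<open>E\<close>, so it is everything.\<close>
    have "carrier G \<subseteq> ?N <#> E"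
    proof
      fix t assume t: "t \<in> carrier G"
      obtain h where h: "h \<in> Z" "\<forall>q\<in>C. (h \<otimes> t) \<otimes> q \<otimes> inv (h \<otimes> t) \<in> C" using fr[OF t] by blast
      have hG: "h \<in> carrier G" using h(1) normal_subset[OF Z(1)] by blast
      have "h \<otimes> t \<in> ?N" using nrm(1) h(2) hG t by simp
      then have "h \<otimes> t \<in> ?N <#> E" using PN(2) by blast
      moreover have "inv h \<in> ?N <#> E" using subgroup.m_inv_closed[OF sub[OF Z(1)] h(1)] ZE PN(3) by blast
      ultimately have "inv h \<otimes> (h \<otimes> t) \<in> ?N <#> E" by (rule subgroup.m_closed[OF PN(1), rotated])
      then show "t \<in> ?N <#> E" using hG t by (simp add: m_assoc[symmetric])
    qed
    then have "?N <#> E = carrier G" using subgroup.subset[OF PN(1)] by blast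
    moreover have "L \<subseteq> ?N" using Y(2) C(2) nrm(3) by blast
    ultimately have NG: "?N = carrier G" using frattini[OF nrm(2)] by blast
    have nC: "C \<lhd> G" unfolding normal_inv_iff using C(1) NG nrm(1) by blast
    note PC = product_subgroup[OF E C(1)]
    have "C <#> E = B"
    proof
      have "E \<subseteq> A <#> E" by (rule product_subgroup(3)[OF E sub[OF A(1)]])
      then show "C <#> E \<subseteq> B" using PC(4)[OF sub[OF B]] C(3) A(3) product_subgroup(2)[OF E sub[OF A(1)]] by blast
      have "A \<subseteq> C <#> E" using C(4) mono_set_mult[of C C Z E] ZE by blast
      then show "B \<subseteq> C <#> E" using product_subgroup(4)[OF E sub[OF A(1)] PC(1) _ PC(3)] A(3) by simp
    qed
    then have "card A \<le> card C" using minA[of C] nC Y(2) C(2) by blast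
    then have "C = A" using fA C(3) by (intro card_seteq) auto
    then show False using C(5) Z(3) YZ by blast
  qed
  then show ?thesis using that[OF A(1,2) _ A(3)] Z(4) by simp
qed

text \<open>
  The centralizer \<open>C\<close> of \<open>H/L\<close> has a \<open>p\<close>-supersolvable quotient. For a minimal supplement \<open>T\<close> of \<open>C\<close>
  the intersection \<open>H \<inter> T\<close> is \<open>L\<close> or \<open>H\<close>, being normal in \<open>TC = G\<close>. In the first case commutators of \<open>H\<close> with
  the residual of \<open>T\<close> lie in \<open>H \<inter> T = L\<close>, and \<open>G/C\<close> is a quotient of \<open>T\<close> by a subgroup containing that
  residual. The second case contradicts \<open>C \<noteq> G\<close> by \<open>normal_p'_supplement\<close> in the group \<open>T\<close>.
\<close>

theorem residual_centralizes_normalizing_chief_factor: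
  assumes p: "Factorial_Ring.prime p" and ps: "p_solvable p G"
    and S: "chief_step G L H" and pi: "p_index p L H"
    and nrm: "\<And>T h y. subgroup T G \<Longrightarrow> L \<subseteq> T \<Longrightarrow> h \<in> H \<Longrightarrow> y \<in> residual_above p (G\<lparr>carrier := T\<rparr>) L
      \<Longrightarrow> h \<otimes> y \<otimes> inv h \<in> residual_above p (G\<lparr>carrier := T\<rparr>) L"
  shows "residual_above p G L \<subseteq> section_centralizer G H L"
proof -
  note sub = normal_imp_subgroup
  have L: "L \<lhd> G" and H: "H \<lhd> G" and LH: "L \<subset> H" using S by (auto simp: chief_step_def)
  let ?C = "section_centralizer G H L"
  have C: "?C \<lhd> G" by (rule section_centralizer_normal[OF L H])
  have Hc: "h \<in> carrier G" if "h \<in> H" for h using that normal_subset[OF H] by blast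
  have LC: "L \<subseteq> ?C"
  proof
    fix x assume x: "x \<in> L"
    have "commute_mod G L x h" if "h \<in> H" for h
      using commute_mod_in[OF L Hc[OF that] x] commute_mod_sym[of L x h] by blast
    then show "x \<in> ?C" using x normal_subset[OF L] by (auto simp: section_centralizer_def)
  qed
  have "supersolvable_above p G ?C"
  proof (cases "?C = carrier G")
    case True then show ?thesis using supersolvable_above_carrier by simp
  next
    case Cne: False
    let ?P = "\<lambda>T. subgroup T G \<and> L \<subseteq> T \<and> T <#> ?C = carrier G"
    have "carrier G <#> ?C = carrier G"
      using product_subgroup(1,2)[OF C subgroup_self] subgroup.subset by blast
    then have "?P (carrier G)" using subgroup_self normal_subset[OF L] by blast
    then obtain T where T: "subgroup T G" "L \<subseteq> T" "T <#> ?C = carrier G"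
      and minT: "\<And>T'. ?P T' \<Longrightarrow> card T \<le> card T'"
      using arg_min_natI[of ?P "carrier G" card] arg_min_nat_le[of ?P _ card] by blast
    define TT where "TT = G\<lparr>carrier := T\<rparr>"
    interpret T: finite_group TT unfolding TT_def by (rule finite_group_subgroup[OF T(1)])
    have TT [simp]: "carrier TT = T" "monoid.mult TT = monoid.mult G" "one TT = one G"
      "set_mult TT = set_mult G" by (simp_all add: TT_def fun_eq_iff set_mult_def)
    have invT: "inv\<^bsub>TT\<^esub> x = inv x" if "x \<in> T" for x
      using m_inv_consistent[OF T(1) that] by (simp add: TT_def)
    have Tc: "x \<in> carrier G" if "x \<in> T" for x using subgroup.mem_carrier[OF T(1) that] .
    have decomp: "\<exists>t\<in>T. \<exists>c\<in>?C. g = t \<otimes> c" if "g \<in> carrier G" for g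
      using that unfolding T(3)[symmetric] set_mult_def by blast
    have Cc: "c \<in> carrier G" if "c \<in> ?C" for c using that by (simp add: section_centralizer_def)
    let ?E = "?C \<inter> T"
    have nE: "?E \<lhd> TT" unfolding TT_def by (rule normal_Int_subgroup[OF T(1) C])
    have sHT: "subgroup (H \<inter> T) G" by (rule subgroups_Inter_pair[OF sub[OF H] T(1)])
    have LHT: "L \<subseteq> H \<inter> T" using LH T(2) by blast
    \<comment> \<open>It is normalized by \<open>T\<close>, and by \<open>C\<close> because \<open>C\<close> moves its elements only within cosets of \<open>L\<close>.\<close>
    have nHT: "H \<inter> T \<lhd> G"
      unfolding normal_inv_iff
    proof (intro conjI ballI)
      fix g y assume g: "g \<in> carrier G" and y: "y \<in> H \<inter> T"
      obtain t c where tc: "t \<in> T" "c \<in> ?C" "g = t \<otimes> c" using decomp[OF g] by blast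
      have yG: "y \<in> carrier G" using y Hc by blast
      have "c \<otimes> y \<otimes> inv c \<otimes> inv y \<in> L"
        using tc(2) y commute_mod_iff[OF L Cc[OF tc(2)] yG] by (simp add: section_centralizer_def)
      then have "(c \<otimes> y \<otimes> inv c \<otimes> inv y) \<otimes> y \<in> H \<inter> T" by (rule subgroup.m_closed[OF sHT subsetD[OF LHT] y])
      then have u: "c \<otimes> y \<otimes> inv c \<in> H \<inter> T" using yG Cc[OF tc(2)] by (simp add: m_assoc)
      have "t \<otimes> (c \<otimes> y \<otimes> inv c) \<otimes> inv t \<in> H" using normal_conj[OF H Tc[OF tc(1)]] u by blast
      moreover have "t \<otimes> (c \<otimes> y \<otimes> inv c) \<otimes> inv t \<in> T"
        using u tc(1) subgroup.m_closed[OF T(1)] subgroup.m_inv_closed[OF T(1)] by simp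
      moreover have "t \<otimes> (c \<otimes> y \<otimes> inv c) \<otimes> inv t = g \<otimes> y \<otimes> inv g"
        unfolding tc(3) using Tc[OF tc(1)] Cc[OF tc(2)] yG by (simp add: m_assoc inv_mult_group)
      ultimately show "g \<otimes> y \<otimes> inv g \<in> H \<inter> T" by simp
    qed (rule sHT)
    interpret f: finite_group_hom G "G Mod ?C" "(#>) ?C" by (rule Mod_hom[OF C])
    note kC = Mod_hom(2)[OF C] and sC = Mod_hom(3)[OF C]
    have imT: "(#>) ?C ` T = carrier (G Mod ?C)" using product_subgroup(5)[OF C T(1)] T(3) sC by simp
    have "(G Mod ?C)\<lparr>carrier := (#>) ?C ` T\<rparr> = G Mod ?C" unfolding imT by simp
    then have "finite_group_hom TT (G Mod ?C) ((#>) ?C)"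
      using f.finite_group_hom_restrict[OF T(1)] unfolding TT_def by simp
    then interpret Tf: finite_group_hom TT "G Mod ?C" "(#>) ?C" .
    have sT: "(#>) ?C ` carrier TT = carrier (G Mod ?C)" using imT by simp
    have "H \<inter> T = L \<or> H \<inter> T = H" using S nHT LHT by (auto simp: chief_step_def)
    then show ?thesis
    proof
      assume HTL: "H \<inter> T = L"
      let ?R = "residual_above p TT L"
      have LTT: "L \<subseteq> carrier TT" using T(2) by simp
      note R = T.residual_above_mem[OF LTT, of p]
      have RT: "?R \<subseteq> T" using T.normal_subset[OF R(1)] by simp
      have "?R \<subseteq> ?C"
      proof
        fix y assume y: "y \<in> ?R"
        have yG: "y \<in> carrier G" using y RT Tc by blast
        have sR: "subgroup ?R G" using incl_subgroup[OF T(1)] sub[OF R(1)] by (simp add: TT_def)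
        have "commute_mod G L y h" if h: "h \<in> H" for h
        proof -
          have hG: "h \<in> carrier G" by (rule Hc[OF h])
          have "h \<otimes> y \<otimes> inv h \<in> ?R" using nrm[OF T(1,2) h] y unfolding TT_def by blast
          then have "h \<otimes> y \<otimes> inv h \<otimes> inv y \<in> T"
            using subgroup.m_closed[OF sR _ subgroup.m_inv_closed[OF sR y]] RT by blast
          moreover have "h \<otimes> (y \<otimes> inv h \<otimes> inv y) \<in> H"
            using subgroup.m_closed[OF sub[OF H] h] normal_conj[OF H yG subgroup.m_inv_closed[OF sub[OF H] h]] by blast
          ultimately have "h \<otimes> y \<otimes> inv h \<otimes> inv y \<in> L" using HTL hG yG by (auto simp: m_assoc)
          then show ?thesis using commute_mod_iff[OF L hG yG] commute_mod_sym[of L h y] by blast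
        qed
        then show "y \<in> ?C" using yG by (simp add: section_centralizer_def)
      qed
      then have "supersolvable_above p TT ?E"
        using T.supersolvable_above_mono[OF R(3)] RT by blast
      moreover have "Tf.preimg {\<one>\<^bsub>G Mod ?C\<^esub>} = ?E" "f.preimg {\<one>\<^bsub>G Mod ?C\<^esub>} = ?C"
        using kC Tc by (auto simp: Tf.preimg_def f.preimg_def kernel_def)
      ultimately show ?thesis
        using Tf.supersolvable_above_preimg[OF sT f.H.one_is_normal, of p]
          f.supersolvable_above_preimg[OF sC f.H.one_is_normal, of p] by simp
    next
      assume "H \<inter> T = H"
      then have HT: "H \<subseteq> T" by blast
      have "?E \<noteq> T"
      proof
        assume "?E = T"
        then have "T \<subseteq> ?C" by blast
        then have "T <#> ?C \<subseteq> ?C" using product_subgroup(4)[OF C T(1) sub[OF C]] by blast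
        then show False using T(3) Cne normal_subset[OF C] by blast
      qed
      then have "?E \<subset> carrier TT" by auto
      then obtain B where B: "chief_step TT ?E B" using T.chief_step_above[OF nE T.carrier_normal] by blast
      have nB: "B \<lhd> TT" and EB: "?E \<subset> B" using B by (auto simp: chief_step_def)
      have BT: "B \<subseteq> T" using T.normal_subset[OF nB] by simp
      have sB: "subgroup B G" using incl_subgroup[OF T(1)] sub[OF nB] by (simp add: TT_def)
      have "p_index p ?E B \<or> p'_index p ?E B"
        using subgroup_p_solvable[OF p ps T(1)] B unfolding TT_def by blast
      then have False
      proof
        assume pB: "p_index p ?E B"
        have "(#>) ?C ` B \<lhd> G Mod ?C" by (rule Tf.image_normal[OF nB sT])
        then have nY: "B <#> ?C \<lhd> G"
          using f.preimg_normal product_eq_preimg[OF C sB] by (simp add: f.preimg_def)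
        have "B \<inter> ?C = ?E" using BT EB by blast
        then have "p_index p ?C (B <#> ?C)" using index_product(1)[OF C sB] pB by simp
        then have "B <#> ?C \<subseteq> ?C"
          using chief_p_centralized[OF p S pi nY sub[OF C] product_subgroup(3)[OF C sB]]
          by (auto simp: section_centralizer_def)
        then show False using product_subgroup(2)[OF C sB] BT EB by blast
      next
        assume p'B: "p'_index p ?E B"
        have LTT: "L \<lhd> TT" using normal_Int_subgroup[OF T(1) L] T(2) by (simp add: TT_def Int_absorb2)
        obtain A where A: "A \<lhd> TT" "L \<subseteq> A" "p'_index p L A" "A <#>\<^bsub>TT\<^esub> ?E = B"
        proof (rule T.normal_p'_supplement[OF p _ LTT nE nB _ _ p'B])
          show "p_index p K M \<or> p'_index p K M" if "chief_step TT K M" for K M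
            using subgroup_p_solvable[OF p ps T(1)] that unfolding TT_def by blast
          show "L \<subseteq> ?E" using LC T(2) by blast
          show "?E \<subseteq> B" using EB by blast
          fix N assume N: "subgroup N TT" "L \<subseteq> N" "N <#>\<^bsub>TT\<^esub> ?E = carrier TT"
          have sN: "subgroup N G" using incl_subgroup[OF T(1)] N(1) by (simp add: TT_def)
          have NT: "N \<subseteq> T" using subgroup.subset[OF N(1)] by simp
          note PN = product_subgroup[OF C sN]
          have "T \<subseteq> N <#> ?C" using N(3) mono_set_mult[of N N ?E ?C] by auto
          then have "T <#> ?C \<subseteq> N <#> ?C" using product_subgroup(4)[OF C T(1) PN(1) _ PN(3)] by blast
          then have "N <#> ?C = carrier G" using T(3) subgroup.subset[OF PN(1)] by blast
          then have "card T \<le> card N" using minT[of N] sN N(2) by blast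
          then have "N = T" using NT finite_subset_carrier[OF subgroup.subset[OF T(1)]] by (intro card_seteq) auto
          then show "N = carrier TT" by simp
        qed
        have sA: "subgroup A G" using incl_subgroup[OF T(1)] sub[OF A(1)] by (simp add: TT_def)
        have AT: "A \<subseteq> T" using T.normal_subset[OF A(1)] by simp
        have sAH: "subgroup (A \<inter> H) G" by (rule subgroups_Inter_pair[OF sA sub[OF H]])
        have LAH: "L \<subseteq> A \<inter> H" using A(2) LH by blast
        have "card (A \<inter> H) = card L"
          using p_and_p'_index[OF p _ _ card_normal_pos[OF L]]
            index_between(1)[OF p sub[OF L] sAH sub[OF H] LAH _ pi]
            index_between(3)[OF p sub[OF L] sAH sA LAH _ A(3)] by blast
        then have AHL: "A \<inter> H = L"
          using LAH finite_subset_carrier[OF subgroup.subset[OF sAH]] by (metis card_subset_eq)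
        have "A \<subseteq> ?C"
        proof
          fix a assume a: "a \<in> A"
          have aG: "a \<in> carrier G" using a AT Tc by blast
          have "commute_mod G L a h" if h: "h \<in> H" for h
          proof -
            have hT: "h \<in> T" and hG: "h \<in> carrier G" using h HT Hc by auto
            have "a \<otimes> h \<otimes> inv a \<otimes> inv h \<in> H"
              using subgroup.m_closed[OF sub[OF H] normal_conj[OF H aG h] subgroup.m_inv_closed[OF sub[OF H] h]] .
            moreover have "h \<otimes> inv a \<otimes> inv h \<in> A"
              using T.normal_conj[OF A(1), of h "inv a"] hT subgroup.m_inv_closed[OF sA a] invT by simp
            then have "a \<otimes> (h \<otimes> inv a \<otimes> inv h) \<in> A" by (rule subgroup.m_closed[OF sA a])
            ultimately have "a \<otimes> h \<otimes> inv a \<otimes> inv h \<in> L" using AHL aG hG by (auto simp: m_assoc)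
            then show ?thesis using commute_mod_iff[OF L aG hG] by blast
          qed
          then show "a \<in> ?C" using aG by (simp add: section_centralizer_def)
        qed
        then have "A \<subseteq> ?E" using AT by blast
        then have "A <#>\<^bsub>TT\<^esub> ?E \<subseteq> ?E"
          using T.product_subgroup(4)[OF nE sub[OF A(1)] sub[OF nE]] by blast
        then show False using A(4) EB by blast
      qed
      then show ?thesis ..
    qed
  qed
  then show ?thesis by (rule residual_above_least[OF C LC])
qed

text \<open>
  Let \<open>N\<close> be the last term of the series that avoids \<open>H/L\<close>, and \<open>M\<close> the next one. Then \<open>H/L\<close> is
  perspective to \<open>HN/LN\<close>, and \<open>HN \<le> LM\<close>. Both \<open>L\<close> and \<open>M\<close> normalize the residuals modulo \<open>LN\<close>, the latter because
  a residual modulo \<open>LN\<close> is the product of a residual modulo \<open>N\<close> with \<open>LN\<close>. So the previous theorem applies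
  to \<open>HN/LN\<close>.
\<close>

theorem residual_centralizes_below_N_U_series:
  assumes p: "Factorial_Ring.prime p" and ps: "p_solvable p G"
    and S: "chief_step G L H" and pi: "p_index p L H" and Hj: "H \<subseteq> N_U_series p G j"
  shows "residual_above p G {\<one>} \<subseteq> section_centralizer G H L"
proof -
  note sub = normal_imp_subgroup
  have L: "L \<lhd> G" and H: "H \<lhd> G" and LH: "L \<subset> H" using S by (auto simp: chief_step_def)
  define i' where "i' = (LEAST i. \<not> H \<inter> N_U_series p G i \<subseteq> L)"
  have "\<not> H \<inter> N_U_series p G j \<subseteq> L" using Hj LH by blast
  then have i': "\<not> H \<inter> N_U_series p G i' \<subseteq> L" unfolding i'_def by (rule LeastI)
  have "i' \<noteq> 0" using i' subgroup.one_closed[OF sub[OF L]] by (cases i') auto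
  then obtain i where i: "i' = Suc i" by (cases i') auto
  let ?N = "N_U_series p G i" and ?M = "N_U_series p G (Suc i)"
  have N: "?N \<lhd> G" and M: "?M \<lhd> G" and NM: "?N \<subseteq> ?M"
    by (rule N_U_series_normal N_U_series_mono)+
  have HN: "H \<inter> ?N \<subseteq> L"
    using not_less_Least[of i "\<lambda>i. \<not> H \<inter> N_U_series p G i \<subseteq> L"] i unfolding i'_def by simp
  have HM: "H \<subseteq> L <#> ?M" using chief_step_dichotomy[OF S M] i' i by simp
  note U = chief_step_up[OF S N HN]
  let ?K = "L <#> ?N" and ?H = "H <#> ?N"
  have nK: "?K \<lhd> G" and nH: "?H \<lhd> G" using product_normal[OF N] L H by auto
  note PL = product_subgroup[OF N sub[OF L]] and PH = product_subgroup[OF N sub[OF H]]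
  note PM = product_subgroup[OF M sub[OF L]]
  have pK: "p_index p ?K ?H" using index_cong(2)[OF U(2) card_normal_pos[OF nK] card_normal_pos[OF L]] pi by simp
  have HM': "?H \<subseteq> L <#> ?M" using PH(4)[OF PM(1) HM] PM(3) NM by blast
  have c: "residual_above p G ?K \<subseteq> section_centralizer G ?H ?K"
  proof (rule residual_centralizes_normalizing_chief_factor[OF p ps U(1) pK])
    fix T h y assume T: "subgroup T G" "?K \<subseteq> T" and h: "h \<in> ?H"
      and y: "y \<in> residual_above p (G\<lparr>carrier := T\<rparr>) ?K"
    interpret T: finite_group "G\<lparr>carrier := T\<rparr>" by (rule finite_group_subgroup[OF T(1)])
    let ?R = "residual_above p (G\<lparr>carrier := T\<rparr>) ?K" and ?Q = "residual_above p (G\<lparr>carrier := T\<rparr>) ?N"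
    have nKT: "?K \<lhd> G\<lparr>carrier := T\<rparr>" using normal_Int_subgroup[OF T(1) nK] T(2) by (simp add: Int_absorb2)
    have KT: "?K \<subseteq> carrier (G\<lparr>carrier := T\<rparr>)" using T(2) by simp
    note R = T.residual_above_mem[OF KT, of p]
    have NT: "?N \<subseteq> T" using PL(3) T(2) by blast
    have RQ: "?R = ?Q <#> ?K" using T.residual_above_product[OF PL(3) nKT] by simp
    have RT: "?R \<subseteq> T" using T.normal_subset[OF R(1)] by simp
    have sR: "subgroup ?R G" by (rule incl_subgroup[OF T(1) sub[OF R(1)]])
    have Tc: "x \<in> carrier G" if "x \<in> T" for x using subgroup.mem_carrier[OF T(1) that] .
    have hLM: "h \<in> L <#> ?M" using h HM' by blast
    then obtain l s where ls: "l \<in> L" "s \<in> ?M" "h = l \<otimes> s" unfolding set_mult_def by blast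
    have lT: "l \<in> T" using ls(1) PL(2) T(2) by blast
    have lG: "l \<in> carrier G" and sG: "s \<in> carrier G" using ls normal_subset[OF L] normal_subset[OF M] by auto
    have "y \<in> ?Q <#> ?K" using y RQ by simp
    then obtain a k where ak: "a \<in> ?Q" "k \<in> ?K" "y = a \<otimes> k" unfolding set_mult_def by blast
    have QT: "?Q \<subseteq> T" using T.normal_subset[OF T.residual_above_mem(1)] NT by simp
    have aG: "a \<in> carrier G" and kG: "k \<in> carrier G" using ak QT Tc normal_subset[OF nK] by auto
    have "s \<otimes> a \<otimes> inv s \<in> ?Q" by (rule N_U_series_normalises[OF ls(2) T(1) NT ak(1)])
    moreover have "s \<otimes> k \<otimes> inv s \<in> ?K" by (rule normal_conj[OF nK sG ak(2)])
    ultimately have "(s \<otimes> a \<otimes> inv s) \<otimes> (s \<otimes> k \<otimes> inv s) \<in> ?R" unfolding RQ by (rule set_multI)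
    moreover have "(s \<otimes> a \<otimes> inv s) \<otimes> (s \<otimes> k \<otimes> inv s) = s \<otimes> y \<otimes> inv s"
    proof -
      have "inv s \<otimes> (s \<otimes> (k \<otimes> inv s)) = k \<otimes> inv s" using sG kG by (simp add: m_assoc[symmetric])
      then show ?thesis unfolding ak(3) using sG aG kG by (simp add: m_assoc)
    qed
    ultimately have u: "s \<otimes> y \<otimes> inv s \<in> ?R" by simp
    have "l \<otimes> (s \<otimes> y \<otimes> inv s) \<otimes> inv l \<in> ?R"
      using T.normal_conj[OF R(1), of l] lT u m_inv_consistent[OF T(1) lT] by simp
    moreover have "l \<otimes> (s \<otimes> y \<otimes> inv s) \<otimes> inv l = h \<otimes> y \<otimes> inv h"
      unfolding ls(3) using lG sG aG kG ak(3) by (simp add: m_assoc inv_mult_group)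
    ultimately show "h \<otimes> y \<otimes> inv h \<in> ?R" by simp
  qed
  \<comment> \<open>Back to \<open>H/L\<close>: commutators of \<open>R\<close> with \<open>H\<close> lie in \<open>H \<inter> LN = L\<close>.\<close>
  show ?thesis
  proof
    fix r assume "r \<in> residual_above p G {\<one>}"
    moreover have "{\<one>} \<subseteq> ?K" using subgroup.one_closed[OF PL(1)] by simp
    ultimately have r: "r \<in> section_centralizer G ?H ?K" using residual_above_mono[of "{\<one>}" ?K] c by blast
    then have rG: "r \<in> carrier G" by (simp add: section_centralizer_def)
    have "commute_mod G L r x" if x: "x \<in> H" for x
    proof -
      have xG: "x \<in> carrier G" using x normal_subset[OF H] by blast
      have "commute_mod G ?K r x" using r x PH(2) by (auto simp: section_centralizer_def)
      then have cK: "r \<otimes> x \<otimes> inv r \<otimes> inv x \<in> ?K" using commute_mod_iff[OF nK rG xG] by simp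
      have cH: "r \<otimes> x \<otimes> inv r \<otimes> inv x \<in> H"
        using subgroup.m_closed[OF sub[OF H] normal_conj[OF H rG x] subgroup.m_inv_closed[OF sub[OF H] x]] .
      obtain l n where ln: "l \<in> L" "n \<in> ?N" "r \<otimes> x \<otimes> inv r \<otimes> inv x = l \<otimes> n"
        using cK unfolding set_mult_def by blast
      have lG: "l \<in> carrier G" and nG: "n \<in> carrier G" using ln normal_subset[OF L] normal_subset[OF N] by auto
      have "inv l \<otimes> (l \<otimes> n) \<in> H"
        using subgroup.m_closed[OF sub[OF H] subgroup.m_inv_closed[OF sub[OF H]]] ln(1) LH cH ln(3) by auto
      then have "n \<in> H" using lG nG by (simp add: m_assoc[symmetric])
      then have "n \<in> L" using ln(2) HN by blast
      then have "l \<otimes> n \<in> L" using ln(1) subgroup.m_closed[OF sub[OF L]] by blast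
      then show ?thesis using commute_mod_iff[OF L rG xG] ln(3) by simp
    qed
    then show "r \<in> section_centralizer G H L" using rG by (simp add: section_centralizer_def)
  qed
qed

end

section \<open>Normal p-complements of sections\<close>

context finite_group
begin

text \<open>
  As \<open>H/L\<close> is central in \<open>M/L\<close>, the subgroup \<open>H\<close> normalizes every complement, so the Frattini argument
  makes the complement normal in \<open>G\<close>.
\<close>

lemma normal_central_complement:
  assumes p: "Factorial_Ring.prime p" and L: "L \<lhd> G" and H: "H \<lhd> G" and M: "M \<lhd> G"
    and LH: "L \<subseteq> H" and HM: "H \<subseteq> M" and pi: "p_index p L H" and p'i: "p'_index p H M"
    and central: "\<And>x y. x \<in> M \<Longrightarrow> y \<in> H \<Longrightarrow> commute_mod G L x y"
  obtains C where "C \<lhd> G" "L \<subseteq> C" "C \<subseteq> M" "C <#> H = M" "p'_index p L C" "p_index p C M"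
proof -
  note sub = normal_imp_subgroup
  have ab: "commute_mod G L x y" if "x \<in> H" "y \<in> H" for x y using central that HM by blast
  obtain C where C: "subgroup C G" "L \<subseteq> C" "C \<subseteq> M" "C <#> H = M" "C \<inter> H = L"
    and fr: "\<And>t. t \<in> carrier G \<Longrightarrow> \<exists>h\<in>H. \<forall>q\<in>C. (h \<otimes> t) \<otimes> q \<otimes> inv (h \<otimes> t) \<in> C"
    using schur_zassenhaus_frattini[OF p L H M LH HM pi p'i ab] by blast
  have Hc: "h \<in> carrier G" if "h \<in> H" for h using that normal_subset[OF H] by blast
  have Cc: "c \<in> carrier G" if "c \<in> C" for c using subgroup.mem_carrier[OF C(1) that] .
  have nC: "C \<lhd> G"
    unfolding normal_inv_iff
  proof (intro conjI ballI)
    fix t q assume t: "t \<in> carrier G" and q: "q \<in> C"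
    obtain h where h: "h \<in> H" "\<forall>q\<in>C. (h \<otimes> t) \<otimes> q \<otimes> inv (h \<otimes> t) \<in> C" using fr[OF t] by blast
    define u where "u = (h \<otimes> t) \<otimes> q \<otimes> inv (h \<otimes> t)"
    have u: "u \<in> C" using h(2) q by (simp add: u_def)
    have ih: "inv h \<in> H" by (rule subgroup.m_inv_closed[OF sub[OF H] h(1)])
    have "commute_mod G L (inv h) u" using central[of u "inv h"] u C(3) ih commute_mod_sym[of L u "inv h"] by blast
    then have "inv h \<otimes> u \<otimes> h \<otimes> inv u \<in> L"
      using commute_mod_iff[OF L Hc[OF ih] Cc[OF u]] Hc[OF h(1)] by simp
    then have "(inv h \<otimes> u \<otimes> h \<otimes> inv u) \<otimes> u \<in> C" by (rule subgroup.m_closed[OF C(1) subsetD[OF C(2)] u])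
    then have "inv h \<otimes> u \<otimes> h \<in> C" using Hc[OF h(1)] Cc[OF u] by (simp add: m_assoc)
    moreover have "inv h \<otimes> u \<otimes> h = t \<otimes> q \<otimes> inv t"
    proof -
      have "inv h \<otimes> u \<otimes> h = inv h \<otimes> (h \<otimes> (t \<otimes> q \<otimes> inv t))"
        unfolding u_def using Hc[OF h(1)] Cc[OF q] t by (simp add: m_assoc inv_mult_group)
      also have "\<dots> = t \<otimes> q \<otimes> inv t" using Hc[OF h(1)] Cc[OF q] t by (simp add: m_assoc[symmetric])
      finally show ?thesis .
    qed
    ultimately show "t \<otimes> q \<otimes> inv t \<in> C" by simp
  qed (rule C(1))
  have "p'_index p L C" using index_product(2)[OF H C(1), of p] p'i C(4,5) by simp
  moreover have "p_index p C M"
  proof -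
    have "card M * card L = card H * card C" using card_product[OF H C(1)] C(4,5) by (simp add: mult.commute)
    then show ?thesis
      using index_cong(2)[OF _ card_normal_pos[OF nC] card_normal_pos[OF L]] pi by blast
  qed
  ultimately show ?thesis using that[OF nC C(2,3,4)] by blast
qed

text \<open>
  Induction from the top. A lowest chief factor that is a \<open>p'\<close>-group is absorbed into the
  normal \<open>p'\<close>-part, and one that is central in \<open>D\<close> is split off from it by \<open>normal_central_complement\<close>.
\<close>

lemma p_nilpotent_section:
  assumes p: "Factorial_Ring.prime p" and D: "D \<lhd> G"
    and steps: "\<And>K H. chief_step G K H \<Longrightarrow> L \<subseteq> K \<Longrightarrow> H \<subseteq> D \<Longrightarrow>
      p'_index p K H \<or> p_index p K H \<and> D \<subseteq> section_centralizer G H K"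
    and L: "L \<lhd> G" and LD: "L \<subseteq> D"
  shows "\<exists>M. M \<lhd> G \<and> L \<subseteq> M \<and> M \<subseteq> D \<and> p'_index p L M \<and> p_index p M D"
  using L LD steps
proof (induction "card D - card L" arbitrary: L rule: less_induct)
  case less
  note L = less.prems(1) and LD = less.prems(2) and steps = less.prems(3)
  have fD: "finite D" using finite_subset_carrier[OF normal_subset[OF D]] .
  show ?case
  proof (cases "L = D")
    case True
    then show ?thesis using L p'_index_refl[OF p, of D] by (intro exI[of _ D]) simp
  next
    case False
    then obtain H where H: "chief_step G L H" "H \<subseteq> D" using chief_step_above[OF L D] LD by blast
    have nH: "H \<lhd> G" and LH: "L \<subset> H" using H(1) by (auto simp: chief_step_def)
    have "card L < card H" using LH finite_subset_carrier[OF normal_subset[OF nH]] by (rule psubset_card_mono[rotated])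
    moreover have "card H \<le> card D" using H(2) fD by (rule card_mono[rotated])
    ultimately have lt: "card D - card H < card D - card L" by simp
    have "\<exists>M. M \<lhd> G \<and> H \<subseteq> M \<and> M \<subseteq> D \<and> p'_index p H M \<and> p_index p M D"
      by (rule less.hyps[OF lt nH H(2)]) (use steps LH in blast)
    then obtain M where M: "M \<lhd> G" "H \<subseteq> M" "M \<subseteq> D" "p'_index p H M" "p_index p M D" by blast
    have "p'_index p L H \<or> p_index p L H \<and> D \<subseteq> section_centralizer G H L" using steps[OF H(1) _ H(2)] by blast
    then show ?thesis
    proof
      assume "p'_index p L H"
      then have "p'_index p L M" using p'_index_trans[OF p _ M(4)] by blast
      then show ?thesis using M LH by blast
    next
      assume c: "p_index p L H \<and> D \<subseteq> section_centralizer G H L"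
      have central: "commute_mod G L x y" if "x \<in> M" "y \<in> H" for x y
        using c that M(3) by (auto simp: section_centralizer_def)
      obtain C where C: "C \<lhd> G" "L \<subseteq> C" "C \<subseteq> M" "p'_index p L C" "p_index p C M"
        using normal_central_complement[OF p L nH M(1) _ M(2) _ M(4) central] LH c by blast
      then show ?thesis using p_index_trans[OF C(5) M(5)] M(3) by blast
    qed
  qed
qed

lemma p_index_power_mem:
  assumes L: "L \<lhd> G" and P: "P \<lhd> G" and LP: "L \<subseteq> P" and pi: "p_index p L P"
  obtains j where "\<And>u. u \<in> P \<Longrightarrow> u [^] (p ^ j) \<in> L"
proof -
  interpret f: finite_group_hom G "G Mod L" "(#>) L" by (rule Mod_hom[OF L])
  interpret B: finite_group "G Mod L" by (rule finite_group_Mod[OF L])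
  note sub = normal_imp_subgroup
  let ?P = "(#>) L ` P"
  have sP: "subgroup ?P (G Mod L)" by (rule f.subgroup_img_is_subgroup[OF sub[OF P]])
  interpret P: group "(G Mod L)\<lparr>carrier := ?P\<rparr>" by (rule f.H.subgroup_imp_group[OF sP])
  obtain k where k: "card ?P = p ^ k" using p_index_Mod[OF L sub[OF P] LP pi] by blast
  have "u [^] (p ^ k) \<in> L" if u: "u \<in> P" for u
  proof -
    have uG: "u \<in> carrier G" using u normal_subset[OF P] by blast
    have "(L #> u) [^]\<^bsub>(G Mod L)\<lparr>carrier := ?P\<rparr>\<^esub> order ((G Mod L)\<lparr>carrier := ?P\<rparr>) = \<one>\<^bsub>(G Mod L)\<lparr>carrier := ?P\<rparr>\<^esub>"
      by (rule P.pow_order_eq_1) (use u in simp)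
    then have "(L #> u) [^]\<^bsub>G Mod L\<^esub> (p ^ k) = \<one>\<^bsub>G Mod L\<^esub>"
      using k by (simp add: order_def nat_pow_def)
    then have "L #> (u [^] (p ^ k)) = \<one>\<^bsub>G Mod L\<^esub>" using f.hom_nat_pow[OF uG] by metis
    then show ?thesis using Mod_eq_one_iff[OF L] uG nat_pow_closed by blast
  qed
  then show ?thesis using that by blast
qed

text \<open>
  Modulo \<open>L\<close>, conjugation by \<open>x\<close> multiplies \<open>y\<close> by the commutator \<open>d\<close>, and \<open>x\<close> commutes with \<open>d\<close>. So \<open>x\<^sup>m\<close>
  multiplies \<open>y\<close> by \<open>d\<^sup>m\<close>, which is therefore trivial, while \<open>d\<close> is a \<open>p\<close>-element.
\<close>

lemma coprime_stabilizes_chain: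
  fixes m :: nat
  assumes p: "Factorial_Ring.prime p" and L: "L \<lhd> G" and P: "P \<lhd> G" and LP: "L \<subseteq> P" and pi: "p_index p L P"
    and x: "x \<in> carrier G" "x [^] m = \<one>" and cop: "coprime m p"
    and y: "y \<in> P" and c: "x \<otimes> y \<otimes> inv x \<otimes> inv y \<in> P"
    and xc: "commute_mod G L x (x \<otimes> y \<otimes> inv x \<otimes> inv y)"
  shows "commute_mod G L x y"
proof -
  interpret f: finite_group_hom G "G Mod L" "(#>) L" by (rule Mod_hom[OF L])
  interpret B: finite_group "G Mod L" by (rule finite_group_Mod[OF L])
  note kL = Mod_hom(2)[OF L]
  define c where "c = x \<otimes> y \<otimes> inv x \<otimes> inv y"
  have yG: "y \<in> carrier G" and cG: "c \<in> carrier G" using y assms(10) normal_subset[OF P] by (auto simp: c_def)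
  define a b d where "a = L #> x" and "b = L #> y" and "d = L #> c"
  have abd: "a \<in> carrier (G Mod L)" "b \<in> carrier (G Mod L)" "d \<in> carrier (G Mod L)"
    using x(1) yG cG by (simp_all add: a_def b_def d_def)
  let ?m = "monoid.mult (G Mod L)"
  have "c \<otimes> (y \<otimes> x) = x \<otimes> y"
  proof -
    have "inv y \<otimes> (y \<otimes> x) = x" using x(1) yG by (simp add: m_assoc[symmetric])
    then show ?thesis unfolding c_def using x(1) yG by (simp add: m_assoc)
  qed
  then have ab: "a \<otimes>\<^bsub>G Mod L\<^esub> b = d \<otimes>\<^bsub>G Mod L\<^esub> (b \<otimes>\<^bsub>G Mod L\<^esub> a)"
    unfolding a_def b_def d_def using x(1) yG cG
    by (metis f.hom_mult m_closed)
  have ad: "a \<otimes>\<^bsub>G Mod L\<^esub> d = d \<otimes>\<^bsub>G Mod L\<^esub> a"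
    using xc commute_mod_Mod[OF L x(1) cG] by (simp add: a_def d_def c_def)
  have am: "a [^]\<^bsub>G Mod L\<^esub> m = \<one>\<^bsub>G Mod L\<^esub>"
    using f.hom_nat_pow[OF x(1), of m] x(2) f.hom_one by (simp add: a_def)
  then have dm: "d [^]\<^bsub>G Mod L\<^esub> m = \<one>\<^bsub>G Mod L\<^esub>"
    using B.power_past[OF abd ad[symmetric] ab, of m] abd f.H.nat_pow_closed[OF abd(3), of m] by (simp del: mult_FactGroup one_FactGroup)
  obtain j where j: "\<And>u. u \<in> P \<Longrightarrow> u [^] (p ^ j) \<in> L"
    using p_index_power_mem[OF L P LP pi] by blast
  have "d [^]\<^bsub>G Mod L\<^esub> (p ^ j) = \<one>\<^bsub>G Mod L\<^esub>"
    using f.hom_nat_pow[OF cG, of "p ^ j"] j[of c] assms(10) kL cG by (auto simp: d_def c_def kernel_def simp del: one_FactGroup)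
  moreover have "coprime m (p ^ j)" using cop by simp
  ultimately have "d = \<one>\<^bsub>G Mod L\<^esub>" using B.coprime_exponents_one[OF abd(3) dm] by blast
  then have "a \<otimes>\<^bsub>G Mod L\<^esub> b = b \<otimes>\<^bsub>G Mod L\<^esub> a" using ab abd by (simp del: mult_FactGroup one_FactGroup)
  then show ?thesis using commute_mod_Mod[OF L x(1) yG] by (simp add: a_def b_def)
qed

end

lemma prime_power_if_no_other_prime:
  assumes p: "Factorial_Ring.prime (p::nat)" and k: "k > 0"
    and "\<And>q. Factorial_Ring.prime q \<Longrightarrow> q dvd k \<Longrightarrow> q = p"
  shows "\<exists>j. k = p ^ j"
proof -
  obtain m where m: "k = p ^ multiplicity p k * m" "\<not> p dvd m"
    using multiplicity_decompose'[of k p] k not_prime_unit[of p] p by (metis less_not_refl)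
  have "m = 1"
  proof (rule ccontr)
    assume "m \<noteq> 1"
    then obtain q where q: "Factorial_Ring.prime q" "q dvd m" using prime_factor_nat by blast
    then have "q dvd k" using m(1) by (metis dvd_mult)
    then show False using assms(3)[OF q(1)] q(2) m(2) by blast
  qed
  then show ?thesis using m(1) by auto
qed

context finite_group
begin

text \<open>
  For each prime \<open>q \<noteq> p\<close> the subgroup \<open>L\<close> contains all \<open>q\<close>-elements of \<open>R\<close>, so \<open>q\<close> does not divide the
  index.
\<close>

lemma p_index_if_contains_p'_elements:
  assumes p: "Factorial_Ring.prime p" and L: "subgroup L G" and R: "subgroup R G" and LR: "L \<subseteq> R"
    and c: "\<And>x m. x \<in> R \<Longrightarrow> x [^] (m::nat) = \<one> \<Longrightarrow> coprime m p \<Longrightarrow> x \<in> L"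
  shows "p_index p L R"
proof -
  interpret R: finite_group "G\<lparr>carrier := R\<rparr>" by (rule finite_group_subgroup[OF R])
  obtain k where k: "card R = k * card L" using card_subgroup_dvd[OF L R LR] unfolding dvd_def by (metis mult.commute)
  have pos: "card L > 0" "card R > 0" using card_subgroup_pos L R by auto
  have "q = p" if q: "Factorial_Ring.prime q" "q dvd k" for q
  proof (rule ccontr)
    assume "q \<noteq> p"
    then have cop: "coprime (q ^ j) p" for j using p q(1) by (simp add: primes_coprime)
    have "p'_index q L (carrier (G\<lparr>carrier := R\<rparr>))"
    proof (rule R.p'_index_if_contains_p_elements[OF q(1)])
      show "subgroup L (G\<lparr>carrier := R\<rparr>)" by (rule subgroup_incl[OF L R LR])
      fix x j assume "x \<in> carrier (G\<lparr>carrier := R\<rparr>)" "x [^]\<^bsub>G\<lparr>carrier := R\<rparr>\<^esub> (q ^ j) = \<one>\<^bsub>G\<lparr>carrier := R\<rparr>\<^esub>"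
      then show "x \<in> L" using c[OF _ _ cop[of j]] by (simp add: nat_pow_def)
    qed
    then obtain k' where "\<not> q dvd k'" "card R = k' * card L" by (auto simp: p'_index_def)
    then show False using k q(2) pos by simp
  qed
  then have "\<exists>j. k = p ^ j" using prime_power_if_no_other_prime[OF p] k pos by (metis gr0I mult_0)
  then show ?thesis using k by (auto simp: p_index_def)
qed

lemma p'_subgroup_exponent:
  assumes pi: "p'_index p {\<one>} L" and L: "subgroup L G" and u: "u \<in> L"
  shows "u [^] card L = \<one>" "\<not> p dvd card L"
proof -
  interpret L: group "G\<lparr>carrier := L\<rparr>" by (rule subgroup_imp_group[OF L])
  have "u [^]\<^bsub>G\<lparr>carrier := L\<rparr>\<^esub> order (G\<lparr>carrier := L\<rparr>) = \<one>\<^bsub>G\<lparr>carrier := L\<rparr>\<^esub>"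
    by (rule L.pow_order_eq_1) (use u in simp)
  then show "u [^] card L = \<one>" by (simp add: order_def nat_pow_def)
  show "\<not> p dvd card L" using pi by (auto simp: p'_index_def)
qed

text \<open>
  Climb a chief series of \<open>G\<close> below \<open>U\<close>. On a \<open>p\<close>-step \<open>x\<close> acts trivially by assumption and
  \<open>coprime_stabilizes_chain\<close> applies; a \<open>p'\<close>-step is covered by \<open>L\<close>, since \<open>P/L\<close> is a \<open>p\<close>-group.
\<close>

lemma coprime_element_centralizes_below:
  fixes m :: nat
  assumes p: "Factorial_Ring.prime p" and ps: "p_solvable p G"
    and L: "L \<lhd> G" and P: "P \<lhd> G" and LP: "L \<subseteq> P" and pi: "p_index p L P"
    and x: "x \<in> carrier G" "x [^] m = \<one>" and cop: "coprime m p"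
    and cent: "\<And>W V. chief_step G W V \<Longrightarrow> V \<subseteq> U \<Longrightarrow> p_index p W V \<Longrightarrow> x \<in> section_centralizer G V W"
    and U: "U \<lhd> G" "U \<subseteq> P" and y: "y \<in> U"
  shows "commute_mod G L x y"
proof -
  note sub = normal_imp_subgroup
  have "\<forall>y\<in>V. commute_mod G L x y" if "V \<lhd> G" "V \<subseteq> U" for V
    using that
  proof (induction "card V" arbitrary: V rule: less_induct)
    case less
    note V = less.prems(1) and VU = less.prems(2)
    show ?case
    proof (cases "V = {\<one>}")
      case True
      then show ?thesis using x(1) by (simp add: commute_mod_def)
    next
      case False
      then have "{\<one>} \<subset> V" using subgroup.one_closed[OF sub[OF V]] by blast
      then obtain W where W: "chief_step G W V" using chief_step_below[OF one_is_normal V] by blast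
      have nW: "W \<lhd> G" and WV: "W \<subset> V" using W by (auto simp: chief_step_def)
      have "card W < card V" using WV finite_subset_carrier[OF normal_subset[OF V]] by (rule psubset_card_mono[rotated])
      then have IH: "\<forall>y\<in>W. commute_mod G L x y" using less.hyps nW WV VU by blast
      have "p_index p W V \<or> p'_index p W V" using ps W p_solvable_iff by blast
      then show ?thesis
      proof
        assume pWV: "p_index p W V"
        show ?thesis
        proof
          fix y assume y: "y \<in> V"
          have yG: "y \<in> carrier G" using y normal_subset[OF V] by blast
          have "commute_mod G W x y" using cent[OF W VU pWV] y by (simp add: section_centralizer_def)
          then have c: "x \<otimes> y \<otimes> inv x \<otimes> inv y \<in> W" using commute_mod_iff[OF nW x(1) yG] by simp
          show "commute_mod G L x y"
          proof (rule coprime_stabilizes_chain[OF p L P LP pi x cop])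
            show "y \<in> P" using y VU U(2) by blast
            show "x \<otimes> y \<otimes> inv x \<otimes> inv y \<in> P" using c WV VU U(2) by blast
            show "commute_mod G L x (x \<otimes> y \<otimes> inv x \<otimes> inv y)" using IH c by blast
          qed
        qed
      next
        assume p'WV: "p'_index p W V"
        note PV = product_subgroup[OF L sub[OF V]]
        have "V <#> L \<subseteq> P" using PV(4)[OF sub[OF P]] VU U(2) LP by blast
        then have "p_index p L (V <#> L)" using index_between(1)[OF p sub[OF L] PV(1) sub[OF P] PV(3) _ pi] by blast
        then have VL: "p_index p (V \<inter> L) V" using index_product(1)[OF L sub[OF V]] by blast
        have "\<not> V \<inter> L \<subseteq> W"
        proof
          assume "V \<inter> L \<subseteq> W"
          then have "p_index p W V"
            using index_between(2)[OF p sub[OF normal_subgroup_intersect[OF V L]] sub[OF nW] sub[OF V] _ _ VL] WV by blast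
          then have "card V = card W" using p_and_p'_index[OF p _ p'WV card_normal_pos[OF nW]] by blast
          then show False using \<open>card W < card V\<close> by simp
        qed
        then have VWL: "V \<subseteq> W <#> L" by (rule chief_step_dichotomy[OF W L])
        show ?thesis
        proof
          fix y assume "y \<in> V"
          then obtain w l where wl: "w \<in> W" "l \<in> L" "y = w \<otimes> l" using VWL unfolding set_mult_def by blast
          have "w \<in> carrier G" "l \<in> carrier G" using wl normal_subset[OF nW] normal_subset[OF L] by auto
          then show "commute_mod G L x y"
            unfolding wl(3) using commute_mod_mult[OF L x(1)] IH wl(1) commute_mod_in[OF L x(1) wl(2)] by blast
        qed
      qed
    qed
  qed
  then show ?thesis using U(1) y by blast
qed

text \<open>
  Otherwise a chief factor \<open>M/(C \<inter> P)\<close> with \<open>M\<close> inside the centralizer \<open>C\<close> enlarges \<open>P\<close> if it is a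
  \<open>p\<close>-group. If it is a \<open>p'\<close>-group, \<open>(C \<inter> P)/L\<close> is a central \<open>p\<close>-subgroup of \<open>M/L\<close> and has a normal
  complement there, which enlarges \<open>L\<close>.
\<close>

lemma hall_higman:
  assumes p: "Factorial_Ring.prime p" and ps: "p_solvable p G"
    and R: "R \<lhd> G" and L: "L \<lhd> G" and P: "P \<lhd> G" and LP: "L \<subseteq> P" and PR: "P \<subseteq> R"
    and L1: "p'_index p {\<one>} L" and LPi: "p_index p L P"
    and maxL: "\<And>L'. L' \<lhd> G \<Longrightarrow> L' \<subseteq> R \<Longrightarrow> p'_index p {\<one>} L' \<Longrightarrow> card L' \<le> card L"
    and maxP: "\<And>P'. P' \<lhd> G \<Longrightarrow> L \<subseteq> P' \<Longrightarrow> P' \<subseteq> R \<Longrightarrow> p_index p L P' \<Longrightarrow> card P' \<le> card P"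
  shows "R \<inter> section_centralizer G P L \<subseteq> P"
proof (rule ccontr)
  note sub = normal_imp_subgroup
  let ?C = "R \<inter> section_centralizer G P L"
  assume "\<not> ?C \<subseteq> P"
  then have lt: "?C \<inter> P \<subset> ?C" by blast
  have C: "?C \<lhd> G" by (rule normal_subgroup_intersect[OF R section_centralizer_normal[OF L P]])
  have D: "?C \<inter> P \<lhd> G" by (rule normal_subgroup_intersect[OF C P])
  obtain M where M: "chief_step G (?C \<inter> P) M" "M \<subseteq> ?C" using chief_step_above[OF D C lt] by blast
  have nM: "M \<lhd> G" and DM: "?C \<inter> P \<subset> M" using M(1) by (auto simp: chief_step_def)
  have Pc: "y \<in> carrier G" if "y \<in> P" for y using that normal_subset[OF P] by blast
  have LC: "L \<subseteq> ?C"
  proof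
    fix l assume l: "l \<in> L"
    have "commute_mod G L l y" if "y \<in> P" for y
      using commute_mod_in[OF L Pc[OF that] l] commute_mod_sym[of L l y] by blast
    then show "l \<in> ?C" using l LP PR normal_subset[OF L] by (auto simp: section_centralizer_def)
  qed
  have MP: "M \<inter> P = ?C \<inter> P" using M(2) DM by blast
  have "p_index p (?C \<inter> P) M \<or> p'_index p (?C \<inter> P) M" using ps M(1) p_solvable_iff by blast
  then show False
  proof
    assume "p_index p (?C \<inter> P) M"
    then have "p_index p P (M <#> P)" using index_product(1)[OF P sub[OF nM]] MP by simp
    then have pi: "p_index p L (M <#> P)" by (rule p_index_trans[OF LPi])
    note PP = product_subgroup[OF P sub[OF nM]]
    have "M <#> P \<subseteq> R" using PP(4)[OF sub[OF R]] M(2) PR by blast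
    then have "card (M <#> P) \<le> card P" using maxP[OF product_normal[OF P nM]] LP PP(3) pi by blast
    then have "P = M <#> P"
      using PP(3) finite_subset_carrier[OF subgroup.subset[OF PP(1)]] by (intro card_seteq) auto
    then have "M \<subseteq> P" using PP(2) by blast
    then show False using MP DM by blast
  next
    assume p'M: "p'_index p (?C \<inter> P) M"
    have LD: "L \<subseteq> ?C \<inter> P" using LC LP by blast
    have pD: "p_index p L (?C \<inter> P)" using index_between(1)[OF p sub[OF L] sub[OF D] sub[OF P] LD _ LPi] by blast
    have DM': "?C \<inter> P \<subseteq> M" using DM by blast
    have central: "commute_mod G L x y" if "x \<in> M" "y \<in> ?C \<inter> P" for x y
      using that M(2) by (auto simp: section_centralizer_def)
    obtain A where A: "A \<lhd> G" "L \<subseteq> A" "A \<subseteq> M" "A <#> (?C \<inter> P) = M" "p'_index p L A"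
      using normal_central_complement[OF p L D nM LD DM' pD p'M central] by blast
    have "card A \<le> card L" using maxL[OF A(1) _ p'_index_trans[OF p L1 A(5)]] A(3) M(2) by blast
    then have "L = A" using A(2) finite_subset_carrier[OF normal_subset[OF A(1)]] by (intro card_seteq) auto
    then have "A \<subseteq> ?C \<inter> P" using LD by blast
    then have "A <#> (?C \<inter> P) \<subseteq> ?C \<inter> P" by (rule product_subgroup(4)[OF D sub[OF A(1)] sub[OF D] _ subset_refl])
    then show False unfolding A(4) using DM by blast
  qed
qed

text \<open>
  A \<open>p'\<close>-element \<open>x\<close> of \<open>R\<close> centralizes \<open>K \<inter> P\<close> modulo \<open>L\<close> by \<open>coprime_element_centralizes_below\<close>, and
  then all of \<open>P/L\<close> by \<open>coprime_section_trivial\<close>, since the elements of \<open>P/L\<close> of order dividing \<open>n\<close> lift to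
  elements of \<open>K\<close>. By \<open>hall_higman\<close> it lies in \<open>P\<close>, and being a \<open>p'\<close>-element it lies in \<open>L\<close>.
\<close>

theorem p_nilpotent_if_centralizes_p_elements:
  fixes p :: nat
  defines "n \<equiv> if p = 2 then 4 else p"
  assumes p: "Factorial_Ring.prime p" and ps: "p_solvable p G" and R: "R \<lhd> G" and K: "K \<lhd> G"
    and cent: "\<And>L H. chief_step G L H \<Longrightarrow> H \<subseteq> K \<Longrightarrow> p_index p L H \<Longrightarrow> R \<subseteq> section_centralizer G H L"
    and elems: "\<And>x. x \<in> carrier G \<Longrightarrow> x [^] n = \<one> \<Longrightarrow> x \<in> K"
  shows "\<exists>M. M \<lhd> G \<and> M \<subseteq> R \<and> p'_index p {\<one>} M \<and> p_index p M R"
proof -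
  note sub = normal_imp_subgroup
  have fR: "finite R" by (rule finite_subset_carrier[OF normal_subset[OF R]])
  have Rc: "x \<in> carrier G" if "x \<in> R" for x using that normal_subset[OF R] by blast
  let ?P1 = "\<lambda>L. L \<lhd> G \<and> L \<subseteq> R \<and> p'_index p {\<one>} L"
  have "?P1 {\<one>}" using one_is_normal subgroup.one_closed[OF sub[OF R]] p'_index_refl[OF p] by auto
  moreover have "\<forall>L. ?P1 L \<longrightarrow> card L < Suc (card R)"
    using fR by (auto intro!: le_imp_less_Suc card_mono)
  ultimately obtain L where L: "L \<lhd> G" "L \<subseteq> R" "p'_index p {\<one>} L" and maxL: "\<And>L'. ?P1 L' \<Longrightarrow> card L' \<le> card L"
    using ex_has_greatest_nat[of ?P1 "{\<one>}" card "Suc (card R)"] by blast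
  let ?P2 = "\<lambda>P. P \<lhd> G \<and> L \<subseteq> P \<and> P \<subseteq> R \<and> p_index p L P"
  have "?P2 L" using L by simp
  moreover have "\<forall>P. ?P2 P \<longrightarrow> card P < Suc (card R)"
    using fR by (auto intro!: le_imp_less_Suc card_mono)
  ultimately obtain P where P: "P \<lhd> G" "L \<subseteq> P" "P \<subseteq> R" "p_index p L P" and maxP: "\<And>P'. ?P2 P' \<Longrightarrow> card P' \<le> card P"
    using ex_has_greatest_nat[of ?P2 L card "Suc (card R)"] by blast
  have HH: "R \<inter> section_centralizer G P L \<subseteq> P"
    by (rule hall_higman[OF p ps R L(1) P(1,2,3) L(3) P(4)]) (use maxL maxP in blast)+
  have Pc: "y \<in> carrier G" if "y \<in> P" for y using that normal_subset[OF P(1)] by blast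
  have "x \<in> L" if x: "x \<in> R" "x [^] m = \<one>" "coprime m p" for x and m :: nat
  proof -
    have xG: "x \<in> carrier G" by (rule Rc[OF x(1)])
    have KP: "commute_mod G L x y" if y: "y \<in> K \<inter> P" for y
    proof (rule coprime_element_centralizes_below[OF p ps L(1) P(1,2,4) xG x(2,3) _ normal_subgroup_intersect[OF K P(1)] _ y])
      fix W V assume "chief_step G W V" "V \<subseteq> K \<inter> P" "p_index p W V"
      then show "x \<in> section_centralizer G V W" using cent x(1) by blast
    qed blast
    have fixp: "commute_mod G L x y" if y: "y \<in> P" "y [^] n \<in> L" for y
    proof -
      have yG: "y \<in> carrier G" by (rule Pc[OF y(1)])
      note o = p'_subgroup_exponent[OF L(3) sub[OF L(1)]]
      have "\<not> p dvd card L" by (rule o(2)[OF y(2)])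
      then have "coprime (card L) p" using p prime_imp_coprime coprime_commute by blast
      then have "coprime (card L) n" unfolding n_def using coprime_power_right_iff[of "card L" 2 2] by auto
      then have "\<exists>k j. card L * k = n * j + 1"
      proof -
        assume c: "coprime (card L) n"
        have "n > 0" using p by (auto simp: n_def prime_gt_0_nat)
        show ?thesis
        proof (cases "n = 1")
          case True
          have "card L \<ge> 1" using card_normal_pos[OF L(1)] by linarith
          then have "card L * 1 = n * (card L - 1) + 1" using True by simp
          then show ?thesis by blast
        next
          case False
          then show ?thesis using coprime_bezout_strong[OF c] by blast
        qed
      qed
      \<comment> \<open>The exponent \<open>card L * k\<close> is congruent to \<open>1\<close> modulo \<open>n\<close>, so this power of \<open>y\<close> stays in the
        coset of \<open>y\<close> modulo \<open>L\<close>; and it has order dividing \<open>n\<close>.\<close>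
      then obtain k j where kj: "card L * k = n * j + 1" by blast
      define y' where "y' = y [^] (card L * k)"
      have y'G: "y' \<in> carrier G" using yG by (simp add: y'_def)
      have "y' [^] n = ((y [^] n) [^] card L) [^] k"
        using yG by (simp add: y'_def nat_pow_pow ac_simps)
      also have "\<dots> = \<one>" using o(1)[OF y(2)] by simp
      finally have "y' \<in> K" by (rule elems[OF y'G])
      have eq: "y' = (y [^] n) [^] j \<otimes> y"
        using yG by (simp add: y'_def kj nat_pow_pow)
      have l: "(y [^] n) [^] j \<in> L"
        using subgroup_int_pow_closed[OF sub[OF L(1)] y(2), of "int j"] by (simp add: int_pow_int)
      have "(y [^] n) [^] j \<in> P" using l P(2) by blast
      then have "y' \<in> P" unfolding eq by (rule subgroup.m_closed[OF sub[OF P(1)] _ y(1)])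
      then have c': "commute_mod G L x y'" using KP \<open>y' \<in> K\<close> by blast
      let ?l = "inv ((y [^] n) [^] j)"
      have il: "?l \<in> L" by (rule subgroup.m_inv_closed[OF sub[OF L(1)] l])
      have "commute_mod G L x (?l \<otimes> y')"
        using commute_mod_mult[OF L(1) xG _ y'G commute_mod_in[OF L(1) xG il] c'] yG by simp
      moreover have "?l \<otimes> y' = y" unfolding eq using yG by (simp add: m_assoc[symmetric])
      ultimately show ?thesis by simp
    qed
    have "commute_mod G L x y" if y: "y \<in> P" for y
      using coprime_section_trivial[OF p L(1) P(1,2,4) xG x(2,3) _ y] fixp unfolding n_def by blast
    then have "x \<in> R \<inter> section_centralizer G P L" using x(1) xG by (simp add: section_centralizer_def)
    then have xP: "x \<in> P" using HH by blast
    interpret f: finite_group_hom G "G Mod L" "(#>) L" by (rule Mod_hom[OF L(1)])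
    interpret B: finite_group "G Mod L" by (rule finite_group_Mod[OF L(1)])
    obtain j where "\<And>u. u \<in> P \<Longrightarrow> u [^] (p ^ j) \<in> L" using p_index_power_mem[OF L(1) P(1,2,4)] by blast
    then have j: "x [^] (p ^ j) \<in> L" using xP by blast
    note in_ker = Mod_eq_one_iff[OF L(1)]
    have "(L #> x) [^]\<^bsub>G Mod L\<^esub> m = \<one>\<^bsub>G Mod L\<^esub>"
      using f.hom_nat_pow[OF xG, of m] x(2) f.hom_one by simp
    moreover have "(L #> x) [^]\<^bsub>G Mod L\<^esub> (p ^ j) = \<one>\<^bsub>G Mod L\<^esub>"
      using f.hom_nat_pow[OF xG, of "p ^ j"] j in_ker[of "x [^] (p ^ j)"] xG by (simp del: one_FactGroup)
    ultimately have "L #> x = \<one>\<^bsub>G Mod L\<^esub>"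
      using B.coprime_exponents_one[OF f.hom_closed[OF xG], of m "p ^ j"] x(3) by (simp del: one_FactGroup)
    then show "x \<in> L" using in_ker[OF xG] by blast
  qed
  then have "p_index p L R" by (rule p_index_if_contains_p'_elements[OF p sub[OF L(1)] sub[OF R] L(2)])
  then show ?thesis using L by blast
qed

text \<open>
  A \<open>p\<close>-element has a nontrivial fixed point on a chief factor of order \<open>p\<close>, and one nontrivial fixed point
  generates it. So \<open>D\<close> contains all \<open>p\<close>-elements.
\<close>

lemma p_chief_centralizers_p'_index:
  assumes p: "Factorial_Ring.prime p" and R: "R \<lhd> G"
  defines "D \<equiv> {d \<in> carrier G. \<forall>K H. chief_step G K H \<longrightarrow> R \<subseteq> K \<longrightarrow> card H = p * card K \<longrightarrow>
      d \<in> section_centralizer G H K}"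
  shows "D \<lhd> G" "R \<subseteq> D" "p'_index p D (carrier G)"
proof -
  note sub = normal_imp_subgroup
  have n: "section_centralizer G H K \<lhd> G" if "chief_step G K H" for K H
    using section_centralizer_normal that by (simp add: chief_step_def)
  show D: "D \<lhd> G"
    unfolding normal_inv_iff
  proof (intro conjI ballI)
    show "subgroup D G"
    proof (rule subgroupI)
      have "\<one> \<in> D" using subgroup.one_closed[OF sub[OF n]] by (simp add: D_def)
      then show "D \<noteq> {}" by blast
      show "inv a \<in> D" if "a \<in> D" for a
        using that subgroup.m_inv_closed[OF sub[OF n]] by (simp add: D_def)
      show "a \<otimes> b \<in> D" if "a \<in> D" "b \<in> D" for a b
        using that subgroup.m_closed[OF sub[OF n]] by (simp add: D_def)
    qed (auto simp: D_def)
    show "x \<otimes> a \<otimes> inv x \<in> D" if "x \<in> carrier G" "a \<in> D" for x a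
      using that normal_conj[OF n] by (simp add: D_def)
  qed
  show "R \<subseteq> D"
  proof
    fix r assume r: "r \<in> R"
    then have rG: "r \<in> carrier G" using normal_subset[OF R] by blast
    have "r \<in> section_centralizer G H K" if KH: "chief_step G K H" "R \<subseteq> K" for K H
    proof -
      have nK: "K \<lhd> G" and nH: "H \<lhd> G" using KH(1) by (auto simp: chief_step_def)
      have "commute_mod G K r h" if "h \<in> H" for h
      proof -
        have "h \<in> carrier G" using that normal_subset[OF nH] by blast
        moreover have "r \<in> K" using r KH(2) by blast
        ultimately show ?thesis using commute_mod_in[OF nK] commute_mod_sym[of K r h] by blast
      qed
      then show ?thesis using rG by (simp add: section_centralizer_def)
    qed
    then show "r \<in> D" using rG by (simp add: D_def)
  qed
  show "p'_index p D (carrier G)"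
  proof (rule p'_index_if_contains_p_elements[OF p sub[OF D]])
    fix x j assume x: "x \<in> carrier G" "x [^] (p ^ j) = \<one>"
    let ?Y = "generate G {x}"
    have Y: "subgroup ?Y G" using generate_is_subgroup[of "{x}"] x(1) by simp
    have "ord x dvd p ^ j" using pow_eq_id[OF x(1)] x(2) by blast
    then obtain i where "ord x = p ^ i" using divides_primepow_nat[OF p] by blast
    then have Yp: "p_index p {\<one>} ?Y" using generate_pow_card[OF x(1)] by (auto simp: p_index_def)
    have one_sub: "subgroup {\<one>} G" by (rule sub[OF one_is_normal])
    have xY: "x \<in> ?Y" by (rule generate.incl) simp
    have "x \<in> section_centralizer G H K" if KH: "chief_step G K H" "card H = p * card K" for K H
    proof -
      have nK: "K \<lhd> G" and nH: "H \<lhd> G" and lt: "K \<subset> H" using KH(1) by (auto simp: chief_step_def)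
      have Hc: "h \<in> carrier G" if "h \<in> H" for h using that normal_subset[OF nH] by blast
      have pi: "p_index p K H" using KH(2) unfolding p_index_def by (intro exI[of _ 1]) simp
      have "\<exists>h\<in>H. h \<notin> K \<and> (\<forall>y\<in>?Y. commute_mod G K y h)"
      proof (rule section_fixed_point[OF p nK nH lt pi Y one_sub _ Yp])
        show "{\<one>} \<subseteq> ?Y" using subgroup.one_closed[OF Y] by simp
        fix d h assume "d \<in> {\<one>}" "h \<in> H"
        then show "commute_mod G K d h" using Hc by (simp add: commute_mod_def)
      qed
      then obtain h where h: "h \<in> H" "h \<notin> K" "commute_mod G K x h" using xY by blast
      \<comment> \<open>The fixed points form a subgroup strictly above \<open>K\<close>, hence \<open>H\<close>, as the index is prime.\<close>
      let ?S = "{y \<in> H. commute_mod G K x y}"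
      have S: "subgroup ?S G"
      proof (rule subgroupI)
        show "?S \<subseteq> carrier G" using Hc by blast
        show "?S \<noteq> {}" using h by blast
        show "inv a \<in> ?S" if "a \<in> ?S" for a
          using that commute_mod_inv[OF nK x(1) Hc] subgroup.m_inv_closed[OF sub[OF nH]] by simp
        show "a \<otimes> b \<in> ?S" if "a \<in> ?S" "b \<in> ?S" for a b
          using that commute_mod_mult[OF nK x(1) Hc Hc] subgroup.m_closed[OF sub[OF nH]] by simp
      qed
      have KS: "K \<subseteq> ?S" using lt commute_mod_in[OF nK x(1)] by blast
      obtain u where u: "card ?S = u * card K"
        using card_subgroup_dvd[OF sub[OF nK] S KS] unfolding dvd_def by (metis mult.commute)
      obtain v where v: "card H = v * card ?S"
        using card_subgroup_dvd[OF S sub[OF nH]] unfolding dvd_def by (metis (no_types, lifting) mem_Collect_eq mult.commute subsetI)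
      have pos: "card K > 0" by (rule card_normal_pos[OF nK])
      have "(v * u) * card K = p * card K" using u v KH(2) by (simp only: mult.assoc)
      then have vu: "v * u = p" using pos by simp
      have fS: "finite ?S" by (rule finite_subset_carrier[OF subgroup.subset[OF S]])
      have "u \<noteq> 1"
      proof
        assume "u = 1"
        then have "K = ?S" using KS fS u by (intro card_seteq) auto
        then show False using h by blast
      qed
      then have "u = p" using vu p by (metis dvd_triv_right prime_nat_iff)
      then have "card ?S = card H" using u KH(2) by simp
      then have "?S = H" using finite_subset_carrier[OF normal_subset[OF nH]] by (intro card_seteq) auto
      then show ?thesis using x(1) by (auto simp: section_centralizer_def)
    qed
    then show "x \<in> D" using x(1) by (simp add: D_def)
  qed
qed

section \<open>The p-Fitting series\<close>

lemma generate_Union_normal: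
  assumes "\<And>N. N \<in> \<N> \<Longrightarrow> N \<lhd> G"
  shows "generate G (\<Union>\<N>) \<lhd> G"
proof (rule normal_generateI)
  show "\<Union>\<N> \<subseteq> carrier G" using assms normal_subset by blast
  show "g \<otimes> h \<otimes> inv g \<in> \<Union>\<N>" if "h \<in> \<Union>\<N>" "g \<in> carrier G" for h g
    using that normal_conj assms by blast
qed

lemma O_p_normal: "O_p p G \<lhd> G" and O_p'_normal: "O_p' p G \<lhd> G"
  unfolding O_p_def O_p'_def by (rule generate_Union_normal, simp)+

lemma F_p_normal: "F_p p G \<lhd> G"
  unfolding F_p_def
  by (rule quotient_preimage_normal(1)[OF O_p'_normal finite_group.O_p_normal[OF finite_group_Mod[OF O_p'_normal]]])

lemma Mod_image_eq_one:
  assumes N: "N \<lhd> G" and A: "subgroup A G" "A \<subseteq> N"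
  shows "(#>) N ` A = {\<one>\<^bsub>G Mod N\<^esub>}"
proof -
  have "N #> a = \<one>\<^bsub>G Mod N\<^esub>" if "a \<in> A" for a
    using Mod_eq_one_iff[OF N] A(2) normal_subset[OF N] that by blast
  moreover have "\<one> \<in> A" by (rule subgroup.one_closed[OF A(1)])
  ultimately show ?thesis by (auto simp del: one_FactGroup)
qed

text \<open>
  Since \<open>M\<close> lies in \<open>O_p'\<close>, the image of \<open>B\<close> modulo \<open>O_p'\<close> is a quotient of the \<open>p\<close>-group \<open>B/M\<close>.
\<close>

lemma F_p_contains:
  assumes p: "Factorial_Ring.prime p" and M: "M \<lhd> G" and B: "B \<lhd> G" and MB: "M \<subseteq> B"
    and M1: "p'_index p {\<one>} M" and MBi: "p_index p M B"
  shows "B \<subseteq> F_p p G"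
proof
  note sub = normal_imp_subgroup
  let ?N = "O_p' p G"
  have N: "?N \<lhd> G" by (rule O_p'_normal)
  have "p'_group p (G\<lparr>carrier := M\<rparr>)" using M1 by (auto simp: p'_group_def p'_index_def order_def)
  then have MN: "M \<subseteq> ?N" using M unfolding O_p'_def by (auto intro: generate.incl)
  interpret f: finite_group_hom G "G Mod ?N" "(#>) ?N" by (rule Mod_hom[OF N])
  have "p_index p {\<one>\<^bsub>G Mod ?N\<^esub>} ((#>) ?N ` B)"
    using f.index_image(1)[OF p sub[OF M] sub[OF B] MB MBi] Mod_image_eq_one[OF N sub[OF M] MN] by simp
  then have "p_group p ((G Mod ?N)\<lparr>carrier := (#>) ?N ` B\<rparr>)"
    by (auto simp: p_group_def p_index_def order_def)
  moreover have "(#>) ?N ` B \<lhd> G Mod ?N" by (rule f.image_normal[OF B Mod_hom(3)[OF N]])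
  ultimately have *: "(#>) ?N ` B \<subseteq> O_p p (G Mod ?N)" unfolding O_p_def by (blast intro: generate.incl)
  fix b assume b: "b \<in> B"
  then have "?N #> b \<in> O_p p (G Mod ?N)" using * by blast
  then show "b \<in> F_p p G" using b normal_subset[OF B] by (auto simp: F_p_def quotient_preimage_def)
qed

text \<open>
  If the series has reached \<open>N\<close>, and \<open>B\<close> is \<open>p\<close>-nilpotent over a normal subgroup \<open>A\<close> of \<open>N\<close>, then the
  next term contains \<open>B\<close>; the image of \<open>B\<close> in \<open>G/N\<close> is a quotient of \<open>B/A\<close>.
\<close>

lemma F_p_step:
  assumes p: "Factorial_Ring.prime p" and N: "N \<lhd> G" and A: "A \<lhd> G" and AN: "A \<subseteq> N"
    and M: "M \<lhd> G" and B: "B \<lhd> G" and AM: "A \<subseteq> M" and MB: "M \<subseteq> B"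
    and AMi: "p'_index p A M" and MBi: "p_index p M B"
  shows "B \<subseteq> quotient_preimage G N (F_p p (G Mod N))"
proof
  note sub = normal_imp_subgroup
  interpret f: finite_group_hom G "G Mod N" "(#>) N" by (rule Mod_hom[OF N])
  interpret Q: finite_group "G Mod N" by (rule finite_group_Mod[OF N])
  note s = Mod_hom(3)[OF N]
  have *: "(#>) N ` B \<subseteq> F_p p (G Mod N)"
  proof (rule Q.F_p_contains[OF p f.image_normal[OF M s] f.image_normal[OF B s]])
    show "(#>) N ` M \<subseteq> (#>) N ` B" using MB by blast
    show "p'_index p {\<one>\<^bsub>G Mod N\<^esub>} ((#>) N ` M)"
      using f.index_image(2)[OF p sub[OF A] sub[OF M] AM AMi] Mod_image_eq_one[OF N sub[OF A] AN] by simp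
    show "p_index p ((#>) N ` M) ((#>) N ` B)" by (rule f.index_image(1)[OF p sub[OF M] sub[OF B] MB MBi])
  qed
  fix b assume b: "b \<in> B"
  then have "N #> b \<in> F_p p (G Mod N)" using * by blast
  then show "b \<in> quotient_preimage G N (F_p p (G Mod N))"
    using b normal_subset[OF B] by (auto simp: quotient_preimage_def)
qed

lemma quotient_preimage_F_p_normal: "N \<lhd> G \<Longrightarrow> quotient_preimage G N (F_p p (G Mod N)) \<lhd> G"
  by (rule quotient_preimage_normal(1)[OF _ finite_group.F_p_normal[OF finite_group_Mod]])

end

section \<open>The bound on the p-Fitting length\<close>

theorem theorem5p5:
  fixes G :: "('a, 'b) monoid_scheme" and p :: nat
  assumes "Factorial_Ring.prime p"
    and "group G" and "finite (carrier G)"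
    and "p_solvable p G"
    and "\<And>x. x \<in> carrier G \<Longrightarrow> group.ord G x = p \<Longrightarrow> x \<in> N_U_infinity p G"
    and "\<And>x. p = 2 \<Longrightarrow> x \<in> carrier G \<Longrightarrow> group.ord G x = 4 \<Longrightarrow> x \<in> N_U_infinity p G"
  shows "p_Fitting_length p G \<le> 3"
proof -
  note p = assms(1) and ps = assms(4)
  interpret G: finite_group G
    using assms(2,3) by (simp add: finite_group_def finite_group_axioms_def)
  note sub = normal_imp_subgroup
  obtain j where j: "N_U_infinity p G = N_U_series p G j" unfolding N_U_infinity_def by blast
  define K where "K = N_U_infinity p G"
  have K: "K \<lhd> G" unfolding K_def j by (rule G.N_U_series_normal)
  have elems: "x \<in> K" if x: "x \<in> carrier G" "x [^]\<^bsub>G\<^esub> (if p = 2 then 4 else p) = \<one>\<^bsub>G\<^esub>" for x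
  proof -
    have d: "G.ord x dvd (if p = 2 then 4 else p)" using G.pow_eq_id[OF x(1)] x(2) by blast
    have "G.ord x = 1 \<or> G.ord x = p \<or> (p = 2 \<and> G.ord x = 4)"
    proof (cases "p = 2")
      case True
      then have "G.ord x dvd 2 ^ 2" using d by simp
      then obtain i where i: "i \<le> 2" "G.ord x = 2 ^ i" using divides_primepow_nat[OF two_is_prime_nat] by blast
      then have "i = 0 \<or> i = 1 \<or> i = 2" by auto
      then show ?thesis using i(2) True by auto
    next
      case False
      then show ?thesis using d p by (auto simp: prime_nat_iff)
    qed
    then show ?thesis
    proof (elim disjE)
      assume "G.ord x = 1"
      then have "x = \<one>\<^bsub>G\<^esub>" using G.ord_eq_1[OF x(1)] by blast
      then show ?thesis using subgroup.one_closed[OF sub[OF K]] by simp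
    next
      assume "G.ord x = p"
      then show ?thesis unfolding K_def by (rule assms(5)[OF x(1)])
    next
      assume "p = 2 \<and> G.ord x = 4"
      then show ?thesis unfolding K_def using assms(6)[OF _ x(1)] by blast
    qed
  qed
  define R where "R = residual_above p G {\<one>\<^bsub>G\<^esub>}"
  have one: "{\<one>\<^bsub>G\<^esub>} \<subseteq> carrier G" by simp
  have R: "R \<lhd> G" "supersolvable_above p G R" unfolding R_def using G.residual_above_mem[OF one] by auto
  have cent: "R \<subseteq> section_centralizer G H L" if "chief_step G L H" "H \<subseteq> K" "p_index p L H" for L H
    unfolding R_def by (rule G.residual_centralizes_below_N_U_series[OF p ps that(1,3)]) (use that(2) K_def j in simp)
  obtain M where M: "M \<lhd> G" "M \<subseteq> R" "p'_index p {\<one>\<^bsub>G\<^esub>} M" "p_index p M R"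
    using G.p_nilpotent_if_centralizes_p_elements[OF p ps R(1) K cent elems] by blast
  define D where "D = {d \<in> carrier G. \<forall>K H. chief_step G K H \<longrightarrow> R \<subseteq> K \<longrightarrow> card H = p * card K \<longrightarrow>
      d \<in> section_centralizer G H K}"
  note D = G.p_chief_centralizers_p'_index[OF p R(1), folded D_def]
  have "\<exists>M. M \<lhd> G \<and> R \<subseteq> M \<and> M \<subseteq> D \<and> p'_index p R M \<and> p_index p M D"
  proof (rule G.p_nilpotent_section[OF p D(1) _ R(1) D(2)])
    fix K H assume KH: "chief_step G K H" "R \<subseteq> K" "H \<subseteq> D"
    have "card H = p * card K \<or> p'_index p K H" using R(2) KH by (auto simp: supersolvable_above_def)
    then show "p'_index p K H \<or> p_index p K H \<and> D \<subseteq> section_centralizer G H K"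
    proof
      assume c: "card H = p * card K"
      then have "p_index p K H" unfolding p_index_def by (intro exI[of _ 1]) simp
      moreover have "D \<subseteq> section_centralizer G H K" using KH(1,2) c unfolding D_def by blast
      ultimately show ?thesis by blast
    qed blast
  qed
  then obtain M' where M': "M' \<lhd> G" "R \<subseteq> M'" "M' \<subseteq> D" "p'_index p R M'" "p_index p M' D" by blast
  define F1 where "F1 = F_p p G"
  define F2 where "F2 = quotient_preimage G F1 (F_p p (G Mod F1))"
  define F3 where "F3 = quotient_preimage G F2 (F_p p (G Mod F2))"
  have F1: "F1 \<lhd> G" unfolding F1_def by (rule G.F_p_normal)
  have F2: "F2 \<lhd> G" unfolding F2_def by (rule G.quotient_preimage_F_p_normal[OF F1])
  have "R \<subseteq> F1" unfolding F1_def by (rule G.F_p_contains[OF p M(1) R(1) M(2-4)])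
  then have "D \<subseteq> F2"
    unfolding F2_def by (rule G.F_p_step[OF p F1 R(1) _ M'(1) D(1) M'(2-5)])
  then have "carrier G \<subseteq> F3"
    unfolding F3_def
    by (rule G.F_p_step[OF p F2 D(1) _ G.carrier_normal G.carrier_normal G.normal_subset[OF D(1)] _ D(3)]) auto
  moreover have "F3 \<subseteq> carrier G" by (auto simp: F3_def quotient_preimage_def)
  moreover have "F_p_series p G 3 = F3" by (simp add: numeral_3_eq_3 F1_def F2_def F3_def)
  ultimately have "0 < (3::nat) \<and> F_p_series p G 3 = carrier G" by simp
  then show ?thesis unfolding p_Fitting_length_def by (rule Least_le)
qed

end
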